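(* Let $(\Omega,\Sigma,p)$ be a probability measure space, let $k,n\in\mathbb{N}$ with $k\le n$ and let $X:\Omega\to\mathbb{R}^k$ be an absolutely continuous random variable with probability density function $f_X$. If $\phi:\mathbb{R}^k\to\mathbb{R}^n$ is a locally Lipschitz map such that $\operatorname{rank}(J\phi)=k$ a.e., then the probability measure $p_Y$ induced by the statistic $Y:=\phi\circ X$ is absolutely continuous with respect to the Hausdorff measure $\mathcal{H}^k$ on $\mathbb{R}^n$, i.e. $p_Y\ll\mathcal{H}^k$. Its Radon–Nikodym derivative $\frac{dp_Y}{d\mathcal{H}^k}$, defined through the relation $$p_Y(A)=p(Y^{-1}(A))=\int_A\frac{dp_Y}{d\mathcal{H}^k}(y)\,d\mathcal{H}^k(y)\qquad\text{for all Borel subsets } A\subseteq\mathbb{R}^n,$$ satisfies $$\frac{dp_Y}{d\mathcal{H}^k}(y)=\int_{\phi^{-1}(y)}f_X(x)\frac{1}{J_k\phi(x)}\,d\mathcal{H}^0(x)=\sum_{\phi(x)=y}f_X(x)\frac{1}{J_k\phi(x)}\qquad\text{for }\mathcal{H}^k\text{-a.e. } y\in\phi(\mathbb{R}^k),$$ and it is $0$ otherwise (i.e. for $y\notin\phi(\mathbb{R}^k)$). Moreover, suppose that there exists a countable disjoint covering $\bigcup_{i\in\mathbb{N}}E_i$ of a.e. point of $\mathbb{R}^k$ (i.e. the set of points of $\mathbb{R}^k$ which are not covered has $\mathcal{L}^k$-measure zero) such that on each measurable subset $E_i$ the restriction map $\phi_i:=\phi_{|E_i}$ is a.e. injective. Then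 $$\frac{dp_Y}{d\mathcal{H}^k}(y)=\sum_{i\in\mathbb{N}}f_X\big(\phi_i^{-1}(y)\big)\frac{1}{J_k\phi\big(\phi_i^{-1}(y)\big)}\qquad\text{for }\mathcal{H}^k\text{-a.e. } y\in\phi(\mathbb{R}^k),$$ where the $i$-th term is understood to be $0$ when $y\notin\phi_i(E_i)$.
   Context: For a random variable $X:\Omega\to\mathbb{R}^k$ (a measurable map), $p_X(A)=p(X^{-1}(A))$ for Borel $A\subseteq\mathbb{R}^k$ is the induced measure. $X$ is called absolutely continuous if $p_X\ll\mathcal{L}^k$ (Lebesgue measure); its density function is $f_X=dp_X/d\mathcal{L}^k\ge0$. "A.e." without further specification refers to Lebesgue measure. $\mathcal{H}^s$ is the $s$-dimensional Hausdorff measure: $\mathcal{H}^s(E)=\lim_{\epsilon\to0^+}\frac{\pi^{s/2}}{\Gamma(1+s/2)}\inf\sum_i r_i^s$, the infimum being over countable coverings of $E$ by balls $B(x_i,r_i)$ with $r_i\le\epsilon$. Thus $\mathcal{H}^0$ is the counting measure and $\mathcal{H}^n=\mathcal{L}^n$ on $\mathbb{R}^n$. A locally Lipschitz $\phi$ is differentiable a.e. (Rademacher), so its Jacobian matrix $J\phi(x)$ exists for a.e. $x$. The $k$-dimensional Jacobian is $$J_k\phi(x)=\sup\left\{\frac{\mathcal{H}^k(J\phi(x)(P))}{\mathcal{H}^k(P)} : P\text{ a } k\text{-dimensional parallelepiped of }\mathbb{R}^k\right\}=\sqrt{\det\big(J\phi(x)^t\,J\phi(x)\big)}.$$ "$\phi_i$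 is a.e. injective on $E_i$" means that $\phi$ is injective on $E_i$ minus an $\mathcal{L}^k$-null set; $\phi_i^{-1}(y)$ denotes the (for $\mathcal{H}^k$-a.e. $y\in\phi_i(E_i)$ unique) point of $E_i$ mapped to $y$. *)

theory Defs
  imports "HOL-Analysis.Analysis" "HOL-Probability.Probability"
begin

text \<open>
  Hausdorff measure via coverings by balls. A countable covering is a countable set of pairs
  (centre, radius), so finite coverings are included; radii are positive, so that for \<open>s = 0\<close>
  every ball contributes 1. The constant in \<open>hausdorff_outer_measure\<close> is the volume of the unit
  ball in dimension \<open>s\<close>.
\<close>

definition hausdorff_content :: "real \<Rightarrow> real \<Rightarrow> 'a::metric_space set \<Rightarrow> ennreal" where
  "hausdorff_content s \<epsilon> E =
     (INF C \<in> {C. countable C \<and> (\<forall>(x, r) \<in> C. 0 < r \<and> r \<le> \<epsilon>) \<and> E \<subseteq> (\<Union>(x, r) \<in> C. ball x r)}.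
        \<Sum>\<^sub>\<infinity>(x, r) \<in> C. ennreal (r powr s))"

definition hausdorff_outer_measure :: "real \<Rightarrow> 'a::metric_space set \<Rightarrow> ennreal" where
  "hausdorff_outer_measure s E =
     Lim (at_right 0)
       (\<lambda>\<epsilon>. ennreal (pi powr (s / 2) / Gamma (1 + s / 2)) * hausdorff_content s \<epsilon> E)"

text \<open>
  The restriction of the outer measure to the Borel sets. The lemma
  \<open>emeasure_hausdorff_measure\<close> below shows that this really is a measure, so that
  \<^const>\<open>measure_of\<close> does not return its default value.
\<close>

definition hausdorff_measure :: "real \<Rightarrow> 'a::metric_space measure" where
  "hausdorff_measure s = measure_of UNIV (sets borel) (hausdorff_outer_measure s)"

lemma space_hausdorff_measure [simp]: "space (hausdorff_measure s) = UNIV"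
  by (simp add: hausdorff_measure_def)

lemma sets_hausdorff_measure [simp, measurable_cong]: "sets (hausdorff_measure s) = sets borel"
  by (simp add: hausdorff_measure_def sets.sigma_sets_eq[of borel, simplified])

lemma hausdorff_content_mono:
  "E \<subseteq> F \<Longrightarrow> \<epsilon> \<le> \<delta> \<Longrightarrow> hausdorff_content s \<delta> E \<le> hausdorff_content s \<epsilon> F"
  unfolding hausdorff_content_def by (rule INF_superset_mono) (fastforce)+

lemma tendsto_hausdorff_content_SUP:
  "((\<lambda>\<epsilon>. c * hausdorff_content s \<epsilon> E) \<longlongrightarrow> (SUP \<epsilon>\<in>{0<..}. c * hausdorff_content s \<epsilon> E))
     (at_right 0)"
proof (rule order_tendstoI)
  fix a assume "a < (SUP \<epsilon>\<in>{0<..}. c * hausdorff_content s \<epsilon> E)"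
  then obtain d where d: "d > 0" "a < c * hausdorff_content s d E"
    by (auto simp: less_SUP_iff)
  have "a < c * hausdorff_content s \<epsilon> E" if "\<epsilon> \<in> {0<..<d}" for \<epsilon>
    using that d(2) hausdorff_content_mono[of E E \<epsilon> d s]
    by (metis greaterThanLessThan_iff less_eq_real_def mult_left_mono order.strict_trans2
        order_refl zero_le)
  then show "\<forall>\<^sub>F \<epsilon> in at_right 0. a < c * hausdorff_content s \<epsilon> E"
    unfolding eventually_at_right_field using d(1) by auto
next
  fix a assume a: "(SUP \<epsilon>\<in>{0<..}. c * hausdorff_content s \<epsilon> E) < a"
  have "c * hausdorff_content s \<epsilon> E < a" if "\<epsilon> > 0" for \<epsilon>
    by (rule le_less_trans[OF _ a], rule SUP_upper) (use that in auto)
  then show "\<forall>\<^sub>F \<epsilon> in at_right 0. c * hausdorff_content s \<epsilon> E < a"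
    unfolding eventually_at_right_field by (auto intro!: exI[of _ 1])
qed

lemma hausdorff_outer_measure_eq_SUP:
  "hausdorff_outer_measure s E =
     (SUP \<epsilon>\<in>{0<..}. ennreal (pi powr (s / 2) / Gamma (1 + s / 2)) * hausdorff_content s \<epsilon> E)"
  unfolding hausdorff_outer_measure_def
  by (rule tendsto_Lim[OF _ tendsto_hausdorff_content_SUP]) simp

lemma tendsto_hausdorff_outer_measure:
  "((\<lambda>\<epsilon>. ennreal (pi powr (s / 2) / Gamma (1 + s / 2)) * hausdorff_content s \<epsilon> E)
     \<longlongrightarrow> hausdorff_outer_measure s E) (at_right 0)"
  unfolding hausdorff_outer_measure_eq_SUP by (rule tendsto_hausdorff_content_SUP)

lemma hausdorff_outer_measure_mono:
  "E \<subseteq> F \<Longrightarrow> hausdorff_outer_measure s E \<le> hausdorff_outer_measure s F"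
  unfolding hausdorff_outer_measure_eq_SUP
  by (intro SUP_mono') (auto intro!: mult_left_mono hausdorff_content_mono)

lemma hausdorff_content_empty [simp]: "hausdorff_content s \<epsilon> {} = 0"
proof -
  have "hausdorff_content s \<epsilon> {} \<le> 0"
    unfolding hausdorff_content_def by (rule INF_lower2[of "{}"]) auto
  then show ?thesis by simp
qed

lemma hausdorff_outer_measure_empty [simp]: "hausdorff_outer_measure s {} = 0"
  by (simp add: hausdorff_outer_measure_eq_SUP)

lemma infsum_ennreal_SUP:
  fixes f :: "'a \<Rightarrow> ennreal"
  shows "infsum f A = (SUP F\<in>{F. finite F \<and> F \<subseteq> A}. sum f F)"
  by (rule nonneg_infsum_complete) auto

lemma infsum_ennreal_UN_le:
  fixes f :: "'a \<Rightarrow> ennreal"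
  shows "infsum f (\<Union>n. C n) \<le> (\<Sum>n::nat. infsum f (C n))"
  unfolding infsum_ennreal_SUP[of f "\<Union>n. C n"]
proof (rule SUP_least, clarify)
  fix F assume F: "finite F" "F \<subseteq> (\<Union>n. C n)"
  have "sum f F \<le> (\<Sum>x\<in>F. \<Sum>n. if x \<in> C n then f x else 0)"
  proof (rule sum_mono)
    fix x assume "x \<in> F"
    then obtain n where "x \<in> C n" using F by auto
    then have "f x = (\<Sum>m\<in>{n}. if x \<in> C m then f x else 0)" by simp
    also have "\<dots> \<le> (\<Sum>n. if x \<in> C n then f x else 0)"
      by (rule sum_le_suminf) auto
    finally show "f x \<le> (\<Sum>n. if x \<in> C n then f x else 0)" .
  qed
  also have "\<dots> = (\<Sum>n. \<Sum>x\<in>F. if x \<in> C n then f x else 0)"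
    by (rule suminf_sum[symmetric]) auto
  also have "\<dots> \<le> (\<Sum>n. infsum f (C n))"
  proof (rule suminf_le)
    fix n
    have "(\<Sum>x\<in>F. if x \<in> C n then f x else 0) = sum f (F \<inter> C n)"
      using F by (simp add: sum.inter_restrict)
    also have "\<dots> \<le> infsum f (C n)"
      unfolding infsum_ennreal_SUP by (rule SUP_upper) (use F in auto)
    finally show "(\<Sum>x\<in>F. if x \<in> C n then f x else 0) \<le> infsum f (C n)" .
  qed auto
  finally show "sum f F \<le> (\<Sum>n. infsum f (C n))" .
qed

lemma hausdorff_content_subadditive:
  "hausdorff_content s \<epsilon> (\<Union>n. A n) \<le> (\<Sum>n::nat. hausdorff_content s \<epsilon> (A n))"
proof (rule ennreal_le_epsilon)
  fix e :: real assume fin: "(\<Sum>n. hausdorff_content s \<epsilon> (A n)) < top" and e: "0 < e"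
  let ?f = "\<lambda>(x, r). ennreal (r powr s)"
  let ?cov = "\<lambda>E. {C. countable C \<and> (\<forall>(x, r) \<in> C. 0 < r \<and> r \<le> \<epsilon>) \<and> E \<subseteq> (\<Union>(x, r) \<in> C. ball x r)}"
  have "\<exists>C\<in>?cov (A n). infsum ?f C < hausdorff_content s \<epsilon> (A n) + ennreal (e * (1/2) ^ Suc n)" for n
  proof -
    have "hausdorff_content s \<epsilon> (A n) < top"
      using fin ennreal_suminf_lessD by blast
    then have "hausdorff_content s \<epsilon> (A n) < hausdorff_content s \<epsilon> (A n) + ennreal (e * (1/2) ^ Suc n)"
      using e by (cases "hausdorff_content s \<epsilon> (A n)")
        (auto simp flip: ennreal_plus intro!: ennreal_lessI add_nonneg_pos)
    then show ?thesis
      unfolding hausdorff_content_def[of s \<epsilon> "A n"] INF_less_iff by simp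
  qed
  then have "\<forall>n. \<exists>C. C \<in> ?cov (A n) \<and>
      infsum ?f C < hausdorff_content s \<epsilon> (A n) + ennreal (e * (1/2) ^ Suc n)"
    unfolding Bex_def by (rule allI)
  from choice[OF this] obtain C where C0: "\<forall>n. C n \<in> ?cov (A n) \<and>
      infsum ?f (C n) < hausdorff_content s \<epsilon> (A n) + ennreal (e * (1/2) ^ Suc n)" ..
  have C: "C n \<in> ?cov (A n)"
    "infsum ?f (C n) < hausdorff_content s \<epsilon> (A n) + ennreal (e * (1/2) ^ Suc n)" for n
    using C0[THEN spec, of n] by (rule conjunct1, rule conjunct2)
  have "hausdorff_content s \<epsilon> (\<Union>n. A n) \<le> infsum ?f (\<Union>n. C n)"
    unfolding hausdorff_content_def
  proof (rule INF_lower)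
    show "(\<Union>n. C n) \<in> ?cov (\<Union>n. A n)" using C(1) by fastforce
  qed
  also have "\<dots> \<le> (\<Sum>n. infsum ?f (C n))" by (rule infsum_ennreal_UN_le)
  also have "\<dots> \<le> (\<Sum>n. hausdorff_content s \<epsilon> (A n) + ennreal (e * (1/2) ^ Suc n))"
    by (intro suminf_le less_imp_le[OF C(2)]) auto
  also have "\<dots> = (\<Sum>n. hausdorff_content s \<epsilon> (A n)) + (\<Sum>n. ennreal (e * (1/2) ^ Suc n))"
    by (rule suminf_add[symmetric]) auto
  also have "(\<Sum>n. ennreal (e * (1/2) ^ Suc n)) = ennreal e"
    using e sums_mult[OF power_half_series, of e]
    by (subst suminf_ennreal2) (auto simp: sums_iff)
  finally show "hausdorff_content s \<epsilon> (\<Union>n. A n) \<le> (\<Sum>n. hausdorff_content s \<epsilon> (A n)) + ennreal e" .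
qed

lemma hausdorff_outer_measure_subadditive:
  "hausdorff_outer_measure s (\<Union>n. A n) \<le> (\<Sum>n::nat. hausdorff_outer_measure s (A n))"
  unfolding hausdorff_outer_measure_eq_SUP[of s "\<Union>n. A n"]
proof (rule SUP_least)
  fix \<epsilon> :: real assume e: "\<epsilon> \<in> {0<..}"
  let ?c = "ennreal (pi powr (s / 2) / Gamma (1 + s / 2))"
  have "?c * hausdorff_content s \<epsilon> (\<Union>n. A n) \<le> ?c * (\<Sum>n. hausdorff_content s \<epsilon> (A n))"
    by (intro mult_left_mono hausdorff_content_subadditive) auto
  also have "\<dots> = (\<Sum>n. ?c * hausdorff_content s \<epsilon> (A n))" by simp
  also have "\<dots> \<le> (\<Sum>n. hausdorff_outer_measure s (A n))"
    unfolding hausdorff_outer_measure_eq_SUP by (intro suminf_le SUP_upper e) auto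
  finally show "?c * hausdorff_content s \<epsilon> (\<Union>n. A n) \<le> (\<Sum>n. hausdorff_outer_measure s (A n))" .
qed

lemma outer_measure_space_hausdorff:
  "outer_measure_space UNIV (hausdorff_outer_measure s)"
  by (auto simp: outer_measure_space_def positive_def increasing_def countably_subadditive_def
      hausdorff_outer_measure_mono hausdorff_outer_measure_subadditive)

lemma hausdorff_outer_measure_Un:
  "hausdorff_outer_measure s (E \<union> F) \<le> hausdorff_outer_measure s E + hausdorff_outer_measure s F"
proof -
  define W where "W n = (if n = 0 then E else if n = 1 then F else {})" for n :: nat
  have "E \<union> F = (\<Union>n. W n)" by (auto simp: W_def split: if_splits)
  then have "hausdorff_outer_measure s (E \<union> F) \<le> (\<Sum>n. hausdorff_outer_measure s (W n))"
    using hausdorff_outer_measure_subadditive[of s W] by simp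
  also have "\<dots> = (\<Sum>n\<in>{0,1}. hausdorff_outer_measure s (W n))"
    by (rule suminf_finite) (auto simp: W_def)
  finally show ?thesis by (simp add: W_def)
qed

lemma hausdorff_content_separated:
  assumes d: "\<And>x y. x \<in> E \<Longrightarrow> y \<in> F \<Longrightarrow> d \<le> dist x y" and e: "2 * \<epsilon> \<le> d"
  shows "hausdorff_content s \<epsilon> E + hausdorff_content s \<epsilon> F \<le> hausdorff_content s \<epsilon> (E \<union> F)"
  unfolding hausdorff_content_def[of s \<epsilon> "E \<union> F"]
proof (rule INF_greatest, clarify)
  fix C :: "('a \<times> real) set"
  assume C: "countable C" "\<forall>(x, r) \<in> C. 0 < r \<and> r \<le> \<epsilon>" "E \<union> F \<subseteq> (\<Union>(x, r) \<in> C. ball x r)"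
  let ?f = "\<lambda>(x, r). ennreal (r powr s)"
  define C1 where "C1 = {(x, r) \<in> C. ball x r \<inter> E \<noteq> {}}"
  have 1: "hausdorff_content s \<epsilon> E \<le> infsum ?f C1"
    unfolding hausdorff_content_def
  proof (rule INF_lower, clarify, intro conjI)
    show "countable C1" by (rule countable_subset[OF _ C(1)]) (auto simp: C1_def)
    show "\<forall>(x, r) \<in> C1. 0 < r \<and> r \<le> \<epsilon>" using C(2) by (auto simp: C1_def)
    show "E \<subseteq> (\<Union>(x, r) \<in> C1. ball x r)" using C(3) by (fastforce simp: C1_def)
  qed
  have 2: "hausdorff_content s \<epsilon> F \<le> infsum ?f (C - C1)"
    unfolding hausdorff_content_def
  proof (rule INF_lower, clarify, intro conjI)
    show "countable (C - C1)" using C(1) by simp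
    show "\<forall>(x, r) \<in> C - C1. 0 < r \<and> r \<le> \<epsilon>" using C(2) by auto
    show "F \<subseteq> (\<Union>(x, r) \<in> C - C1. ball x r)"
    proof
      fix y assume y: "y \<in> F"
      then obtain x r where xr: "(x, r) \<in> C" "y \<in> ball x r" using C(3) by blast
      have "(x, r) \<notin> C1"
      proof
        assume "(x, r) \<in> C1"
        then obtain z where z: "z \<in> E" "dist x z < r" by (auto simp: C1_def)
        have "dist z y < 2 * r" using xr(2) z(2) dist_triangle3[of z y x] by simp
        with d[OF z(1) y] e C(2) xr(1) show False by fastforce
      qed
      with xr show "y \<in> (\<Union>(x, r) \<in> C - C1. ball x r)" by blast
    qed
  qed
  have "C = C1 \<union> (C - C1)" by (auto simp: C1_def)
  then have "infsum ?f C = infsum ?f (C1 \<union> (C - C1))" by (rule arg_cong)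
  also have "\<dots> = infsum ?f C1 + infsum ?f (C - C1)"
    by (rule infsum_Un_disjoint) (auto intro!: nonneg_summable_on_complete)
  finally show "hausdorff_content s \<epsilon> E + hausdorff_content s \<epsilon> F \<le> infsum ?f C"
    using add_mono[OF 1 2] by simp
qed

lemma hausdorff_outer_measure_separated:
  assumes "\<And>x y. x \<in> E \<Longrightarrow> y \<in> F \<Longrightarrow> d \<le> dist x y" and "0 < d"
  shows "hausdorff_outer_measure s E + hausdorff_outer_measure s F \<le> hausdorff_outer_measure s (E \<union> F)"
proof (rule tendsto_le)
  let ?c = "ennreal (pi powr (s / 2) / Gamma (1 + s / 2))"
  show "((\<lambda>\<epsilon>. ?c * hausdorff_content s \<epsilon> (E \<union> F)) \<longlongrightarrow> hausdorff_outer_measure s (E \<union> F)) (at_right 0)"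
    by (rule tendsto_hausdorff_outer_measure)
  show "((\<lambda>\<epsilon>. ?c * hausdorff_content s \<epsilon> E + ?c * hausdorff_content s \<epsilon> F) \<longlongrightarrow>
    hausdorff_outer_measure s E + hausdorff_outer_measure s F) (at_right 0)"
    by (intro tendsto_add tendsto_hausdorff_outer_measure)
  have "?c * hausdorff_content s \<epsilon> E + ?c * hausdorff_content s \<epsilon> F \<le> ?c * hausdorff_content s \<epsilon> (E \<union> F)"
    if "\<epsilon> < d / 2" for \<epsilon>
    using hausdorff_content_separated[OF assms(1), where \<epsilon>=\<epsilon> and s=s] that
    by (simp add: mult_left_mono flip: distrib_left)
  then show "\<forall>\<^sub>F \<epsilon> in at_right 0. ?c * hausdorff_content s \<epsilon> E + ?c * hausdorff_content s \<epsilon> F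
      \<le> ?c * hausdorff_content s \<epsilon> (E \<union> F)"
    unfolding eventually_at_right_field using \<open>0 < d\<close> by (intro exI[of _ "d / 2"]) auto
qed simp


lemma closed_lambda_system_hausdorff:
  assumes "closed A"
  shows "A \<in> lambda_system UNIV UNIV (hausdorff_outer_measure s)"
proof -
  let ?H = "hausdorff_outer_measure s"
  have le: "?H (X \<inter> A) + ?H (X - A) \<le> ?H X" for X
  proof (cases "A = {} \<or> ?H X = top")
    case True
    then show ?thesis by (auto simp: top_greatest)
  next
    case False
    then have ne: "A \<noteq> {}" and fin: "?H X \<noteq> top" by auto
    define G where "G n = {x \<in> X. 1 / real (Suc n) \<le> infdist x A}" for n
    define D where "D n = G (Suc n) - G n" for n
    have XA: "?H (X \<inter> A) + ?H (G n) \<le> ?H X" for n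
    proof -
      have "?H (X \<inter> A) + ?H (G n) \<le> ?H ((X \<inter> A) \<union> G n)"
      proof (rule hausdorff_outer_measure_separated)
        fix x y assume "x \<in> X \<inter> A" "y \<in> G n"
        then show "1 / real (Suc n) \<le> dist x y"
          using infdist_le[of x A y] by (auto simp: G_def dist_commute)
      qed simp
      also have "\<dots> \<le> ?H X" by (rule hausdorff_outer_measure_mono) (auto simp: G_def)
      finally show ?thesis .
    qed
    have alt: "(\<Sum>j<N. ?H (D (2 * j + p))) \<le> ?H (\<Union>j<N. D (2 * j + p))" for N p
    proof (induction N)
      case (Suc N)
      have sep: "?H (\<Union>j<N. D (2 * j + p)) + ?H (D (2 * N + p)) \<le>
        ?H ((\<Union>j<N. D (2 * j + p)) \<union> D (2 * N + p))"
      proof (cases "N = 0")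
        case False
        show ?thesis
        proof (rule hausdorff_outer_measure_separated)
          show "0 < 1 / real (2 * N + p) - 1 / real (2 * N + p + 1)"
            using False by (simp add: frac_less2)
          fix x y assume "x \<in> (\<Union>j<N. D (2 * j + p))" and y: "y \<in> D (2 * N + p)"
          then obtain j where j: "j < N" "x \<in> D (2 * j + p)" by auto
          have "1 / real (2 * N + p) \<le> 1 / real (Suc (Suc (2 * j + p)))"
            using j(1) by (intro divide_left_mono) (auto simp flip: of_nat_add of_nat_mult)
          also have "\<dots> \<le> infdist x A" using j(2) by (simp add: D_def G_def)
          finally have 1: "1 / real (2 * N + p) \<le> infdist x A" .
          have 2: "infdist y A < 1 / real (2 * N + p + 1)" using y by (auto simp: D_def G_def)
          show "1 / real (2 * N + p) - 1 / real (2 * N + p + 1) \<le> dist x y"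
            using 1 2 infdist_triangle[of x A y] by linarith
        qed
      qed simp
      have "(\<Sum>j<Suc N. ?H (D (2 * j + p))) \<le> ?H (\<Union>j<N. D (2 * j + p)) + ?H (D (2 * N + p))"
        using Suc.IH by (simp add: add_right_mono)
      also note sep
      also have "(\<Union>j<N. D (2 * j + p)) \<union> D (2 * N + p) = (\<Union>j<Suc N. D (2 * j + p))"
        by (auto simp: lessThan_Suc)
      finally show ?case .
    qed simp
    have alt_le: "(\<Sum>j<N. ?H (D (2 * j + p))) \<le> ?H X" for N p
      by (rule order_trans[OF alt hausdorff_outer_measure_mono]) (auto simp: D_def G_def)
    have "(\<Sum>n<2 * N. ?H (D n)) = (\<Sum>j<N. ?H (D (2 * j + 0))) + (\<Sum>j<N. ?H (D (2 * j + 1)))" for N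
      by (induction N) (auto simp: algebra_simps)
    then have "(\<Sum>n<2 * N. ?H (D n)) \<le> ?H X + ?H X" for N
      using add_mono[OF alt_le[of 0 N] alt_le[of 1 N]] by simp
    moreover have "(\<Sum>n<N. ?H (D n)) \<le> (\<Sum>n<2 * N. ?H (D n))" for N
      by (rule sum_mono2) auto
    ultimately have "(\<Sum>n. ?H (D n)) \<le> ?H X + ?H X"
      by (intro suminf_le_const) (auto intro: order_trans)
    then have sfin: "(\<Sum>n. ?H (D n)) < top"
      using fin by (metis ennreal_add_less_top less_top order.strict_trans1)
    have cover: "?H (X - A) \<le> ?H (G n) + (\<Sum>i. ?H (D (i + n)))" for n
    proof -
      have "X - A \<subseteq> G n \<union> (\<Union>i. D (i + n))"
      proof
        fix x assume x: "x \<in> X - A"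
        then have "0 < infdist x A"
          using in_closed_iff_infdist_zero[OF assms ne, of x] infdist_nonneg[of x A] by auto
        then obtain m where m: "1 / real (Suc m) < infdist x A"
          using nat_approx_posE by metis
        define k where "k = (LEAST k. x \<in> G k)"
        have "x \<in> G m" using x m by (auto simp: G_def)
        then have k: "x \<in> G k" unfolding k_def by (rule LeastI)
        show "x \<in> G n \<union> (\<Union>i. D (i + n))"
        proof (cases "k \<le> n")
          case True
          have "1 / real (Suc n) \<le> 1 / real (Suc k)"
            using True by (intro divide_left_mono) auto
          with k have "x \<in> G n" by (auto simp: G_def)
          then show ?thesis by simp
        next
          case False
          then obtain i where i: "k = Suc (i + n)"
            by (metis add.commute less_imp_Suc_add not_le)
          have "x \<notin> G (i + n)"
            using not_less_Least[of "i + n" "\<lambda>k. x \<in> G k"] i by (simp add: k_def)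
          with k i have "x \<in> D (i + n)" by (simp add: D_def)
          then show ?thesis by blast
        qed
      qed
      then have "?H (X - A) \<le> ?H (G n \<union> (\<Union>i. D (i + n)))"
        by (rule hausdorff_outer_measure_mono)
      also have "\<dots> \<le> ?H (G n) + ?H (\<Union>i. D (i + n))"
        by (rule hausdorff_outer_measure_Un)
      also have "\<dots> \<le> ?H (G n) + (\<Sum>i. ?H (D (i + n)))"
        by (intro add_left_mono hausdorff_outer_measure_subadditive)
      finally show ?thesis .
    qed
    have tail: "(\<lambda>n. \<Sum>i. ?H (D (i + n))) \<longlonglongrightarrow> 0"
    proof -
      have f: "ennreal (enn2real (?H (D n))) = ?H (D n)" for n
        using ennreal_suminf_lessD[OF sfin, of n] by simp
      have sm: "summable (\<lambda>n. enn2real (?H (D n)))"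
        using sfin by (intro summable_suminf_not_top) (auto simp: f)
      have "(\<lambda>n. ennreal (\<Sum>i. enn2real (?H (D (i + n))))) \<longlonglongrightarrow> ennreal 0"
        by (intro tendsto_ennrealI suminf_exist_split2 sm)
      also have "(\<lambda>n. ennreal (\<Sum>i. enn2real (?H (D (i + n))))) = (\<lambda>n. \<Sum>i. ?H (D (i + n)))"
        using sm by (subst suminf_ennreal2[symmetric]) (auto simp: f intro: summable_ignore_initial_segment)
      finally show ?thesis by simp
    qed
    show ?thesis
    proof (rule tendsto_lowerbound)
      show "(\<lambda>n. ?H X + (\<Sum>i. ?H (D (i + n)))) \<longlonglongrightarrow> ?H X"
        using tendsto_add[OF tendsto_const tail, of "?H X"] by simp
      have "?H (X \<inter> A) + ?H (X - A) \<le> ?H X + (\<Sum>i. ?H (D (i + n)))" for n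
      proof -
        have "?H (X \<inter> A) + ?H (X - A) \<le> ?H (X \<inter> A) + (?H (G n) + (\<Sum>i. ?H (D (i + n))))"
          by (intro add_left_mono cover)
        also have "\<dots> = (?H (X \<inter> A) + ?H (G n)) + (\<Sum>i. ?H (D (i + n)))"
          by (simp add: add.assoc)
        also have "\<dots> \<le> ?H X + (\<Sum>i. ?H (D (i + n)))" by (intro add_right_mono XA)
        finally show ?thesis .
      qed
      then show "\<forall>\<^sub>F n in sequentially. ?H (X \<inter> A) + ?H (X - A) \<le> ?H X + (\<Sum>i. ?H (D (i + n)))"
        by simp
    qed simp
  qed
  have "?H (A \<inter> X) + ?H (- A \<inter> X) = ?H X" for X
  proof (rule antisym)
    show "?H (A \<inter> X) + ?H (- A \<inter> X) \<le> ?H X"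
      using le[of X] by (simp add: Int_commute Diff_eq)
    have "?H X = ?H ((A \<inter> X) \<union> (- A \<inter> X))" by (rule arg_cong[where f="?H"]) auto
    then show "?H X \<le> ?H (A \<inter> X) + ?H (- A \<inter> X)"
      using hausdorff_outer_measure_Un[of s "A \<inter> X" "- A \<inter> X"] by simp
  qed
  then show ?thesis by (auto simp: lambda_system_def Compl_eq_Diff_UNIV)
qed

lemma emeasure_hausdorff_measure:
  assumes "A \<in> sets borel"
  shows "emeasure (hausdorff_measure s) A = hausdorff_outer_measure s A"
proof -
  let ?H = "hausdorff_outer_measure s :: 'a set \<Rightarrow> ennreal"
  have ms: "measure_space UNIV (lambda_system UNIV UNIV ?H) ?H"
    using sigma_algebra.caratheodory_lemma[OF sigma_algebra_Pow[of UNIV], of ?H]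
    by (simp add: outer_measure_space_hausdorff)
  then have "sigma_algebra UNIV (lambda_system UNIV UNIV ?H)"
    by (simp add: measure_space_def)
  then have "sigma_sets UNIV (Collect closed) \<subseteq> lambda_system UNIV UNIV ?H"
    by (rule sigma_algebra.sigma_sets_subset) (auto intro: closed_lambda_system_hausdorff)
  then have sub: "sets borel \<subseteq> lambda_system UNIV UNIV ?H"
    by (simp add: borel_eq_closed)
  have "sigma_algebra UNIV (sets (borel :: 'a measure))"
    by (metis sets.sigma_algebra_axioms space_borel)
  then have "measure_space UNIV (sets borel) ?H"
    using measure_down[OF ms _ sub] by simp
  then show ?thesis
    unfolding hausdorff_measure_def using assms
    by (intro emeasure_measure_of_sigma) (auto simp: measure_space_def)
qed

text \<open>
  A property of an arbitrary version \<open>g\<close> of the derivative of \<open>\<nu>\<close> with respect to \<open>\<mu>\<close>;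
  \<^const>\<open>RN_deriv\<close> would pick one version.
\<close>

definition is_RN_derivative :: "'a measure \<Rightarrow> 'a measure \<Rightarrow> ('a \<Rightarrow> ennreal) \<Rightarrow> bool" where
  "is_RN_derivative \<mu> \<nu> g \<longleftrightarrow>
     g \<in> borel_measurable \<mu> \<and> (\<forall>A \<in> sets \<mu>. emeasure \<nu> A = (\<integral>\<^sup>+y\<in>A. g y \<partial>\<mu>))"

definition k_jacobian :: "(real^'k \<Rightarrow> real^'n) \<Rightarrow> real^'k \<Rightarrow> real" where
  "k_jacobian \<phi> x = sqrt (det (transpose (jacobian \<phi> (at x)) ** jacobian \<phi> (at x)))"

definition locally_lipschitz :: "('a::metric_space \<Rightarrow> 'b::metric_space) \<Rightarrow> bool" where
  "locally_lipschitz \<phi> \<longleftrightarrow> (\<forall>x. \<exists>u>0. \<exists>L. L-lipschitz_on (ball x u) \<phi>)"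

definition ae_inj_on :: "('a::euclidean_space \<Rightarrow> 'b) \<Rightarrow> 'a set \<Rightarrow> bool" where
  "ae_inj_on \<phi> E \<longleftrightarrow> (\<exists>N \<in> null_sets lebesgue. inj_on \<phi> (E - N))"

end

theory Submission
  imports Defs
begin

text \<open>
  The theorem is the area formula in disguise. Suppose that \<open>C\<close> is a set on which \<open>\<phi>\<close> is injective
  and differentiable with injective derivative. If \<open>\<H>\<^sup>k(\<phi>(A)) = \<integral>\<^sub>A J\<^sub>k\<phi>\<close> for all measurable \<open>A \<subseteq> C\<close>, then
  \<open>\<H>\<^sup>k\<close> on \<open>\<phi>(C)\<close> is the image under \<open>\<phi>\<close> of the measure with density \<open>J\<^sub>k\<phi>\<close> on \<open>C\<close>
  (\<open>area_transform_injective\<close>), so the image of the measure \<open>f(x) dx\<close> on \<open>C\<close> has density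
  \<open>f / J\<^sub>k\<phi>\<close>, read off at the preimage. Almost all of \<open>\<real>\<^sup>k\<close> is a countable disjoint union of such
  sets \<open>C\<close>; adding their contributions gives the sum over the fibre. The points that are left out form a
  null set, and \<open>\<phi>\<close> maps null sets to \<open>\<H>\<^sup>k\<close>-null sets, so they are invisible in the target; the same
  remark turns the sum over the fibre into the sum over any other partition into sets of a.e. injectivity.
  The measure \<open>\<H>\<^sup>k\<close> is not \<open>\<sigma>\<close>-finite on \<open>\<real>\<^sup>n\<close> in general, but two derivatives of the same
  \<^emph>\<open>finite\<close> measure still agree almost everywhere.

  The area formula (\<open>area_formula_injective\<close>) rests on three facts.

  \<^item> Measure of Lipschitz images: an \<open>L\<close>-Lipschitz map of a measurable subset of \<open>\<real>\<^sup>k\<close> satisfies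
    \<open>\<H>\<^sup>k(\<psi>(A)) \<le> L\<^sup>k \<L>\<^sup>k(A)\<close> (\<open>hausdorff_lipschitz_image_le\<close>), by Vitali's theorem with balls centred
    in \<open>A\<close>. Conversely \<open>\<L>\<^sup>k \<le> \<H>\<^sup>k\<close> on \<open>\<real>\<^sup>k\<close> (\<open>lebesgue_le_hausdorff\<close>), and \<open>\<H>\<^sup>k\<close> does not increase
    under contractions of the whole space. Lower bounds for \<open>\<H>\<^sup>k(\<phi>(A))\<close> come from applying a linear
    contraction \<open>Q : \<real>\<^sup>n \<rightarrow> \<real>\<^sup>k\<close> first; this avoids the isodiametric inequality.

  \<^item> Rademacher's theorem (\<open>rademacher\<close>): at almost no point can a bi-Lipschitz increasing function of
    one variable stretch some arbitrarily short intervals by at least \<open>q\<close> and others by at most \<open>p < q\<close>.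
    Fubini gives directional derivatives almost everywhere, integration over boxes shows that they
    are additive in the direction, and equicontinuity of the difference quotients does the rest.

  \<^item> Linearisation (\<open>near_linear_decomposition\<close>): for \<open>t > 1\<close> the points with injective derivative are
    covered by countably many sets on which \<open>|\<phi> x - \<phi> y| \<le> t |S (x - y)| \<le> t\<^sup>2 |Q (\<phi> x - \<phi> y)|\<close> for a
    linear bijection \<open>S\<close> of \<open>\<real>\<^sup>k\<close>. On such a set both \<open>J\<^sub>k\<phi>\<close> and the ratio of \<open>\<H>\<^sup>k(\<phi>(A))\<close> to \<open>\<L>\<^sup>k(A)\<close>
    differ from \<open>|det S|\<close> by a factor of at most \<open>t\<^sup>k\<close>. Summing over the pieces and letting
    \<open>t \<rightarrow> 1\<close> proves the formula.
\<close>

section \<open>Hausdorff measure of Lipschitz images\<close>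

lemma infsum_ennreal_mono_set:
  fixes f :: "'i \<Rightarrow> ennreal"
  assumes "A \<subseteq> B"
  shows "infsum f A \<le> infsum f B"
  unfolding infsum_ennreal_SUP by (rule SUP_subset_mono) (use assms in auto)

text \<open>
  A cover indexed by a family may repeat a ball, whereas the definition counts a set of pairs;
  choosing one index per pair can only decrease the sum.
\<close>

lemma hausdorff_content_le_infsum:
  fixes x :: "'i \<Rightarrow> 'a::metric_space"
  assumes I: "countable I" and r: "\<And>i. i \<in> I \<Longrightarrow> 0 < r i \<and> r i \<le> \<epsilon>"
    and E: "E \<subseteq> (\<Union>i\<in>I. ball (x i) (r i))"
  shows "hausdorff_content s \<epsilon> E \<le> infsum (\<lambda>i. ennreal (r i powr s)) I"
proof -
  let ?h = "\<lambda>i. (x i, r i)" and ?f = "\<lambda>(y, t). ennreal (t powr s)"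
  obtain J where J: "J \<subseteq> I" "inj_on ?h J" "?h ` I = ?h ` J"
    using subset_image_inj[of "?h ` I" ?h I] by auto
  have "hausdorff_content s \<epsilon> E \<le> infsum ?f (?h ` I)"
    unfolding hausdorff_content_def using I r E by (intro INF_lower) auto
  also have "\<dots> = infsum (?f \<circ> ?h) J"
    unfolding J(3) by (rule infsum_reindex[OF J(2)])
  also have "\<dots> \<le> infsum (?f \<circ> ?h) I"
    by (rule infsum_ennreal_mono_set[OF J(1)])
  finally show ?thesis by (simp add: o_def)
qed

lemma hausdorff_content_Un:
  "hausdorff_content s \<epsilon> (E \<union> F) \<le> hausdorff_content s \<epsilon> E + hausdorff_content s \<epsilon> F"
proof -
  define W where "W n = (if n = 0 then E else if n = 1 then F else {})" for n :: nat
  have "E \<union> F = (\<Union>n. W n)" by (auto simp: W_def split: if_splits)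
  then have "hausdorff_content s \<epsilon> (E \<union> F) \<le> (\<Sum>n. hausdorff_content s \<epsilon> (W n))"
    using hausdorff_content_subadditive[of s \<epsilon> W] by simp
  also have "\<dots> = (\<Sum>n\<in>{0,1}. hausdorff_content s \<epsilon> (W n))"
    by (rule suminf_finite) (auto simp: W_def)
  finally show ?thesis by (simp add: W_def)
qed

lemma infsum_ball_volumes_le:
  fixes a :: "'i \<Rightarrow> 'a::euclidean_space"
  assumes r: "\<And>i. i \<in> I \<Longrightarrow> 0 \<le> r i"
    and disj: "pairwise (\<lambda>i j. disjnt (cball (a i) (r i)) (cball (a j) (r j))) I"
    and U: "\<And>i. i \<in> I \<Longrightarrow> cball (a i) (r i) \<subseteq> U" "U \<in> sets lebesgue"
  shows "infsum (\<lambda>i. ennreal (unit_ball_vol DIM('a) * r i ^ DIM('a))) I \<le> emeasure lebesgue U"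
  unfolding infsum_ennreal_SUP
proof (rule SUP_least, clarify)
  fix F assume F: "finite F" "F \<subseteq> I"
  have "(\<Sum>i\<in>F. ennreal (unit_ball_vol DIM('a) * r i ^ DIM('a))) = (\<Sum>i\<in>F. emeasure lebesgue (cball (a i) (r i)))"
    using F r by (intro sum.cong) (auto simp: emeasure_cball)
  also have "\<dots> = emeasure lebesgue (\<Union>i\<in>F. cball (a i) (r i))"
    using F disj by (intro sum_emeasure)
      (auto simp: disjoint_family_on_def pairwise_def disjnt_def subset_iff)
  also have "\<dots> \<le> emeasure lebesgue U"
    using F U by (intro emeasure_mono) auto
  finally show "(\<Sum>i\<in>F. ennreal (unit_ball_vol DIM('a) * r i ^ DIM('a))) \<le> emeasure lebesgue U" .
qed

lemma infsum_ennreal_cmult: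
  fixes f :: "'i \<Rightarrow> ennreal"
  shows "infsum (\<lambda>i. c * f i) A = c * infsum f A"
  unfolding infsum_ennreal_SUP
  by (subst SUP_mult_left_ennreal) (simp add: sum_distrib_left)

text \<open>
  The balls are centred in \<open>A\<close> because only then is the image of a ball of radius \<open>r\<close> contained
  in a ball of radius \<open>L r\<close>; for other centres a factor 2 would be lost. The strictly larger constant \<open>L'\<close>
  makes room for passing from closed to open balls, and \<open>m\<close> is the enlargement factor of the covering
  lemma that produced the disjoint balls.
\<close>

lemma hausdorff_content_lipschitz_image_balls:
  fixes \<psi> :: "'a::euclidean_space \<Rightarrow> 'b::metric_space"
  assumes L: "L-lipschitz_on A \<psi>" and L': "L < L'"
    and I: "countable I" "\<And>i. i \<in> I \<Longrightarrow> a i \<in> A" "\<And>i. i \<in> I \<Longrightarrow> 0 < r i \<and> L' * (m * r i) \<le> \<epsilon>"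
    and disj: "pairwise (\<lambda>i j. disjnt (cball (a i) (r i)) (cball (a j) (r j))) I"
    and U: "\<And>i. i \<in> I \<Longrightarrow> cball (a i) (r i) \<subseteq> U" "U \<in> sets lebesgue"
    and m: "0 < m"
    and E: "E \<subseteq> A" "E \<subseteq> (\<Union>i\<in>I. cball (a i) (m * r i))"
  shows "ennreal (unit_ball_vol DIM('a)) * hausdorff_content DIM('a) \<epsilon> (\<psi> ` E)
      \<le> ennreal ((L' * m) ^ DIM('a)) * emeasure lebesgue U"
proof -
  let ?k = "DIM('a)"
  have L0: "0 \<le> L" using L by (rule lipschitz_on_nonneg)
  then have Lp: "0 < L'" using L' by simp
  have "hausdorff_content ?k \<epsilon> (\<psi> ` E) \<le> infsum (\<lambda>i. ennreal ((L' * (m * r i)) powr ?k)) I"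
  proof (rule hausdorff_content_le_infsum[OF I(1), where x="\<lambda>i. \<psi> (a i)"])
    show "\<psi> ` E \<subseteq> (\<Union>i\<in>I. ball (\<psi> (a i)) (L' * (m * r i)))"
    proof clarify
      fix x assume x: "x \<in> E"
      then obtain i where i: "i \<in> I" "dist (a i) x \<le> m * r i" using E(2) by auto
      have "dist (\<psi> (a i)) (\<psi> x) \<le> L * dist (a i) x"
        using lipschitz_onD[OF L I(2)[OF i(1)], of x] x E(1) by auto
      also have "\<dots> \<le> L * (m * r i)"
        using i(2) L0 by (rule mult_left_mono)
      also have "\<dots> < L' * (m * r i)"
        using L' m I(3)[OF i(1)] by simp
      finally show "\<psi> x \<in> (\<Union>i\<in>I. ball (\<psi> (a i)) (L' * (m * r i)))"
        using i(1) by auto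
    qed
  qed (use I(3) Lp m in auto)
  also have "\<dots> = infsum (\<lambda>i. ennreal ((L' * m) ^ ?k) * ennreal (r i ^ ?k)) I"
    using I(3) Lp m
    by (intro infsum_cong) (simp add: powr_realpow power_mult_distrib mult.assoc flip: ennreal_mult')
  finally have "ennreal (unit_ball_vol ?k) * hausdorff_content ?k \<epsilon> (\<psi> ` E)
      \<le> ennreal (unit_ball_vol ?k) * (ennreal ((L' * m) ^ ?k) * infsum (\<lambda>i. ennreal (r i ^ ?k)) I)"
    unfolding infsum_ennreal_cmult by (rule mult_left_mono) simp
  also have "\<dots> = ennreal ((L' * m) ^ ?k) * infsum (\<lambda>i. ennreal (unit_ball_vol ?k * r i ^ ?k)) I"
    by (simp add: ennreal_mult' infsum_ennreal_cmult mult.left_commute)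
  also have "\<dots> \<le> ennreal ((L' * m) ^ ?k) * emeasure lebesgue U"
    using I(3) by (intro mult_left_mono infsum_ball_volumes_le[where a=a] disj U) (auto intro: less_imp_le)
  finally show ?thesis .
qed

lemma ennreal_le_of_forall_le_add:
  fixes a b :: ennreal
  assumes "\<And>d::real. d > 0 \<Longrightarrow> a \<le> C * (b + ennreal d)" and "C < top"
  shows "a \<le> C * b"
proof (rule tendsto_lowerbound)
  have "((\<lambda>d. ennreal d) \<longlongrightarrow> ennreal 0) (at_right 0)"
    by (intro tendsto_ennrealI tendsto_ident_at)
  then have "((\<lambda>d. b + ennreal d) \<longlongrightarrow> b + 0) (at_right (0::real))"
    by (intro tendsto_intros) simp
  then show "((\<lambda>d. C * (b + ennreal d)) \<longlongrightarrow> C * b) (at_right (0::real))"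
    using assms(2) by (intro ennreal_tendsto_cmult) auto
  show "\<forall>\<^sub>F d in at_right (0::real). a \<le> C * (b + ennreal d)"
    using assms(1) by (auto simp: eventually_at_right_field intro: exI[of _ 1])
qed simp

lemma hausdorff_outer_measure_nat:
  "hausdorff_outer_measure (real k) E =
     (SUP \<epsilon>\<in>{0<..}. ennreal (unit_ball_vol k) * hausdorff_content k \<epsilon> E)"
  unfolding hausdorff_outer_measure_eq_SUP unit_ball_vol_def by (simp add: add.commute)

lemma lebesgue_outer_open_le:
  fixes A :: "'a::euclidean_space set"
  assumes "A \<in> sets lebesgue" "d > 0"
  obtains U where "open U" "A \<subseteq> U" "emeasure lebesgue U \<le> emeasure lebesgue A + ennreal d"
proof -
  obtain U where U: "open U" "A \<subseteq> U" "U - A \<in> lmeasurable" "emeasure lebesgue (U - A) < ennreal d"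
    using sets_lebesgue_outer_open[OF assms] by metis
  have "emeasure lebesgue U = emeasure lebesgue (A \<union> (U - A))"
    using U(2) by (intro arg_cong[where f="emeasure lebesgue"]) auto
  also have "\<dots> \<le> emeasure lebesgue A + emeasure lebesgue (U - A)"
    using U assms by (intro emeasure_subadditive) auto
  also have "\<dots> \<le> emeasure lebesgue A + ennreal d"
    using U(4) by (intro add_left_mono less_imp_le)
  finally show ?thesis using that U by blast
qed

text \<open>
  Vitali's covering theorem leaves out a null set, so null sets are treated first: here the lemma in
  which disjoint balls are enlarged five times covers everything, and the factor \<open>5\<^sup>k\<close> is harmless
  because the volume to be multiplied is as small as desired.
\<close>

lemma hausdorff_lipschitz_image_null:
  fixes \<psi> :: "'a::euclidean_space \<Rightarrow> 'b::metric_space"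
  assumes A: "A \<in> null_sets lebesgue" and L: "L-lipschitz_on A \<psi>"
  shows "hausdorff_outer_measure DIM('a) (\<psi> ` A) = 0"
proof -
  let ?c = "hausdorff_content DIM('a)"
  let ?v = "ennreal (unit_ball_vol DIM('a))"
  have L0: "0 \<le> L" using L by (rule lipschitz_on_nonneg)
  have "?v * ?c \<epsilon> (\<psi> ` A) \<le> 0" if e: "0 < \<epsilon>" for \<epsilon>
  proof -
    let ?C = "ennreal (((L + 1) * 5) ^ DIM('a))"
    have "?v * ?c \<epsilon> (\<psi> ` A) \<le> ?C * (0 + ennreal d)"
      if d: "0 < d" for d
    proof -
      obtain U where U: "open U" "A \<subseteq> U" "emeasure lebesgue U \<le> emeasure lebesgue A + ennreal d"
        using lebesgue_outer_open_le[of A d] A d by blast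
      define \<rho> where "\<rho> = \<epsilon> / ((L + 1) * 5)"
      have rho: "\<rho> > 0" "(L + 1) * (5 * \<rho>) = \<epsilon>" using e L0 by (auto simp: \<rho>_def divide_simps)
      let ?K = "{(x, r). x \<in> A \<and> 0 < r \<and> r \<le> \<rho> \<and> cball x r \<subseteq> U}"
      have "A \<subseteq> (\<Union>i\<in>?K. cball (fst i) (snd i))"
      proof
        fix x assume x: "x \<in> A"
        then obtain r where "r > 0" "cball x r \<subseteq> U"
          using U(1,2) open_contains_cball by blast
        moreover have "cball x (min r \<rho>) \<subseteq> cball x r" by auto
        ultimately have "(x, min r \<rho>) \<in> ?K" using x rho(1) by auto
        moreover have "x \<in> cball x (min r \<rho>)" using \<open>r > 0\<close> rho by auto
        ultimately show "x \<in> (\<Union>i\<in>?K. cball (fst i) (snd i))" by fastforce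
      qed
      then obtain C where C: "countable C" "C \<subseteq> ?K"
         "pairwise (\<lambda>i j. disjnt (cball (fst i) (snd i)) (cball (fst j) (snd j))) C"
         "A \<subseteq> (\<Union>i\<in>C. cball (fst i) (5 * snd i))"
      proof (rule Vitali_covering_lemma_cballs[of A fst snd ?K \<rho>])
        show "0 < snd i \<and> snd i \<le> \<rho>" if "i \<in> ?K" for i using that by (simp add: case_prod_beta)
      qed
      have "?v * ?c \<epsilon> (\<psi> ` A) \<le> ?C * emeasure lebesgue U"
      proof (rule hausdorff_content_lipschitz_image_balls[OF L _ C(1) _ _ C(3) _ _ _ _ C(4)])
        fix i assume i: "i \<in> C"
        have "(L + 1) * (5 * snd i) \<le> (L + 1) * (5 * \<rho>)"
          using i C(2) L0 by (intro mult_left_mono) auto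
        then show "0 < snd i \<and> (L + 1) * (5 * snd i) \<le> \<epsilon>" using i C(2) rho by auto
        have "i \<in> ?K" using i C(2) by (rule subsetD[rotated])
      then show "cball (fst i) (snd i) \<subseteq> U" by (simp add: case_prod_beta)
      qed (use C(2) U(1) in auto)
      also have "\<dots> \<le> ?C * (0 + ennreal d)" using U(3) A by (intro mult_left_mono) auto
      finally show ?thesis .
    qed
    from ennreal_le_of_forall_le_add[OF this] show ?thesis by simp
  qed
  then show ?thesis unfolding hausdorff_outer_measure_nat by (auto intro!: SUP_eq_const)
qed

text \<open>
  Disjoint balls centred in \<open>A\<close> and contained in an open set of almost the same measure cover \<open>A\<close> up
  to a null set, so their images form a cover whose weight is at most \<open>L\<^sup>k\<close> times that measure. Having the
  constant exactly \<open>L\<^sup>k\<close> is what makes the area formula come out as an equality when \<open>L\<close> tends to 1.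
\<close>

lemma hausdorff_lipschitz_image_le:
  fixes \<psi> :: "'a::euclidean_space \<Rightarrow> 'b::metric_space"
  assumes A: "A \<in> sets lebesgue" and L: "L-lipschitz_on A \<psi>" and Lpos: "0 < L"
  shows "hausdorff_outer_measure DIM('a) (\<psi> ` A) \<le> ennreal (L ^ DIM('a)) * emeasure lebesgue A"
proof -
  let ?c = "hausdorff_content DIM('a)"
  have L0: "0 \<le> L" using L by (rule lipschitz_on_nonneg)
  let ?v = "ennreal (unit_ball_vol DIM('a))"
  have "?v * ?c \<epsilon> (\<psi> ` A) \<le> ennreal (L' ^ DIM('a)) * emeasure lebesgue A"
    if e: "0 < \<epsilon>" and L': "L < L'" for \<epsilon> L'
  proof (rule ennreal_le_of_forall_le_add)
    fix d :: real assume d: "0 < d"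
    obtain U where U: "open U" "A \<subseteq> U" "emeasure lebesgue U \<le> emeasure lebesgue A + ennreal d"
      using lebesgue_outer_open_le[OF A d] by blast
    define \<rho> where "\<rho> = \<epsilon> / L'"
    have rho: "\<rho> > 0" "L' * \<rho> = \<epsilon>" using e L0 L' by (auto simp: \<rho>_def)
    let ?K = "{(x, r). x \<in> A \<and> 0 < r \<and> r \<le> \<rho> \<and> cball x r \<subseteq> U}"
    have fine: "\<exists>i. i \<in> ?K \<and> x \<in> cball (fst i) (snd i) \<and> snd i < t" if x: "x \<in> A" and t: "0 < t" for x t
    proof -
      obtain r where "r > 0" "cball x r \<subseteq> U"
        using U(1,2) x open_contains_cball by blast
      moreover define q where "q = min r (min \<rho> (t / 2))"
      ultimately have "cball x q \<subseteq> U" "0 < q" "q \<le> \<rho>" "q < t"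
        using rho t by (auto simp: subset_iff)
      then have "(x, q) \<in> ?K \<and> x \<in> cball (fst (x, q)) (snd (x, q)) \<and> snd (x, q) < t" using x by auto
      then show ?thesis by blast
    qed
    obtain C where C: "countable C" "C \<subseteq> ?K"
       "pairwise (\<lambda>i j. disjnt (cball (fst i) (snd i)) (cball (fst j) (snd j))) C"
       "negligible (A - (\<Union>i\<in>C. cball (fst i) (snd i)))"
    proof (rule Vitali_covering_theorem_cballs[of ?K snd A fst])
      show "0 < snd i" if "i \<in> ?K" for i using that by (simp add: case_prod_beta)
    qed (rule fine)
    define N where "N = A - (\<Union>i\<in>C. cball (fst i) (snd i))"
    have "?v * ?c \<epsilon> (\<psi> ` (A - N)) \<le> ennreal ((L' * 1) ^ DIM('a)) * emeasure lebesgue U"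
    proof (rule hausdorff_content_lipschitz_image_balls[OF L L' C(1) _ _ C(3)])
      fix i assume i: "i \<in> C"
      have "L' * (1 * snd i) \<le> L' * \<rho>"
        using i C(2) L0 L' by (intro mult_left_mono) auto
      then show "0 < snd i \<and> L' * (1 * snd i) \<le> \<epsilon>" using i C(2) rho by auto
      have "i \<in> ?K" using i C(2) by (rule subsetD[rotated])
      then show "cball (fst i) (snd i) \<subseteq> U" by (simp add: case_prod_beta)
    qed (use C(2) U(1) in \<open>auto simp: N_def\<close>)
    moreover have "?v * ?c \<epsilon> (\<psi> ` N) \<le> 0"
    proof -
      have "hausdorff_outer_measure DIM('a) (\<psi> ` N) = 0"
        using C(4) by (intro hausdorff_lipschitz_image_null[OF _ lipschitz_on_subset[OF L]])
          (auto simp: N_def negligible_iff_null_sets)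
      then show ?thesis
        unfolding hausdorff_outer_measure_nat using e SUP_upper[of \<epsilon> "{0<..}"] by (metis greaterThan_iff)
    qed
    moreover have "?v * ?c \<epsilon> (\<psi> ` A) \<le>
       ?v * ?c \<epsilon> (\<psi> ` (A - N)) + ?v * ?c \<epsilon> (\<psi> ` N)"
    proof -
      have "\<psi> ` A = \<psi> ` (A - N) \<union> \<psi> ` N" by (auto simp: N_def)
      then show ?thesis
        by (metis hausdorff_content_Un mult_left_mono distrib_left zero_le)
    qed
    ultimately have "?v * ?c \<epsilon> (\<psi> ` A) \<le> ennreal ((L' * 1) ^ DIM('a)) * emeasure lebesgue U + 0"
      by (meson add_mono order_trans)
    then have "?v * ?c \<epsilon> (\<psi> ` A) \<le> ennreal (L' ^ DIM('a)) * emeasure lebesgue U"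
      by simp
    also have "\<dots> \<le> ennreal (L' ^ DIM('a)) * (emeasure lebesgue A + ennreal d)"
      by (intro mult_left_mono U) auto
    finally show "?v * ?c \<epsilon> (\<psi> ` A) \<le> \<dots>" .
  qed simp
  then have *: "hausdorff_outer_measure DIM('a) (\<psi> ` A) \<le> ennreal (L' ^ DIM('a)) * emeasure lebesgue A"
    if "L < L'" for L'
    unfolding hausdorff_outer_measure_nat using that by (intro SUP_least) auto
  show ?thesis
  proof (rule tendsto_lowerbound)
    have "((\<lambda>L'. ennreal (L' ^ DIM('a))) \<longlongrightarrow> ennreal (L ^ DIM('a))) (at_right L)"
      by (intro tendsto_intros)
    then show "((\<lambda>L'. ennreal (L' ^ DIM('a)) * emeasure lebesgue A) \<longlongrightarrow>
        ennreal (L ^ DIM('a)) * emeasure lebesgue A) (at_right L)"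
      using Lpos by (intro tendsto_mult_ennreal tendsto_const) auto
    show "\<forall>\<^sub>F L' in at_right L. hausdorff_outer_measure DIM('a) (\<psi> ` A) \<le> ennreal (L' ^ DIM('a)) * emeasure lebesgue A"
      using * by (auto simp: eventually_at_right_field intro: exI[of _ "L+1"])
  qed simp
qed


lemma emeasure_UN_le_infsum:
  assumes C: "countable C" and B: "\<And>i. i \<in> C \<Longrightarrow> B i \<in> sets M"
  shows "emeasure M (\<Union>i\<in>C. B i) \<le> infsum (\<lambda>i. emeasure M (B i)) C"
proof -
  define F where "F n = {i \<in> C. to_nat_on C i < n}" for n
  have F: "finite (F n)" for n
    unfolding F_def
    by (rule inj_on_finite[of "to_nat_on C" _ "{..<n}"])
      (auto intro: inj_on_subset[OF inj_on_to_nat_on[OF C]])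
  have "incseq (\<lambda>n. \<Union>i\<in>F n. B i)" by (fastforce simp: incseq_def F_def)
  moreover have "range (\<lambda>n. \<Union>i\<in>F n. B i) \<subseteq> sets M"
    using F B by (auto intro!: sets.finite_UN simp: F_def)
  moreover have "(\<Union>i\<in>C. B i) = (\<Union>n. \<Union>i\<in>F n. B i)"
    by (auto simp: F_def)
  ultimately have "emeasure M (\<Union>i\<in>C. B i) = (SUP n. emeasure M (\<Union>i\<in>F n. B i))"
    by (simp add: SUP_emeasure_incseq)
  also have "\<dots> \<le> infsum (\<lambda>i. emeasure M (B i)) C"
  proof (rule SUP_least)
    fix n
    have "emeasure M (\<Union>i\<in>F n. B i) \<le> (\<Sum>i\<in>F n. emeasure M (B i))"
      using F B by (intro emeasure_subadditive_finite) (auto simp: F_def)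
    also have "\<dots> \<le> infsum (\<lambda>i. emeasure M (B i)) C"
      unfolding infsum_ennreal_SUP using F by (intro SUP_upper) (auto simp: F_def)
    finally show "emeasure M (\<Union>i\<in>F n. B i) \<le> infsum (\<lambda>i. emeasure M (B i)) C" .
  qed
  finally show ?thesis .
qed

text \<open>
  The normalising constant of \<open>\<H>\<^sup>k\<close> is the volume of the unit ball, so the weight of a cover is the sum
  of the volumes of its balls.
\<close>

lemma lebesgue_le_hausdorff:
  fixes E :: "'a::euclidean_space set"
  assumes E: "E \<in> sets lebesgue"
  shows "emeasure lebesgue E \<le> hausdorff_outer_measure DIM('a) E"
proof -
  define v w where "v = ennreal (unit_ball_vol DIM('a))" and "w = ennreal (1 / unit_ball_vol DIM('a))"
  have vw: "v * w = 1" "w * v = 1"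
    using unit_ball_vol_pos[of "real DIM('a)"]
    by (simp_all add: v_def w_def flip: ennreal_mult' del: unit_ball_vol_pos)
  have "w * emeasure lebesgue E \<le> hausdorff_content DIM('a) 1 E"
    unfolding hausdorff_content_def
  proof (rule INF_greatest, clarify)
    fix C :: "('a \<times> real) set"
    assume C: "countable C" "\<forall>(x, r) \<in> C. 0 < r \<and> r \<le> 1" "E \<subseteq> (\<Union>(x, r) \<in> C. ball x r)"
    let ?f = "\<lambda>(x, r). ennreal (r powr real DIM('a))"
    have "emeasure lebesgue E \<le> emeasure lebesgue (\<Union>i\<in>C. ball (fst i) (snd i))"
      using C by (intro emeasure_mono sets.countable_UN') (auto simp: case_prod_beta)
    also have "\<dots> \<le> infsum (\<lambda>i. emeasure lebesgue (ball (fst i) (snd i))) C"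
      by (intro emeasure_UN_le_infsum C) auto
    also have "\<dots> = infsum (\<lambda>i. v * ?f i) C"
      using C(2) unfolding v_def by (intro infsum_cong)
        (auto simp: emeasure_ball ennreal_mult' powr_realpow)
    also have "\<dots> = v * infsum ?f C" by (rule infsum_ennreal_cmult)
    finally have "w * emeasure lebesgue E \<le> w * (v * infsum ?f C)" by (intro mult_left_mono) auto
    then show "w * emeasure lebesgue E \<le> infsum ?f C"
      using vw by (simp flip: mult.assoc)
  qed
  then have "v * (w * emeasure lebesgue E) \<le> v * hausdorff_content DIM('a) 1 E"
    by (intro mult_left_mono) auto
  then have "emeasure lebesgue E \<le> v * hausdorff_content DIM('a) 1 E"
    using vw by (simp flip: mult.assoc)
  also have "\<dots> \<le> hausdorff_outer_measure DIM('a) E"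
    unfolding hausdorff_outer_measure_nat v_def by (rule SUP_upper) simp
  finally show ?thesis .
qed

text \<open>
  Since \<open>Q\<close> is defined on the whole space, the centres of a cover can be mapped as well, and the radii
  stay the same. Combined with \<open>\<L>\<^sup>k \<le> \<H>\<^sup>k\<close> this gives lower bounds for \<open>\<H>\<^sup>k\<close> of subsets of \<open>\<real>\<^sup>n\<close>.
\<close>

lemma hausdorff_contraction_image_le:
  assumes Q: "\<And>x y. dist (Q x) (Q y) \<le> dist x y"
  shows "hausdorff_outer_measure s (Q ` E) \<le> hausdorff_outer_measure s E"
proof -
  have "hausdorff_content s \<epsilon> (Q ` E) \<le> hausdorff_content s \<epsilon> E" for \<epsilon>
    unfolding hausdorff_content_def[of s \<epsilon> E]
  proof (rule INF_greatest, clarify)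
    fix C assume C: "countable C" "\<forall>(x, r) \<in> C. 0 < r \<and> r \<le> \<epsilon>" "E \<subseteq> (\<Union>(x, r) \<in> C. ball x r)"
    have "hausdorff_content s \<epsilon> (Q ` E) \<le> infsum (\<lambda>i. ennreal (snd i powr s)) C"
    proof (rule hausdorff_content_le_infsum[OF C(1), where x="\<lambda>i. Q (fst i)"])
      show "Q ` E \<subseteq> (\<Union>i\<in>C. ball (Q (fst i)) (snd i))"
      proof clarify
        fix x assume "x \<in> E"
        then have "x \<in> (\<Union>(x, r)\<in>C. ball x r)" using C(3) by blast
        then obtain i where i: "i \<in> C" "dist (fst i) x < snd i" by auto
        then show "Q x \<in> (\<Union>i\<in>C. ball (Q (fst i)) (snd i))"
          using Q[of "fst i" x] by (intro UN_I[of i]) auto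
      qed
    qed (use C(2) in auto)
    also have "(\<lambda>i. ennreal (snd i powr s)) = (\<lambda>(x, r). ennreal (r powr s))"
      by (simp add: fun_eq_iff)
    finally show "hausdorff_content s \<epsilon> (Q ` E) \<le> (\<Sum>\<^sub>\<infinity>(x, r)\<in>C. ennreal (r powr s))" .
  qed
  then show ?thesis
    unfolding hausdorff_outer_measure_eq_SUP by (intro SUP_mono') (auto intro: mult_left_mono)
qed

lemma inverse_Suc_tendsto_0: "(\<lambda>n. 1 / real (Suc n)) \<longlonglongrightarrow> 0"
  using LIMSEQ_inverse_real_of_nat by (simp add: inverse_eq_divide)

text \<open>
  The intersection of a sequence of covers by open balls with weights tending to 0 is a \<open>G\<^sub>\<delta>\<close> set.
  The exceptional sets below are images of null sets, which need not be Borel.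
\<close>

lemma hausdorff_null_borel_hull:
  fixes E :: "'a::metric_space set"
  assumes E: "hausdorff_outer_measure (real k) E = 0"
  obtains B where "B \<in> null_sets (hausdorff_measure (real k))" "E \<subseteq> B"
proof -
  let ?f = "\<lambda>(x, r). ennreal (r powr k)"
  let ?cov = "\<lambda>\<epsilon>. {C. countable C \<and> (\<forall>(x, r) \<in> C. 0 < r \<and> r \<le> \<epsilon>) \<and> E \<subseteq> (\<Union>(x, r) \<in> C. ball x r)}"
  have "\<exists>C\<in>?cov (1 / Suc n). infsum ?f C < ennreal (1 / Suc n)" for n
  proof -
    have "ennreal (unit_ball_vol k) * hausdorff_content k (1 / Suc n) E \<le> 0"
      using E unfolding hausdorff_outer_measure_nat
      by (metis SUP_upper greaterThan_iff of_nat_0_less_iff zero_less_Suc zero_less_divide_1_iff)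
    then have "hausdorff_content k (1 / Suc n) E < ennreal (1 / Suc n)"
      using unit_ball_vol_pos[of "real k"] by (auto simp del: unit_ball_vol_pos)
    then show ?thesis unfolding hausdorff_content_def INF_less_iff by simp
  qed
  then have "\<forall>n. \<exists>C. C \<in> ?cov (1 / Suc n) \<and> infsum ?f C < ennreal (1 / Suc n)"
    unfolding Bex_def by (rule allI)
  from choice[OF this] obtain C where "\<forall>n. C n \<in> ?cov (1 / Suc n) \<and> infsum ?f (C n) < ennreal (1 / Suc n)" ..
  then have C: "C n \<in> ?cov (1 / Suc n)" "infsum ?f (C n) < ennreal (1 / Suc n)" for n
    by (auto simp only:)
  define B where "B = (\<Inter>n. \<Union>(x, r)\<in>C n. ball x r)"
  have "(\<Union>(x, r)\<in>C n. ball x r) \<in> sets borel" for n by (intro borel_open open_UN) auto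
  then have Bb: "B \<in> sets borel" unfolding B_def by auto
  have "hausdorff_content k \<epsilon> B \<le> 0" if e: "0 < \<epsilon>" for \<epsilon>
  proof (rule tendsto_lowerbound)
    have "(\<lambda>n. ennreal (1 / Suc n)) \<longlonglongrightarrow> ennreal 0"
      by (intro tendsto_ennrealI inverse_Suc_tendsto_0)
    then show "(\<lambda>n. ennreal (1 / Suc n)) \<longlonglongrightarrow> 0" by simp
    obtain m where m: "1 / Suc m < \<epsilon>" using e nat_approx_posE by metis
    have "hausdorff_content k \<epsilon> B \<le> ennreal (1 / Suc n)" if "m \<le> n" for n
    proof -
      have "1 / real (Suc n) \<le> 1 / real (Suc m)" using that by (intro divide_left_mono) auto
      then have "hausdorff_content k \<epsilon> B \<le> infsum ?f (C n)"
        unfolding hausdorff_content_def using C(1)[of n] m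
        by (intro INF_lower) (auto simp: B_def intro: order_trans)
      also have "\<dots> \<le> ennreal (1 / Suc n)" using C(2) by (rule less_imp_le)
      finally show ?thesis .
    qed
    then show "\<forall>\<^sub>F n in sequentially. hausdorff_content k \<epsilon> B \<le> ennreal (1 / Suc n)"
      by (auto simp: eventually_sequentially)
  qed simp
  then have "hausdorff_outer_measure k B = 0"
    unfolding hausdorff_outer_measure_nat by (auto intro!: SUP_eq_const)
  then have "B \<in> null_sets (hausdorff_measure (real k))"
    using Bb by (intro null_setsI) (auto simp: emeasure_hausdorff_measure)
  moreover have "E \<subseteq> B" using C(1) by (auto simp: B_def)
  ultimately show ?thesis by (rule that)
qed

lemma AE_hausdorffI:
  assumes "hausdorff_outer_measure (real k) E = 0" and "\<And>y. y \<notin> E \<Longrightarrow> R y"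
  shows "AE y in hausdorff_measure (real k). R y"
proof -
  obtain B where "B \<in> null_sets (hausdorff_measure (real k))" "E \<subseteq> B"
    using hausdorff_null_borel_hull[OF assms(1)] .
  then show ?thesis using assms(2) by (intro AE_I'[of B]) auto
qed

lemma locally_lipschitz_imp_continuous_on:
  assumes "locally_lipschitz \<phi>"
  shows "continuous_on A \<phi>"
proof (rule continuous_at_imp_continuous_on, rule ballI)
  fix x
  obtain u L where "u > 0" "L-lipschitz_on (ball x u) \<phi>"
    using assms unfolding locally_lipschitz_def by metis
  then show "isCont \<phi> x"
    using lipschitz_on_continuous_on[of L "ball x u" \<phi>] by (simp add: continuous_on_eq_continuous_at)
qed

text \<open>
  Balls of half the radius already cover the space; a closed ball in between is then available on
  which \<open>\<phi>\<close> is Lipschitz.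
\<close>

lemma locally_lipschitz_countable_cover:
  fixes \<phi> :: "'a::euclidean_space \<Rightarrow> 'b::metric_space"
  assumes "locally_lipschitz \<phi>"
  obtains X :: "'a set" and u L where "countable X" "\<And>x. 0 < u x" "\<And>x. 0 < L x"
    "\<And>x. (L x)-lipschitz_on (ball x (u x)) \<phi>" "(\<Union>x\<in>X. ball x (u x / 2)) = UNIV"
proof -
  have "\<exists>u L. 0 < u \<and> 0 < L \<and> L-lipschitz_on (ball x u) \<phi>" for x
  proof -
    obtain u L where "u > 0" "L-lipschitz_on (ball x u) \<phi>"
      using assms unfolding locally_lipschitz_def by metis
    then have "0 < u \<and> 0 < max L 1 \<and> (max L 1)-lipschitz_on (ball x u) \<phi>"
      by (auto intro: lipschitz_on_le)
    then show ?thesis by blast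
  qed
  then obtain u L where uL: "\<And>x. 0 < u x" "\<And>x. 0 < L x" "\<And>x. (L x)-lipschitz_on (ball x (u x)) \<phi>"
    by metis
  obtain F where F: "F \<subseteq> range (\<lambda>x. ball x (u x / 2))" "countable F" "\<Union>F = \<Union>(range (\<lambda>x. ball x (u x / 2)))"
    by (rule Lindelof[of "range (\<lambda>x. ball x (u x / 2))"]) auto
  obtain X where X: "countable X" "F = (\<lambda>x. ball x (u x / 2)) ` X"
    using F(1,2) countable_subset_image[of F "\<lambda>x. ball x (u x / 2)" UNIV] by auto
  have "(\<Union>x\<in>X. ball x (u x / 2)) = UNIV"
  proof -
    have "x \<in> \<Union>(range (\<lambda>x. ball x (u x / 2)))" for x
      using uL(1)[of x] by (intro UnionI[of "ball x (u x / 2)"]) auto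
    then show ?thesis using F(3) unfolding X(2) by auto
  qed
  then show ?thesis by (rule that[OF X(1) uL])
qed

lemma hausdorff_locally_lipschitz_image_null:
  fixes \<phi> :: "'a::euclidean_space \<Rightarrow> 'b::metric_space"
  assumes \<phi>: "locally_lipschitz \<phi>" and N: "N \<in> null_sets lebesgue"
  shows "hausdorff_outer_measure DIM('a) (\<phi> ` N) = 0"
proof -
  let ?H = "hausdorff_outer_measure DIM('a)"
  obtain X :: "'a set" and u L where X: "countable X" "\<And>x. 0 < u x" "\<And>x. 0 < L x"
    "\<And>x. (L x)-lipschitz_on (ball x (u x)) \<phi>" "(\<Union>x\<in>X. ball x (u x / 2)) = UNIV"
    using locally_lipschitz_countable_cover[OF \<phi>] by blast
  have ne: "X \<noteq> {}" using X(5) by auto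
  define W where "W n = N \<inter> ball (from_nat_into X n) (u (from_nat_into X n))" for n
  have "N \<subseteq> (\<Union>n. W n)"
  proof
    fix z assume z: "z \<in> N"
    obtain x where x: "x \<in> X" "z \<in> ball x (u x / 2)" using X(5) by blast
    then obtain n where n: "x = from_nat_into X n" using X(1) by (metis from_nat_into_surj)
    have "z \<in> ball x (u x)" using x(2) X(2)[of x] by simp
    then show "z \<in> (\<Union>n. W n)" using z n by (auto simp: W_def)
  qed
  then have "?H (\<phi> ` N) \<le> ?H (\<Union>n. \<phi> ` W n)"
    by (intro hausdorff_outer_measure_mono) blast
  also have "\<dots> \<le> (\<Sum>n. ?H (\<phi> ` W n))"
    by (rule hausdorff_outer_measure_subadditive)
  also have "\<dots> = (\<Sum>n. 0)"
  proof (rule suminf_cong)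
    fix n
    have "W n \<in> null_sets lebesgue" unfolding W_def using N by (auto intro: null_sets_completion_subset)
    then show "?H (\<phi> ` W n) = 0"
      by (rule hausdorff_lipschitz_image_null) (rule lipschitz_on_subset[OF X(4)], auto simp: W_def)
  qed
  finally show ?thesis by simp
qed

lemma lebesgue_fsigma_subset:
  fixes A :: "'a::euclidean_space set"
  assumes "A \<in> sets lebesgue"
  obtains C where "fsigma C" "C \<subseteq> A" "A - C \<in> null_sets lebesgue"
proof -
  obtain C N where "fsigma C" "N \<in> null_sets lebesgue" "C \<union> N = A" "disjnt C N"
    using lebesgue_set_almost_fsigma[OF assms] .
  moreover from this have "A - C = N" by (auto simp: disjnt_def)
  ultimately show ?thesis by (intro that[of C]) auto
qed

lemma fsigma_imp_borel: "fsigma (C :: 'a::euclidean_space set) \<Longrightarrow> C \<in> sets borel"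
proof -
  assume "fsigma C"
  then obtain F :: "nat \<Rightarrow> 'a set" where F: "range F \<subseteq> Collect compact" "C = \<Union>(range F)"
    using fsigma_Union_compact[THEN iffD1] by blast
  then have "F n \<in> sets borel" for n by (intro borel_compact) auto
  then show "C \<in> sets borel" unfolding F(2) by (intro sets.countable_UN) auto
qed

lemma fsigma_continuous_image_borel:
  fixes \<phi> :: "'a::euclidean_space \<Rightarrow> 'b::t2_space"
  assumes "fsigma C" "continuous_on C \<phi>"
  shows "\<phi> ` C \<in> sets borel"
proof -
  obtain F :: "nat \<Rightarrow> 'a set" where F: "range F \<subseteq> Collect compact" "C = \<Union>(range F)"
    using fsigma_Union_compact[THEN iffD1, OF assms(1)] by blast
  have "compact (\<phi> ` F n)" for n
    using F assms(2) by (intro compact_continuous_image) (auto intro: continuous_on_subset)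
  then have "(\<Union>n. \<phi> ` F n) \<in> sets borel" by (intro sets.countable_UN) (auto intro: borel_closed compact_imp_closed)
  moreover have "\<phi> ` C = (\<Union>n. \<phi> ` F n)" using F(2) by auto
  ultimately show ?thesis by simp
qed

section \<open>Volume of linear images\<close>

text \<open>
  The image of a ball of radius \<open>r\<close> is a translate of \<open>r\<close> times the image of the unit ball, so the volumes
  of all balls are scaled by the same factor; a box is a disjoint union of balls up to a null set.
\<close>

lemma linear_image_content_scale:
  fixes f :: "'a::euclidean_space \<Rightarrow> 'a"
  assumes f: "linear f"
  obtains c where "\<And>a b. measure lebesgue (f ` cbox a b) = c * measure lebesgue (cbox a b)"
proof (cases "inj f")
  case False
  then have "measure lebesgue (f ` cbox a b) = 0 * measure lebesgue (cbox a b)" for a b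
    using negligible_linear_singular_image[OF f False] by (simp add: negligible_imp_measure0)
  then show ?thesis by (rule that)
next
  case True
  let ?B = "ball (0::'a) 1"
  have lip: "negligible N \<Longrightarrow> negligible (f ` N)" for N
    using f by (intro negligible_differentiable_image_negligible linear_imp_differentiable_on) auto
  have meas: "f ` ball x r \<in> lmeasurable" for x r
    using f by (intro measurable_convex convex_linear_image bounded_linear_image)
      (auto simp: linear_conv_bounded_linear)
  define c where "c = measure lebesgue (f ` ?B) / measure lebesgue ?B"
  have ball_eq: "emeasure lebesgue (f ` ball x r) = ennreal c * emeasure lebesgue (ball x r)" if r: "0 < r" for x r
  proof -
    have "f ` ball x r = (\<lambda>y. r *\<^sub>R y + f x) ` (f ` ?B)"
    proof -
      have "(*\<^sub>R) r ` ?B = ball 0 r" using r ball_scale[of r 0 1] by simp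
      moreover have "ball x r = (+) x ` ball 0 r" using ball_translation[of x 0 r] by (metis add.right_neutral)
      ultimately have "ball x r = (+) x ` (*\<^sub>R) r ` ?B" by (simp only:)
      also have "\<dots> = (\<lambda>y. r *\<^sub>R y + x) ` ?B"
        unfolding image_image by (simp only: add.commute)
      finally have "ball x r = (\<lambda>y. r *\<^sub>R y + x) ` ?B" .
      then show ?thesis
        using f by (simp add: image_image linear_add linear_scale)
    qed
    then have "measure lebesgue (f ` ball x r) = \<bar>r\<bar> ^ DIM('a) * measure lebesgue (f ` ?B)"
      by (simp only: measure_lebesgue_affine)
    also have "\<dots> = c * (\<bar>r\<bar> ^ DIM('a) * measure lebesgue ?B)"
      unfolding c_def using content_ball_gt_0_iff[of "0::'a" 1] by simp
    also have "\<bar>r\<bar> ^ DIM('a) * measure lebesgue ?B = measure lebesgue (ball x r)"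
      using r by (simp add: content_ball)
    finally have m: "measure lebesgue (f ` ball x r) = c * measure lebesgue (ball x r)" .
    have "emeasure lebesgue (f ` ball x r) = ennreal (measure lebesgue (f ` ball x r))"
      by (rule emeasure_eq_measure2[OF meas])
    also have "\<dots> = ennreal c * ennreal (measure lebesgue (ball x r))"
      unfolding m by (rule ennreal_mult') (simp add: c_def)
    also have "ennreal (measure lebesgue (ball x r)) = emeasure lebesgue (ball x r)"
      by (rule emeasure_eq_measure2[symmetric]) simp
    finally show ?thesis .
  qed
  have "measure lebesgue (f ` cbox a b) = c * measure lebesgue (cbox a b)" for a b
  proof -
    let ?K = "{(x, r). 0 < r \<and> ball x r \<subseteq> box a b}"
    obtain C where C: "countable C" "C \<subseteq> ?K"
       "pairwise (\<lambda>i j. disjnt (ball (fst i) (snd i)) (ball (fst j) (snd j))) C"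
       "negligible (box a b - (\<Union>i\<in>C. ball (fst i) (snd i)))"
    proof (rule Vitali_covering_theorem_balls[of "box a b" ?K fst snd])
      fix x :: 'a and d :: real assume x: "x \<in> box a b" and d: "0 < d"
      obtain r where r: "0 < r" "ball x r \<subseteq> box a b"
        using open_box[of a b] x by (meson open_contains_ball)
      then have "(x, min r (d / 2)) \<in> ?K" using d by (auto simp: subset_iff)
      moreover have "x \<in> ball x (min r (d / 2))" "min r (d / 2) < d" using r d by auto
      ultimately show "\<exists>i. i \<in> ?K \<and> x \<in> ball (fst i) (snd i) \<and> snd i < d" by fastforce
    qed
    define V where "V = (\<Union>i\<in>C. ball (fst i) (snd i))"
    have pos: "0 < snd i" "ball (fst i) (snd i) \<subseteq> box a b" if "i \<in> C" for i
      using subsetD[OF C(2) that] by (simp_all add: case_prod_beta)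
    have VU: "V \<subseteq> box a b" using pos(2) unfolding V_def by blast
    have neg: "negligible (cbox a b - V)"
    proof (rule negligible_subset)
      show "negligible ((cbox a b - box a b) \<union> (box a b - V))"
        using C(4) by (intro negligible_Un) (auto simp: V_def negligible_frontier_interval)
    qed auto
    have disj: "disjoint_family_on (\<lambda>i. ball (fst i) (snd i)) C"
      using C(3) by (auto simp: disjoint_family_on_def pairwise_def disjnt_def)
    have "emeasure lebesgue (f ` V) = emeasure lebesgue (\<Union>i\<in>C. f ` ball (fst i) (snd i))"
      by (simp add: V_def image_UN)
    also have "\<dots> = (\<integral>\<^sup>+i. emeasure lebesgue (f ` ball (fst i) (snd i)) \<partial>count_space C)"
      using disj True C(1) by (intro emeasure_UN_countable fmeasurableD meas)
        (auto simp: disjoint_family_on_def image_Int[symmetric])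
    also have "\<dots> = (\<integral>\<^sup>+i. ennreal c * emeasure lebesgue (ball (fst i) (snd i)) \<partial>count_space C)"
      by (intro nn_integral_cong) (simp add: ball_eq pos)
    also have "\<dots> = ennreal c * (\<integral>\<^sup>+i. emeasure lebesgue (ball (fst i) (snd i)) \<partial>count_space C)"
      by (rule nn_integral_cmult) auto
    also have "(\<integral>\<^sup>+i. emeasure lebesgue (ball (fst i) (snd i)) \<partial>count_space C) = emeasure lebesgue V"
      unfolding V_def using disj C(1) by (intro emeasure_UN_countable[symmetric]) auto
    finally have *: "emeasure lebesgue (f ` V) = ennreal c * emeasure lebesgue V" .
    have "measure lebesgue (f ` V) = c * measure lebesgue V"
      using arg_cong[OF *, of enn2real] by (simp add: measure_def enn2real_mult c_def)
    moreover have "measure lebesgue V = measure lebesgue (cbox a b)"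
    proof (rule measure_negligible_symdiff)
      have "V \<subseteq> cbox a b" using VU box_subset_cbox by (rule order_trans)
      then show "negligible (cbox a b - V \<union> (V - cbox a b))"
        using neg by (intro negligible_Un) (auto simp: Diff_eq_empty_iff[THEN iffD2])
    qed auto
    moreover have "measure lebesgue (f ` V) = measure lebesgue (f ` cbox a b)"
    proof (rule measure_negligible_symdiff)
      have "f ` V \<subseteq> f ` cbox a b" using VU box_subset_cbox by (intro image_mono) (rule order_trans)
      moreover have "negligible (f ` cbox a b - f ` V)"
        by (rule negligible_subset[OF lip[OF neg]]) auto
      ultimately show "negligible (f ` cbox a b - f ` V \<union> (f ` V - f ` cbox a b))"
        by (intro negligible_Un) (auto simp: Diff_eq_empty_iff[THEN iffD2])
    qed (rule measurable_linear_image_interval[OF f])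
    ultimately show ?thesis by simp
  qed
  then show ?thesis by (rule that)
qed

text \<open>
  As the scaling factor does not depend on the set, it suffices to determine it on the unit
  box. Both the factor and \<open>|det|\<close> are multiplicative, so only elementary maps remain, for which the
  image of the unit box is explicit.
\<close>

lemma linear_image_measure_det:
  fixes f :: "real^'k \<Rightarrow> real^'k"
  assumes f: "linear f" and S: "S \<in> lmeasurable"
  shows "f ` S \<in> lmeasurable \<and> measure lebesgue (f ` S) = \<bar>det (matrix f)\<bar> * measure lebesgue S"
proof -
  have unit: "measure lebesgue (cbox 0 1 :: (real^'k) set) = 1"
    by (simp add: content_cbox_if_cart interval_ne_empty_cart)
  have enough: "\<forall>S\<in>lmeasurable. g ` S \<in> lmeasurable \<and> measure lebesgue (g ` S) = \<bar>det (matrix g)\<bar> * measure lebesgue S"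
    if g: "linear g" and u: "measure lebesgue (g ` cbox 0 1) = \<bar>det (matrix g)\<bar>" for g :: "real^'k \<Rightarrow> real^'k"
  proof
    fix S :: "(real^'k) set" assume S: "S \<in> lmeasurable"
    obtain c where c: "\<And>a b. measure lebesgue (g ` cbox a b) = c * measure lebesgue (cbox a b)"
      using linear_image_content_scale[OF g] by blast
    have "c = \<bar>det (matrix g)\<bar>" using c[of 0 1] u unit by simp
    then show "g ` S \<in> lmeasurable \<and> measure lebesgue (g ` S) = \<bar>det (matrix g)\<bar> * measure lebesgue S"
      using measure_linear_sufficient[OF g S c] by simp
  qed
  have "\<forall>S\<in>lmeasurable. f ` S \<in> lmeasurable \<and> measure lebesgue (f ` S) = \<bar>det (matrix f)\<bar> * measure lebesgue S"
  proof (rule induct_linear_elementary[OF f])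
    fix f g :: "real^'k \<Rightarrow> real^'k"
    let ?P = "\<lambda>f. \<forall>S\<in>lmeasurable. f ` S \<in> lmeasurable \<and> measure lebesgue (f ` S) = \<bar>det (matrix f)\<bar> * measure lebesgue S"
    assume lin: "linear f" "linear g" and P: "?P f" "?P g"
    show "?P (f \<circ> g)"
    proof
      fix S :: "(real^'k) set" assume S: "S \<in> lmeasurable"
      have "(f \<circ> g) ` S = f ` (g ` S)" by (simp add: image_comp)
      then show "(f \<circ> g) ` S \<in> lmeasurable \<and> measure lebesgue ((f \<circ> g) ` S) = \<bar>det (matrix (f \<circ> g))\<bar> * measure lebesgue S"
        using P S by (simp add: matrix_compose[OF lin(2,1)] det_mul abs_mult)
    qed
  next
    fix f :: "real^'k \<Rightarrow> real^'k" and i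
    assume lin: "linear f" and 0: "\<And>x. f x $ i = 0"
    have "\<not> surj f"
    proof
      assume "surj f"
      then obtain x where "f x = 1" by (metis surjD)
      then show False using 0[of x] by simp
    qed
    then have ninj: "\<not> inj f" using linear_injective_imp_surjective[OF lin] by blast
    then have "det (matrix f) = 0" using det_nz_iff_inj[OF lin] by blast
    moreover have "measure lebesgue (f ` cbox 0 1) = 0"
      using negligible_linear_singular_image[OF lin ninj] by (simp add: negligible_imp_measure0)
    ultimately show "\<forall>S\<in>lmeasurable. f ` S \<in> lmeasurable \<and> measure lebesgue (f ` S) = \<bar>det (matrix f)\<bar> * measure lebesgue S"
      by (intro enough lin) simp
  next
    fix c :: "'k \<Rightarrow> real"
    let ?f = "\<lambda>x. \<chi> i. c i * x $ i"
    have "linear ?f" by (rule linearI) (auto simp: vec_eq_iff algebra_simps)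
    moreover have "matrix ?f = (\<chi> i j. if i = j then c i else 0)"
      by (auto simp: matrix_def axis_def vec_eq_iff)
    then have "det (matrix ?f) = prod c UNIV"
      by (subst det_diagonal) auto
    ultimately show "\<forall>S\<in>lmeasurable. ?f ` S \<in> lmeasurable \<and> measure lebesgue (?f ` S) = \<bar>det (matrix ?f)\<bar> * measure lebesgue S"
      by (intro enough) (simp_all add: measure_stretch unit)
  next
    fix m n :: 'k assume mn: "m \<noteq> n"
    let ?p = "Transposition.transpose m n"
    let ?f = "\<lambda>x::real^'k. \<chi> i. x $ ?p i"
    have lin: "linear ?f" by (rule linearI) (auto simp: vec_eq_iff)
    have invol: "?f \<circ> ?f = id" by (auto simp: fun_eq_iff vec_eq_iff)
    have "det (matrix ?f) * det (matrix ?f) = 1"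
      by (metis invol lin matrix_compose det_mul matrix_id_mat_1 det_I)
    then have "\<bar>det (matrix ?f)\<bar> = 1"
      by (auto simp only: square_eq_1_iff abs_minus_cancel abs_one)
    moreover have "?f ` cbox 0 1 = cbox 0 1"
    proof -
      have "?f ` cbox 0 1 \<subseteq> cbox 0 1" by (auto simp: mem_box_cart)
      moreover from this have "?f ` (?f ` cbox 0 1) \<subseteq> ?f ` cbox 0 1" by (rule image_mono)
      then have "cbox 0 1 \<subseteq> ?f ` cbox 0 1" unfolding image_comp invol by simp
      ultimately show ?thesis by (rule equalityI)
    qed
    ultimately show "\<forall>S\<in>lmeasurable. ?f ` S \<in> lmeasurable \<and> measure lebesgue (?f ` S) = \<bar>det (matrix ?f)\<bar> * measure lebesgue S"
      by (intro enough lin) (simp add: unit)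
  next
    fix m n :: 'k assume mn: "m \<noteq> n"
    let ?f = "\<lambda>x::real^'k. \<chi> i. if i = m then x $ m + x $ n else x $ i"
    have lin: "linear ?f" by (rule linearI) (auto simp: vec_eq_iff algebra_simps)
    have "matrix ?f = (\<chi> k. if k = m then row m (mat 1) + 1 *s row n (mat 1) else row k (mat 1))"
      by (auto simp: matrix_def axis_def vec_eq_iff row_def mat_def)
    then have "det (matrix ?f) = 1"
      using det_row_operation[OF mn, where c=1 and A="mat 1 :: real^'k^'k"] by (simp only: det_I)
    moreover have "measure lebesgue (?f ` cbox 0 1) = 1"
      using measure_shear_interval[OF mn, of 0 1] unit by (simp add: interval_ne_empty_cart)
    ultimately show "\<forall>S\<in>lmeasurable. ?f ` S \<in> lmeasurable \<and> measure lebesgue (?f ` S) = \<bar>det (matrix ?f)\<bar> * measure lebesgue S"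
      by (intro enough lin) simp
  qed
  then show ?thesis using S by blast
qed

lemma emeasure_linear_image_det:
  fixes f :: "real^'k \<Rightarrow> real^'k"
  assumes f: "linear f" "inj f" and S: "S \<in> sets lebesgue"
  shows "f ` S \<in> sets lebesgue"
    and "emeasure lebesgue (f ` S) = ennreal \<bar>det (matrix f)\<bar> * emeasure lebesgue S"
proof -
  define B where "B n = S \<inter> (cball 0 (real (Suc n)) - cball 0 (real n) \<union> (if n = 0 then {0} else {}))" for n
  have Bm: "B n \<in> lmeasurable" for n
  proof (rule bounded_set_imp_lmeasurable)
    show "bounded (B n)" by (rule bounded_subset[of "cball 0 (real (Suc n))"]) (auto simp: B_def)
    show "B n \<in> sets lebesgue" using S by (auto simp: B_def)
  qed
  have un: "S = (\<Union>n. B n)"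
  proof -
    have "\<exists>n. x \<in> B n" if "x \<in> S" for x
    proof (cases "x = 0")
      case True then show ?thesis using that by (intro exI[of _ 0]) (auto simp: B_def)
    next
      case False
      define n where "n = nat (\<lceil>norm x\<rceil> - 1)"
      have "0 < norm x" using False by simp
      then have "real n < norm x" "norm x \<le> real (Suc n)"
        unfolding n_def by linarith+
      then show ?thesis using that by (intro exI[of _ n]) (auto simp: B_def)
    qed
    then show ?thesis by (auto simp: B_def)
  qed
  have disj: "disjoint_family B"
    unfolding disjoint_family_on_def
  proof (clarify, rule equals0I)
    fix m n :: nat and x assume "m \<noteq> n" "x \<in> B m \<inter> B n"
    then show False by (auto simp: B_def split: if_splits)
  qed
  have fB: "f ` B n \<in> lmeasurable" "measure lebesgue (f ` B n) = \<bar>det (matrix f)\<bar> * measure lebesgue (B n)" for n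
    using linear_image_measure_det[OF f(1) Bm] by auto
  have eq: "f ` S = (\<Union>n. f ` B n)" unfolding un image_UN ..
  show "f ` S \<in> sets lebesgue" unfolding eq by (intro sets.countable_UN) (auto intro: fB fmeasurableD)
  have disj': "disjoint_family (\<lambda>n. f ` B n)"
    using disj f(2) by (auto simp: disjoint_family_on_def image_Int[symmetric])
  have "emeasure lebesgue (f ` S) = (\<Sum>n. emeasure lebesgue (f ` B n))"
    unfolding eq by (intro suminf_emeasure[symmetric] disj') (auto intro: fB fmeasurableD)
  also have "\<dots> = (\<Sum>n. ennreal \<bar>det (matrix f)\<bar> * emeasure lebesgue (B n))"
    using fB Bm by (intro suminf_cong) (simp add: emeasure_eq_measure2 ennreal_mult')
  also have "\<dots> = ennreal \<bar>det (matrix f)\<bar> * (\<Sum>n. emeasure lebesgue (B n))" by simp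
  also have "(\<Sum>n. emeasure lebesgue (B n)) = emeasure lebesgue S"
    unfolding un by (intro suminf_emeasure disj) (auto intro: Bm fmeasurableD)
  finally show "emeasure lebesgue (f ` S) = ennreal \<bar>det (matrix f)\<bar> * emeasure lebesgue S" .
qed

text \<open>
  The map \<open>A \<circ> inv B\<close> sends the unit ball into the ball of radius \<open>c\<close>.
\<close>

lemma abs_det_le_of_norm_le:
  fixes A B :: "real^'k \<Rightarrow> real^'k"
  assumes lin: "linear A" "linear B" "inj B" and c: "0 < c" "\<And>v. norm (A v) \<le> c * norm (B v)"
  shows "\<bar>det (matrix A)\<bar> \<le> c ^ CARD('k) * \<bar>det (matrix B)\<bar>"
proof -
  obtain B' where B': "linear B'" "B' \<circ> B = id" "B \<circ> B' = id"
    using lin(2,3) by (metis linear_injective_left_inverse linear_inverse_left)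
  let ?D = "A \<circ> B'"
  have D: "linear ?D" using B'(1) lin(1) by (rule linear_compose)
  have "?D ` ball 0 1 \<subseteq> ball 0 c"
  proof clarsimp
    fix x :: "real^'k" assume x: "norm x < 1"
    have "B (B' x) = x" using B'(3) by (metis comp_apply id_apply)
    then have "norm (A (B' x)) \<le> c * norm x" using c(2)[of "B' x"] by simp
    also have "\<dots> < c" using x c(1) by simp
    finally show "norm (A (B' x)) < c" .
  qed
  then have "measure lebesgue (?D ` ball 0 1) \<le> measure lebesgue (ball (0::real^'k) c)"
    using linear_image_measure_det[OF D, of "ball 0 1"]
    by (intro measure_mono_fmeasurable) (auto intro: fmeasurableD)
  then have "\<bar>det (matrix ?D)\<bar> * measure lebesgue (ball (0::real^'k) 1) \<le> c ^ CARD('k) * measure lebesgue (ball (0::real^'k) 1)"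
    using linear_image_measure_det[OF D, of "ball 0 1"] c(1) by (simp add: content_ball mult.commute)
  then have "\<bar>det (matrix ?D)\<bar> \<le> c ^ CARD('k)"
    using content_ball_gt_0_iff[of "0::real^'k" 1] by simp
  moreover have "matrix A = matrix ?D ** matrix B"
  proof -
    have "A = ?D \<circ> B" using B'(2) by (metis comp_assoc comp_id)
    then show ?thesis using matrix_compose[OF lin(2) D] by simp
  qed
  ultimately show ?thesis by (simp add: det_mul abs_mult mult_right_mono)
qed

section \<open>Rademacher's theorem\<close>

text \<open>
  Up to the strictness of the inequalities, the points at which the lower derivative along \<open>v\<close> is at most \<open>p\<close>
  and the upper one at least \<open>q\<close>. For \<open>p < q\<close> this is the only obstruction to the convergence of bounded
  difference quotients.
\<close>

definition oscillation_set :: "('a::real_normed_vector \<Rightarrow> real) \<Rightarrow> 'a \<Rightarrow> real \<Rightarrow> real \<Rightarrow> 'a set" where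
  "oscillation_set f v p q =
     {x. (\<forall>n. \<exists>h. h \<noteq> 0 \<and> \<bar>h\<bar> < 1 / real (Suc n) \<and> (f (x + h *\<^sub>R v) - f x) / h < p) \<and>
         (\<forall>n. \<exists>h. h \<noteq> 0 \<and> \<bar>h\<bar> < 1 / real (Suc n) \<and> q < (f (x + h *\<^sub>R v) - f x) / h)}"

text \<open>
  For a fixed step \<open>h\<close> both conditions are open in \<open>x\<close>, so arbitrary unions over \<open>h\<close> are harmless.
\<close>

lemma oscillation_set_borel:
  assumes f: "continuous_on UNIV f"
  shows "oscillation_set f v p q \<in> sets borel"
proof -
  let ?Q = "\<lambda>h x. (f (x + h *\<^sub>R v) - f x) / h"
  let ?I = "\<lambda>n. {h. h \<noteq> 0 \<and> \<bar>h\<bar> < 1 / real (Suc n)}"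
  have c: "continuous_on UNIV (?Q h)" for h
  proof (cases "h = 0")
    case False
    then show ?thesis
      by (intro continuous_intros continuous_on_subset[OF f] continuous_on_compose2[OF f]) auto
  qed simp
  have "oscillation_set f v p q =
      (\<Inter>n. \<Union>h\<in>?I n. {x. ?Q h x < p}) \<inter> (\<Inter>n. \<Union>h\<in>?I n. {x. q < ?Q h x})"
    unfolding oscillation_set_def by blast
  moreover have "(\<Union>h\<in>?I n. {x. ?Q h x < p}) \<in> sets borel" "(\<Union>h\<in>?I n. {x. q < ?Q h x}) \<in> sets borel" for n
    by (intro borel_open open_UN ballI open_Collect_less c continuous_on_const)+
  ultimately show ?thesis by auto
qed

text \<open>
  If the lower and the upper limit of the quotients differ, two rational numbers lie between them.
\<close>

lemma difference_quotient_converges: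
  fixes f :: "'a::real_normed_vector \<Rightarrow> real"
  assumes bound: "\<And>h. \<bar>f (x + h *\<^sub>R v) - f x\<bar> \<le> C * \<bar>h\<bar>"
    and no_osc: "\<And>p q::rat. p < q \<Longrightarrow> x \<notin> oscillation_set f v (of_rat p) (of_rat q)"
  shows "\<exists>l. ((\<lambda>h. (f (x + h *\<^sub>R v) - f x) / h) \<longlongrightarrow> l) (at 0)"
proof -
  let ?Q = "\<lambda>h. (f (x + h *\<^sub>R v) - f x) / h"
  let ?F = "\<lambda>h. ereal (?Q h)"
  have freq: "\<exists>h. h \<noteq> 0 \<and> \<bar>h\<bar> < 1 / real (Suc n) \<and> P (?Q h)"
    if "\<not> eventually (\<lambda>h. \<not> P (?Q h)) (at 0)" for P n
    using that unfolding eventually_at by (auto simp: dist_real_def)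
  have "\<not> Liminf (at 0) ?F < Limsup (at 0) ?F"
  proof
    assume "Liminf (at 0) ?F < Limsup (at 0) ?F"
    then obtain q where q: "Liminf (at 0) ?F < ereal (of_rat q)" "ereal (of_rat q) < Limsup (at 0) ?F"
      using ereal_dense3 by blast
    obtain p where p: "Liminf (at 0) ?F < ereal (of_rat p)" "ereal (of_rat p) < ereal (of_rat q)"
      using ereal_dense3[OF q(1)] by blast
    have "\<not> eventually (\<lambda>h. \<not> ?Q h < of_rat p) (at 0)"
    proof
      assume "eventually (\<lambda>h. \<not> ?Q h < of_rat p) (at 0)"
      then have "eventually (\<lambda>h. ereal (of_rat p) \<le> ?F h) (at 0)"
        by (rule eventually_mono) simp
      then have "ereal (of_rat p) \<le> Liminf (at 0) ?F" by (rule Liminf_bounded)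
      then show False using p(1) by simp
    qed
    moreover have "\<not> eventually (\<lambda>h. \<not> of_rat q < ?Q h) (at 0)"
    proof
      assume "eventually (\<lambda>h. \<not> of_rat q < ?Q h) (at 0)"
      then have "eventually (\<lambda>h. ?F h \<le> ereal (of_rat q)) (at 0)"
        by (rule eventually_mono) simp
      then have "Limsup (at 0) ?F \<le> ereal (of_rat q)" by (rule Limsup_bounded)
      then show False using q(2) by simp
    qed
    ultimately have "x \<in> oscillation_set f v (of_rat p) (of_rat q)"
      unfolding oscillation_set_def
      using freq[of "\<lambda>z. z < of_rat p"] freq[of "\<lambda>z. of_rat q < z"] by simp
    moreover have "p < q" using p(2) by (simp add: of_rat_less)
    ultimately show False using no_osc by blast
  qed
  moreover have "Liminf (at 0) ?F \<le> Limsup (at 0) ?F"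
    by (rule Liminf_le_Limsup) simp
  ultimately have lim: "(?F \<longlongrightarrow> Liminf (at 0) ?F) (at 0)"
    by (subst tendsto_iff_Liminf_eq_Limsup) auto
  have Qb: "- C \<le> ?Q h" "?Q h \<le> C" if "h \<noteq> 0" for h
  proof -
    have "\<bar>?Q h\<bar> \<le> C" using bound[of h] that by (simp add: divide_simps)
    then show "- C \<le> ?Q h" "?Q h \<le> C" by linarith+
  qed
  have ev: "eventually (\<lambda>h. h \<noteq> (0::real)) (at 0)" by (simp add: eventually_at_filter)
  have "ereal (- C) \<le> Liminf (at 0) ?F"
    by (rule Liminf_bounded, rule eventually_mono[OF ev]) (simp add: Qb)
  moreover have "Liminf (at 0) ?F \<le> ereal C"
  proof (rule tendsto_upperbound[OF lim])
    show "eventually (\<lambda>h. ?F h \<le> ereal C) (at 0)"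
      by (rule eventually_mono[OF ev]) (simp add: Qb)
  qed simp
  ultimately obtain l where "Liminf (at 0) ?F = ereal l"
    by (cases "Liminf (at 0) ?F") auto
  with lim have "(?Q \<longlongrightarrow> l) (at 0)" by simp
  then show ?thesis by blast
qed

lemma lipschitz_image_negligible:
  fixes g :: "'a::euclidean_space \<Rightarrow> 'a"
  assumes "M-lipschitz_on UNIV g" "negligible N"
  shows "negligible (g ` N)"
proof (rule negligible_locally_Lipschitz_image)
  fix x assume "x \<in> N"
  show "\<exists>T B. open T \<and> x \<in> T \<and> (\<forall>y\<in>N \<inter> T. norm (g y - g x) \<le> B * norm (y - x))"
    using lipschitz_onD[OF assms(1)] by (intro exI[of _ UNIV] exI[of _ M]) (auto simp: dist_norm)
qed (use assms in auto)

text \<open>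
  A cover of \<open>A\<close> by disjoint short intervals, each of which is stretched by a factor of at most \<open>p\<close>, is
  mapped to a cover of the image; the null set missed by Vitali's theorem has a null image.
\<close>

lemma increasing_image_measure_le:
  fixes g :: "real \<Rightarrow> real"
  assumes A: "A \<in> sets lebesgue" and g: "mono g" "M-lipschitz_on UNIV g" and p: "0 \<le> p"
    and small: "\<And>x d. x \<in> A \<Longrightarrow> 0 < d \<Longrightarrow>
      \<exists>a b. a < b \<and> a \<le> x \<and> x \<le> b \<and> b - a < d \<and> g b - g a \<le> p * (b - a)"
  shows "emeasure lebesgue (g ` A) \<le> ennreal p * emeasure lebesgue A"
proof (rule ennreal_le_of_forall_le_add)
  fix e :: real assume "0 < e"
  then obtain U where U: "open U" "A \<subseteq> U" "emeasure lebesgue U \<le> emeasure lebesgue A + ennreal e"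
    using lebesgue_outer_open_le[OF A] by blast
  let ?K = "{(a, b). a < b \<and> {a..b} \<subseteq> U \<and> g b - g a \<le> p * (b - a)}"
  let ?c = "\<lambda>i. (fst i + snd i) / 2" and ?r = "\<lambda>i. (snd i - fst i) / 2"
  have cb: "cball (?c i) (?r i) = {fst i..snd i}" for i :: "real \<times> real"
    by (simp add: cball_eq_atLeastAtMost field_simps)
  obtain C where C: "countable C" "C \<subseteq> ?K"
     "pairwise (\<lambda>i j. disjnt (cball (?c i) (?r i)) (cball (?c j) (?r j))) C"
     "negligible (A - (\<Union>i\<in>C. cball (?c i) (?r i)))"
  proof (rule Vitali_covering_theorem_cballs[of ?K ?r A ?c])
    show "0 < ?r i" if "i \<in> ?K" for i using that by (simp add: case_prod_beta)
    fix x d :: real assume x: "x \<in> A" and d: "0 < d"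
    obtain r where r: "0 < r" "ball x r \<subseteq> U" using U x by (meson open_contains_ball subsetD)
    obtain a b where ab: "a < b" "a \<le> x" "x \<le> b" "b - a < min d r" "g b - g a \<le> p * (b - a)"
      using small[OF x, of "min d r"] d r by auto
    have "{a..b} \<subseteq> ball x r" using ab by (auto simp: dist_real_def)
    then have "(a, b) \<in> ?K" using ab r by auto
    moreover have "x \<in> cball (?c (a, b)) (?r (a, b))" unfolding cb using ab by simp
    moreover have "?r (a, b) < d" using ab by simp
    ultimately show "\<exists>i. i \<in> ?K \<and> x \<in> cball (?c i) (?r i) \<and> ?r i < d" by blast
  qed
  have Ci: "fst i < snd i" "{fst i..snd i} \<subseteq> U" "g (snd i) - g (fst i) \<le> p * (snd i - fst i)" if "i \<in> C" for i
    using subsetD[OF C(2) that] by (simp_all add: case_prod_beta)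
  define N where "N = A - (\<Union>i\<in>C. {fst i..snd i})"
  have N: "negligible (g ` N)"
    using C(4) unfolding cb N_def by (rule lipschitz_image_negligible[OF g(2)])
  have sub: "g ` A \<subseteq> (\<Union>i\<in>C. {g (fst i)..g (snd i)}) \<union> g ` N"
  proof
    fix y assume "y \<in> g ` A"
    then obtain x where x: "x \<in> A" "y = g x" by blast
    show "y \<in> (\<Union>i\<in>C. {g (fst i)..g (snd i)}) \<union> g ` N"
    proof (cases "x \<in> N")
      case False
      then obtain i where "i \<in> C" "fst i \<le> x" "x \<le> snd i" using x by (auto simp: N_def)
      then show ?thesis using x(2) monoD[OF g(1)] by auto
    qed (use x in auto)
  qed
  have "emeasure lebesgue (g ` A) \<le> emeasure lebesgue ((\<Union>i\<in>C. {g (fst i)..g (snd i)}) \<union> g ` N)"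
    using sub N C(1) by (intro emeasure_mono sets.Un sets.countable_UN' negligible_imp_sets) auto
  also have "\<dots> \<le> emeasure lebesgue (\<Union>i\<in>C. {g (fst i)..g (snd i)}) + emeasure lebesgue (g ` N)"
    using N C(1) by (intro emeasure_subadditive sets.countable_UN' negligible_imp_sets) auto
  also have "emeasure lebesgue (g ` N) = 0"
    by (rule null_setsD1[OF N[unfolded negligible_iff_null_sets]])
  also have "emeasure lebesgue (\<Union>i\<in>C. {g (fst i)..g (snd i)}) + 0 \<le> infsum (\<lambda>i. emeasure lebesgue {g (fst i)..g (snd i)}) C"
    using emeasure_UN_le_infsum[OF C(1), of "\<lambda>i. {g (fst i)..g (snd i)}" lebesgue] by simp
  also have "\<dots> \<le> infsum (\<lambda>i. ennreal p * ennreal (unit_ball_vol DIM(real) * ?r i ^ DIM(real))) C"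
  proof (rule infsum_mono)
    fix i assume i: "i \<in> C"
    have "g (fst i) \<le> g (snd i)" using Ci(1)[OF i] monoD[OF g(1)] by simp
    then have "emeasure lebesgue {g (fst i)..g (snd i)} = ennreal (g (snd i) - g (fst i))" by simp
    also have "\<dots> \<le> ennreal (p * (snd i - fst i))" using Ci(3)[OF i] by (rule ennreal_leI)
    also have "\<dots> = ennreal p * ennreal (unit_ball_vol DIM(real) * ?r i ^ DIM(real))"
    proof -
      have "unit_ball_vol DIM(real) * ?r i ^ DIM(real) = snd i - fst i"
        by (simp add: diff_divide_distrib)
      then show ?thesis by (simp only: ennreal_mult'[OF p])
    qed
    finally show "emeasure lebesgue {g (fst i)..g (snd i)} \<le> \<dots>" .
  qed (auto intro!: nonneg_summable_on_complete)
  also have "\<dots> = ennreal p * infsum (\<lambda>i. ennreal (unit_ball_vol DIM(real) * ?r i ^ DIM(real))) C"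
    by (rule infsum_ennreal_cmult)
  also have "\<dots> \<le> ennreal p * emeasure lebesgue U"
    using U(1) Ci(1,2) by (intro mult_left_mono infsum_ball_volumes_le[where a="?c"] C(3))
      (simp_all add: cb less_imp_le)
  also have "\<dots> \<le> ennreal p * (emeasure lebesgue A + ennreal e)"
    by (intro mult_left_mono U) auto
  finally show "emeasure lebesgue (g ` A) \<le> ennreal p * (emeasure lebesgue A + ennreal e)" .
qed simp

text \<open>
  Adding a linear function turns \<open>f\<close> into an increasing bi-Lipschitz bijection \<open>g\<close> and shifts \<open>p\<close> and \<open>q\<close>
  by the same constant \<open>c\<close>. Near each point of the oscillation set there are arbitrarily short intervals
  which \<open>g\<close> stretches by at most \<open>p + c\<close>, and others which \<open>g\<close> stretches by at least \<open>q + c\<close>. The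
  preceding lemma for \<open>g\<close>, respectively for its inverse, bounds the measure of the image from above by
  \<open>p + c\<close> times, and from below by \<open>q + c\<close> times, the measure of the set, which must therefore vanish.
\<close>

lemma oscillation_set_null_real:
  fixes f :: "real \<Rightarrow> real"
  assumes f: "L-lipschitz_on UNIV f" and pq: "p < q"
  shows "emeasure lborel (oscillation_set f 1 p q) = 0"
proof -
  have L0: "0 \<le> L" using f by (rule lipschitz_on_nonneg)
  have fL: "\<bar>f y - f x\<bar> \<le> L * \<bar>y - x\<bar>" for x y
    using lipschitz_onD[OF f, of y x] by (simp add: dist_real_def)
  have cf: "continuous_on UNIV f" using f by (rule lipschitz_on_continuous_on)
  (* g has slopes between 1 and 2 L + 1 *)
  define c where "c = L + 1"
  define g where "g x = f x + c * x" for x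
  have g_lower: "y - x \<le> g y - g x" if "x \<le> y" for x y
    using fL[of y x] that by (simp add: g_def c_def algebra_simps)
  have g_upper: "g y - g x \<le> (2 * L + 1) * (y - x)" if "x \<le> y" for x y
    using fL[of y x] that by (simp add: g_def c_def algebra_simps)
  have mono_g: "mono g" using g_lower by (force intro: monoI)
  have lip_g: "(2 * L + 1)-lipschitz_on UNIV g"
  proof (rule lipschitz_onI)
    fix x y :: real
    show "dist (g x) (g y) \<le> (2 * L + 1) * dist x y"
    proof (cases "x \<le> y")
      case True
      then show ?thesis using g_lower[OF True] g_upper[OF True] by (simp add: dist_real_def)
    next
      case False
      then have "y \<le> x" by simp
      then show ?thesis using g_lower[of y x] g_upper[of y x] by (simp add: dist_real_def)
    qed
  qed (use L0 in simp)
  have cg: "continuous_on UNIV g" using lip_g by (rule lipschitz_on_continuous_on)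
  have inj_g: "inj g"
  proof (rule injI)
    fix x y assume "g x = g y"
    then show "x = y" using g_lower[of x y] g_lower[of y x] by linarith
  qed
  have surj_g: "surj g"
  proof -
    have "\<exists>x. g x = y" for y
    proof -
      define b where "b = \<bar>y - g 0\<bar>"
      have "g (- b) \<le> y" "y \<le> g b" using g_lower[of "- b" 0] g_lower[of 0 b] by (auto simp: b_def)
      moreover have "- b \<le> b" by (simp add: b_def)
      ultimately have "\<exists>x. - b \<le> x \<and> x \<le> b \<and> g x = y"
        by (intro IVT') (auto intro: continuous_on_subset[OF cg])
      then show ?thesis by blast
    qed
    then show ?thesis by (metis surjI)
  qed
  define G where "G = inv g"
  have Gg: "G (g x) = x" and gG: "g (G x) = x" for x
    using inj_g surj_g by (simp_all add: G_def surj_f_inv_f)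
  have mono_G: "mono G"
  proof (rule monoI)
    fix x y :: real assume "x \<le> y"
    then show "G x \<le> G y" using g_lower[of "G y" "G x"] by (cases "G x \<le> G y") (auto simp: gG)
  qed
  have lip_G: "1-lipschitz_on UNIV G"
  proof (rule lipschitz_onI)
    fix x y :: real
    show "dist (G x) (G y) \<le> 1 * dist x y"
      using g_lower[of "G x" "G y"] g_lower[of "G y" "G x"] by (cases "G x \<le> G y") (auto simp: gG dist_real_def)
  qed simp
  have cG: "continuous_on UNIV G" using lip_G by (rule lipschitz_on_continuous_on)
  have quot: "(f (x + h *\<^sub>R 1) - f x) / h = (g (x + h) - g x) / h - c" if "h \<noteq> 0" for x h
    using that by (simp add: g_def field_simps)
  let ?O = "oscillation_set f 1 p q"
  have Ob: "?O \<in> sets borel" by (rule oscillation_set_borel[OF cf])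
  have small_p: "\<exists>a b. a < b \<and> a \<le> x \<and> x \<le> b \<and> b - a < d \<and> g b - g a \<le> (p + c) * (b - a)"
    if x: "x \<in> ?O" and d: "0 < d" for x d
  proof -
    obtain n where n: "1 / real (Suc n) < d" using d nat_approx_posE by metis
    obtain h where h: "h \<noteq> 0" "\<bar>h\<bar> < 1 / real (Suc n)" "(f (x + h *\<^sub>R 1) - f x) / h < p"
      using x unfolding oscillation_set_def by blast
    have "(g (x + h) - g x) / h < p + c" using h(3) unfolding quot[OF h(1)] by simp
    moreover have "\<bar>h\<bar> < d" using h(2) n by linarith
    ultimately show ?thesis
      using h(1)
      by (cases "0 < h") (intro exI[of _ x] exI[of _ "x + h"], simp add: field_simps,
          intro exI[of _ "x + h"] exI[of _ x], simp add: field_simps)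
  qed
  have small_q: "\<exists>a b. a < b \<and> a \<le> x \<and> x \<le> b \<and> b - a < d \<and> (q + c) * (b - a) \<le> g b - g a"
    if x: "x \<in> ?O" and d: "0 < d" for x d
  proof -
    obtain n where n: "1 / real (Suc n) < d" using d nat_approx_posE by metis
    obtain h where h: "h \<noteq> 0" "\<bar>h\<bar> < 1 / real (Suc n)" "q < (f (x + h *\<^sub>R 1) - f x) / h"
      using x unfolding oscillation_set_def by blast
    have "q + c < (g (x + h) - g x) / h" using h(3) unfolding quot[OF h(1)] by simp
    moreover have "\<bar>h\<bar> < d" using h(2) n by linarith
    ultimately show ?thesis
      using h(1)
      by (cases "0 < h") (intro exI[of _ x] exI[of _ "x + h"], simp add: field_simps,
          intro exI[of _ "x + h"] exI[of _ x], simp add: field_simps)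
  qed
  have "emeasure lebesgue (?O \<inter> cball 0 (real n)) = 0" for n
  proof (cases "?O = {}")
    case False
    then obtain x where "x \<in> ?O" by blast
    from small_p[OF this, of 1] obtain a b where ab: "a < b" "g b - g a \<le> (p + c) * (b - a)" by auto
    have p1: "1 \<le> p + c"
    proof (rule ccontr)
      assume "\<not> 1 \<le> p + c"
      then have less: "(p + c) * (b - a) < 1 * (b - a)" using ab(1) by (intro mult_strict_right_mono) auto
      have "b - a \<le> g b - g a" using ab(1) by (intro g_lower) simp
      also have "\<dots> \<le> (p + c) * (b - a)" by (rule ab(2))
      also note less
      finally show False by simp
    qed
    let ?A = "?O \<inter> cball 0 (real n)"
    have Ab: "?A \<in> sets borel" using Ob by simp
    have gA: "g ` ?A = G -` ?A" by (auto simp: Gg image_iff intro!: bexI[of _ "G _"] gG[symmetric])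
    then have gAb: "g ` ?A \<in> sets borel"
      using measurable_sets[OF borel_measurable_continuous_onI[OF cG] Ab] by simp
    have 1: "emeasure lebesgue (g ` ?A) \<le> ennreal (p + c) * emeasure lebesgue ?A"
      by (rule increasing_image_measure_le[OF _ mono_g lip_g]) (use Ab p1 small_p in auto)
    have "emeasure lebesgue (G ` (g ` ?A)) \<le> ennreal (1 / (q + c)) * emeasure lebesgue (g ` ?A)"
    proof (rule increasing_image_measure_le[OF _ mono_G lip_G])
      fix y d :: real assume "y \<in> g ` ?A" and d: "0 < d"
      then obtain x where x: "x \<in> ?O" "y = g x" by blast
      obtain a b where ab: "a < b" "a \<le> x" "x \<le> b" "b - a < d / (2 * L + 1)" "(q + c) * (b - a) \<le> g b - g a"
        using small_q[OF x(1), of "d / (2 * L + 1)"] d L0 by auto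
      have "g b - g a < d"
        using g_upper[of a b] ab(1,4) L0 by (simp add: field_simps)
      moreover have "g a < g b" using g_lower[of a b] ab(1) by simp
      moreover have "g a \<le> y" "y \<le> g b" using x(2) ab(2,3) monoD[OF mono_g] by auto
      moreover have "G (g b) - G (g a) \<le> 1 / (q + c) * (g b - g a)"
        using ab(5) p1 pq by (simp add: Gg field_simps)
      ultimately show "\<exists>a b. a < b \<and> a \<le> y \<and> y \<le> b \<and> b - a < d \<and> G b - G a \<le> 1 / (q + c) * (b - a)"
        by blast
    qed (use gAb p1 pq in auto)
    also have "G ` (g ` ?A) = ?A" by (simp add: image_image Gg)
    also have "ennreal (1 / (q + c)) * emeasure lebesgue (g ` ?A)
        \<le> ennreal (1 / (q + c)) * (ennreal (p + c) * emeasure lebesgue ?A)"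
      by (intro mult_left_mono 1) auto
    also have "\<dots> = ennreal ((p + c) / (q + c)) * emeasure lebesgue ?A"
      using p1 pq by (simp add: ennreal_mult'[symmetric] mult.assoc[symmetric])
    finally have 2: "emeasure lebesgue ?A \<le> ennreal ((p + c) / (q + c)) * emeasure lebesgue ?A" .
    have "emeasure lebesgue ?A \<le> emeasure lebesgue (cball (0::real) (real n))"
      by (intro emeasure_mono) auto
    also have "\<dots> < \<infinity>" using emeasure_compact_finite[OF compact_cball, of "0::real" "real n"] by simp
    finally obtain m where m: "emeasure lebesgue ?A = ennreal m" "0 \<le> m"
      by (cases "emeasure lebesgue ?A") auto
    have "m \<le> (p + c) / (q + c) * m"
      using 2 m p1 pq by (simp flip: ennreal_mult')
    moreover have "(p + c) / (q + c) < 1" using p1 pq by simp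
    ultimately have "m \<le> 0"
      using mult_strict_right_mono[of "(p + c) / (q + c)" 1 m] by linarith
    then show ?thesis using m by simp
  qed simp
  then have "?O \<inter> cball 0 (real n) \<in> null_sets lborel" for n
    using Ob by (intro null_setsI) (auto simp: emeasure_completion)
  then have "(\<Union>n. ?O \<inter> cball 0 (real n)) \<in> null_sets lborel" by (rule null_sets_UN)
  moreover have "(\<Union>n. ?O \<inter> cball 0 (real n)) = ?O"
    by (auto simp: dist_real_def intro: real_arch_simple)
  ultimately show ?thesis by auto
qed

text \<open>
  On each line in direction \<open>v\<close> the oscillation set is one of a function of one variable, hence
  null. Integrating the indicator function of \<open>x + t v\<close> in both orders over all \<open>x\<close> and \<open>t\<close> gives 0 on one
  side and, by translation invariance, infinitely often the measure of the set on the other.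
\<close>

lemma oscillation_set_null:
  fixes f :: "'a::euclidean_space \<Rightarrow> real"
  assumes f: "L-lipschitz_on UNIV f" and pq: "p < q"
  shows "oscillation_set f v p q \<in> null_sets lborel"
proof -
  let ?B = "oscillation_set f v p q"
  have B[measurable]: "?B \<in> sets borel"
    by (intro oscillation_set_borel lipschitz_on_continuous_on[OF f])
  have line: "emeasure lborel {t. x + t *\<^sub>R v \<in> ?B} = 0" for x
  proof -
    let ?g = "\<lambda>t. f (x + t *\<^sub>R v)"
    have "(L * norm v)-lipschitz_on UNIV ?g"
    proof (rule lipschitz_onI)
      fix s t :: real
      have "dist (?g s) (?g t) \<le> L * dist (x + s *\<^sub>R v) (x + t *\<^sub>R v)"
        by (rule lipschitz_onD[OF f]) auto
      also have "dist (x + s *\<^sub>R v) (x + t *\<^sub>R v) = norm v * dist s t"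
        by (simp add: dist_norm flip: scaleR_left_diff_distrib)
      finally show "dist (?g s) (?g t) \<le> L * norm v * dist s t" by simp
    qed (use lipschitz_on_nonneg[OF f] in simp)
    from oscillation_set_null_real[OF this pq]
    have "emeasure lborel (oscillation_set ?g 1 p q) = 0" .
    moreover have "oscillation_set ?g 1 p q = {t. x + t *\<^sub>R v \<in> ?B}"
      by (simp add: oscillation_set_def algebra_simps)
    ultimately show ?thesis by simp
  qed
  (* the left-hand side is infinite unless B is null *)
  have "(\<integral>\<^sup>+t. emeasure lborel ?B \<partial>(lborel :: real measure)) =
      (\<integral>\<^sup>+t. \<integral>\<^sup>+x. indicator ?B (x + t *\<^sub>R v) \<partial>lborel \<partial>(lborel :: real measure))"
  proof (rule nn_integral_cong)
    fix t :: real
    have "emeasure lborel ?B = (\<integral>\<^sup>+x. indicator ?B x \<partial>lborel)" by simp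
    also have "\<dots> = (\<integral>\<^sup>+x. indicator ?B x \<partial>distr lborel borel ((+) (t *\<^sub>R v)))"
      by (simp only: lborel_distr_plus)
    also have "\<dots> = (\<integral>\<^sup>+x. indicator ?B (t *\<^sub>R v + x) \<partial>lborel)"
      by (rule nn_integral_distr) auto
    finally show "emeasure lborel ?B = (\<integral>\<^sup>+x. indicator ?B (x + t *\<^sub>R v) \<partial>lborel)"
      by (simp add: add.commute)
  qed
  also have "\<dots> = (\<integral>\<^sup>+x. \<integral>\<^sup>+t. indicator ?B (x + t *\<^sub>R v) \<partial>(lborel :: real measure) \<partial>lborel)"
    by (rule lborel_pair.Fubini') measurable
  also have "\<dots> = (\<integral>\<^sup>+x. 0 \<partial>(lborel :: 'a measure))"
  proof (rule nn_integral_cong)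
    fix x :: 'a
    have "(\<integral>\<^sup>+t. indicator ?B (x + t *\<^sub>R v) \<partial>(lborel :: real measure)) =
        (\<integral>\<^sup>+t. indicator {t. x + t *\<^sub>R v \<in> ?B} t \<partial>lborel)"
      by (intro nn_integral_cong) (simp add: indicator_def)
    also have "\<dots> = 0" by (subst nn_integral_indicator) (auto simp: line)
    finally show "(\<integral>\<^sup>+t. indicator ?B (x + t *\<^sub>R v) \<partial>(lborel :: real measure)) = 0" .
  qed
  finally have "emeasure lborel ?B = 0" by (simp add: ennreal_mult_eq_top_iff split: if_splits)
  then show ?thesis by (intro null_setsI) auto
qed

lemma AE_difference_quotient_converges:
  fixes f :: "'a::euclidean_space \<Rightarrow> real"
  assumes f: "L-lipschitz_on UNIV f"
  shows "AE x in lborel. \<exists>l. ((\<lambda>h. (f (x + h *\<^sub>R v) - f x) / h) \<longlongrightarrow> l) (at 0)"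
proof -
  have "AE x in lborel. \<forall>pq\<in>{(p::rat, q::rat). p < q}. x \<notin> oscillation_set f v (of_rat (fst pq)) (of_rat (snd pq))"
  proof (subst AE_ball_countable, simp, clarify)
    fix p q :: rat assume "p < q"
    then have "oscillation_set f v (of_rat p) (of_rat q) \<in> null_sets lborel"
      by (intro oscillation_set_null[OF f]) (simp add: of_rat_less)
    then show "AE x in lborel. x \<notin> oscillation_set f v (of_rat (fst (p, q))) (of_rat (snd (p, q)))"
      by (simp add: AE_not_in)
  qed
  then show ?thesis
  proof (rule AE_mp, intro AE_I2 impI)
    fix x assume x: "\<forall>pq\<in>{(p::rat, q::rat). p < q}. x \<notin> oscillation_set f v (of_rat (fst pq)) (of_rat (snd pq))"
    show "\<exists>l. ((\<lambda>h. (f (x + h *\<^sub>R v) - f x) / h) \<longlongrightarrow> l) (at 0)"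
    proof (rule difference_quotient_converges)
      show "\<bar>f (x + h *\<^sub>R v) - f x\<bar> \<le> (L * norm v) * \<bar>h\<bar>" for h
        using lipschitz_onD[OF f, of "x + h *\<^sub>R v" x] by (simp add: dist_norm mult_ac)
    qed (use x in auto)
  qed
qed

text \<open>
  Difference quotients along the steps \<open>1 / (n + 1)\<close>; a sequence of steps suffices for measurability
  and dominated convergence.
\<close>

definition diff_quot :: "('a::real_normed_vector \<Rightarrow> real) \<Rightarrow> 'a \<Rightarrow> nat \<Rightarrow> 'a \<Rightarrow> real" where
  "diff_quot f v n x = (f (x + (1 / real (Suc n)) *\<^sub>R v) - f x) * real (Suc n)"

text \<open>
  A limit of a sequence of Borel functions, hence a Borel function, with arbitrary values where the
  directional derivative does not exist.
\<close>

definition dir_deriv :: "('a::real_normed_vector \<Rightarrow> real) \<Rightarrow> 'a \<Rightarrow> 'a \<Rightarrow> real" where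
  "dir_deriv f v x = lim (\<lambda>n. diff_quot f v n x)"

lemma diff_quot_tendsto:
  assumes "((\<lambda>h. (f (x + h *\<^sub>R v) - f x) / h) \<longlongrightarrow> l) (at 0)"
  shows "(\<lambda>n. diff_quot f v n x) \<longlonglongrightarrow> l"
proof -
  have "filterlim (\<lambda>n. 1 / real (Suc n)) (at 0) sequentially"
    unfolding filterlim_at using inverse_Suc_tendsto_0 by (intro conjI always_eventually) auto
  from filterlim_compose[OF assms this] show ?thesis
    by (simp add: diff_quot_def)
qed

lemma dir_deriv_eq:
  assumes "((\<lambda>h. (f (x + h *\<^sub>R v) - f x) / h) \<longlongrightarrow> l) (at 0)"
  shows "dir_deriv f v x = l"
  unfolding dir_deriv_def by (rule limI[OF diff_quot_tendsto[OF assms]])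

lemma AE_tendsto_dir_deriv:
  fixes f :: "'a::euclidean_space \<Rightarrow> real"
  assumes f: "L-lipschitz_on UNIV f"
  shows "AE x in lborel. ((\<lambda>h. (f (x + h *\<^sub>R v) - f x) / h) \<longlongrightarrow> dir_deriv f v x) (at 0)"
  using AE_difference_quotient_converges[OF f, of v] by (rule AE_mp) (auto simp: dir_deriv_eq)

lemma borel_measurable_diff_quot:
  fixes f :: "'a::euclidean_space \<Rightarrow> real"
  assumes [measurable]: "f \<in> borel_measurable borel"
  shows "diff_quot f v n \<in> borel_measurable borel"
  unfolding diff_quot_def[abs_def] by measurable

lemma borel_measurable_dir_deriv:
  fixes f :: "'a::euclidean_space \<Rightarrow> real"
  assumes "f \<in> borel_measurable borel"
  shows "dir_deriv f v \<in> borel_measurable borel"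
  unfolding dir_deriv_def[abs_def]
  by (intro borel_measurable_lim_metric borel_measurable_diff_quot assms)

lemma diff_quot_bound:
  assumes "L-lipschitz_on UNIV f"
  shows "\<bar>diff_quot f v n x\<bar> \<le> L * norm v"
proof -
  have "\<bar>f (x + (1 / real (Suc n)) *\<^sub>R v) - f x\<bar> \<le> L * ((1 / real (Suc n)) * norm v)"
    using lipschitz_onD[OF assms, of "x + (1 / real (Suc n)) *\<^sub>R v" x] by (simp add: dist_norm)
  then have "\<bar>f (x + (1 / real (Suc n)) *\<^sub>R v) - f x\<bar> * real (Suc n) \<le> L * ((1 / real (Suc n)) * norm v) * real (Suc n)"
    by (rule mult_right_mono) simp
  then show ?thesis by (simp add: diff_quot_def abs_mult)
qed

text \<open>
  Adding the bound \<open>C\<close> makes both functions densities of measures which agree on boxes, and the boxes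
  are a generator of the Borel sets that is closed under intersection.
\<close>

lemma AE_eq_if_box_integrals_eq:
  fixes h1 h2 :: "'a::euclidean_space \<Rightarrow> real"
  assumes [measurable]: "h1 \<in> borel_measurable borel" "h2 \<in> borel_measurable borel"
    and C: "0 \<le> C" and bound: "AE x in lborel. \<bar>h1 x\<bar> \<le> C" "AE x in lborel. \<bar>h2 x\<bar> \<le> C"
    and eq: "\<And>a b. (LINT x:box a b|lborel. h1 x) = (LINT x:box a b|lborel. h2 x)"
  shows "AE x in lborel. h1 x = h2 x"
proof -
  let ?M = "\<lambda>h. density lborel (\<lambda>x. ennreal (h x + C))"
  have box: "emeasure (?M h) (box a b) = ennreal ((LINT x:box a b|lborel. h x) + C * measure lborel (box a b))"
    if [measurable]: "h \<in> borel_measurable borel" and b: "AE x in lborel. \<bar>h x\<bar> \<le> C" for h :: "'a \<Rightarrow> real" and a b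
  proof -
    have ind: "integrable lborel (indicator (box a b) :: 'a \<Rightarrow> real)"
      by (intro integrable_real_indicator) (auto simp: emeasure_lborel_box_eq)
    have int: "set_integrable lborel (box a b) h"
      unfolding set_integrable_def
    proof (rule Bochner_Integration.integrable_bound[OF integrable_mult_right[OF ind, of C]])
      show "AE x in lborel. norm (indicator (box a b) x *\<^sub>R h x) \<le> norm (C * indicator (box a b) x)"
        using b by eventually_elim (simp add: indicator_def C)
    qed simp
    have int1: "set_integrable lborel (box a b) (\<lambda>x. C)"
      unfolding set_integrable_def by (intro integrable_scaleR_left ind)
    have "emeasure (?M h) (box a b) = (\<integral>\<^sup>+x. ennreal (h x + C) * indicator (box a b) x \<partial>lborel)"
      by (subst emeasure_density) auto
    also have "\<dots> = (\<integral>\<^sup>+x. ennreal (indicator (box a b) x *\<^sub>R (h x + C)) \<partial>lborel)"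
      by (intro nn_integral_cong) (auto simp: indicator_def)
    also have "\<dots> = ennreal (LINT x:box a b|lborel. h x + C)"
      unfolding set_lebesgue_integral_def
    proof (rule nn_integral_eq_integral)
      show "integrable lborel (\<lambda>x. indicator (box a b) x *\<^sub>R (h x + C))"
        using set_integral_add(1)[OF int int1] by (simp add: set_integrable_def)
      show "AE x in lborel. 0 \<le> indicator (box a b) x *\<^sub>R (h x + C)"
        using b by (rule AE_mp) (auto intro!: AE_I2 simp: indicator_def)
    qed
    also have "(LINT x:box a b|lborel. h x + C) = (LINT x:box a b|lborel. h x) + (LINT x:box a b|lborel. C)"
      by (rule set_integral_add(2)[OF int int1])
    also have "(LINT x:box a b|lborel. C) = C * measure lborel (box a b)"
      by (simp add: set_lebesgue_integral_def)
    finally show ?thesis .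
  qed
  have "?M h1 = ?M h2"
  proof (rule measure_eqI_generator_eq[where \<Omega>=UNIV and E="range (\<lambda>(a, b). box a b :: 'a set)"
        and A="\<lambda>n. box (- (real n *\<^sub>R One)) (real n *\<^sub>R One)"])
    show "Int_stable (range (\<lambda>(a, b). box a b :: 'a set))"
      by (fastforce simp: Int_stable_def box_Int_box)
    show "sets (?M h1) = sigma_sets UNIV (range (\<lambda>(a, b). box a b))"
         "sets (?M h2) = sigma_sets UNIV (range (\<lambda>(a, b). box a b))"
      by (simp_all add: borel_eq_box)
    show "(\<Union>n. box (- (real n *\<^sub>R One)) (real n *\<^sub>R One)) = (UNIV :: 'a set)"
      unfolding UN_box_eq_UNIV ..
    show "emeasure (?M h1) (box (- (real n *\<^sub>R One)) (real n *\<^sub>R One)) \<noteq> \<infinity>" for n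
      by (subst box) (use bound in auto)
    show "emeasure (?M h1) X = emeasure (?M h2) X" if "X \<in> range (\<lambda>(a, b). box a b)" for X
      using that bound eq by (auto simp: box)
  qed auto
  then have "AE x in lborel. ennreal (h1 x + C) = ennreal (h2 x + C)"
    by (subst (asm) sigma_finite_measure.density_unique_iff[OF sigma_finite_lborel]) auto
  with bound(1) bound(2) show ?thesis
  proof eventually_elim
    case (elim x)
    then have "0 \<le> h1 x + C" "0 \<le> h2 x + C" by linarith+
    then show ?case using elim(3) by simp
  qed
qed

lemma dir_deriv_bound:
  assumes f: "L-lipschitz_on UNIV f" and l: "((\<lambda>h. (f (x + h *\<^sub>R v) - f x) / h) \<longlongrightarrow> dir_deriv f v x) (at 0)"
  shows "\<bar>dir_deriv f v x\<bar> \<le> L * norm v"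
proof (rule tendsto_upperbound)
  show "(\<lambda>n. \<bar>diff_quot f v n x\<bar>) \<longlonglongrightarrow> \<bar>dir_deriv f v x\<bar>"
    by (intro tendsto_rabs diff_quot_tendsto l)
qed (auto intro!: always_eventually diff_quot_bound[OF f])

text \<open>
  The quotient along \<open>u + v\<close> is the quotient along \<open>u\<close> at \<open>x\<close> plus the quotient along \<open>v\<close> at the shifted
  point \<open>x + u / (n + 1)\<close>. Integrated over a box, the shift can be moved to the box, and the
  shifted indicator functions converge off the boundary of the box. In the limit the shift disappears, so both
  sides have equal integrals over every box.
\<close>

lemma AE_dir_deriv_add:
  fixes f :: "'a::euclidean_space \<Rightarrow> real"
  assumes f: "L-lipschitz_on UNIV f"
  shows "AE x in lborel. dir_deriv f (u + v) x = dir_deriv f u x + dir_deriv f v x"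
proof (rule AE_eq_if_box_integrals_eq)
  let ?q = "diff_quot f" and ?d = "dir_deriv f"
  have L0: "0 \<le> L" using f by (rule lipschitz_on_nonneg)
  have fm[measurable]: "f \<in> borel_measurable borel"
    by (intro borel_measurable_continuous_onI lipschitz_on_continuous_on[OF f])
  note [measurable] = borel_measurable_dir_deriv[OF fm] borel_measurable_diff_quot[OF fm]
  note lim = AE_tendsto_dir_deriv[OF f]
  have dd_bound: "AE x in lborel. \<bar>?d w x\<bar> \<le> L * norm w" for w
    using lim[of w] by (rule AE_mp) (auto intro!: AE_I2 dir_deriv_bound[OF f])
  show "0 \<le> L * norm u + L * norm v" using L0 by simp
  show "?d (u + v) \<in> borel_measurable borel"
    "(\<lambda>x. ?d u x + ?d v x) \<in> borel_measurable borel" by measurable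
  show "AE x in lborel. \<bar>?d (u + v) x\<bar> \<le> L * norm u + L * norm v"
  proof (rule AE_mp[OF dd_bound], intro AE_I2 impI)
    fix x assume "\<bar>?d (u + v) x\<bar> \<le> L * norm (u + v)"
    also have "\<dots> \<le> L * (norm u + norm v)" by (intro mult_left_mono norm_triangle_ineq L0)
    finally show "\<bar>?d (u + v) x\<bar> \<le> L * norm u + L * norm v" by (simp add: distrib_left)
  qed
  show "AE x in lborel. \<bar>?d u x + ?d v x\<bar> \<le> L * norm u + L * norm v"
    using dd_bound[of u] dd_bound[of v] by eventually_elim linarith
  fix a b :: 'a
  let ?Q = "box a b"
  let ?s = "\<lambda>n. (1 / real (Suc n)) *\<^sub>R u"
  obtain r where r: "norm x \<le> r" if "x \<in> ?Q" for x using bounded_box[of a b] by (auto simp: bounded_iff)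
  let ?D = "cball (0::'a) (r + norm u)"
  have int_const: "integrable lborel (\<lambda>x. c * indicator ?D x :: real)" for c
    by (intro integrable_mult_right integrable_real_indicator) (use emeasure_compact_finite[of ?D] in auto)
  have QD: "x \<in> ?D" if "x \<in> ?Q" for x using r[OF that] norm_ge_zero[of u] unfolding mem_cball dist_0_norm by linarith
  have sm: "norm (?s n) \<le> norm u" for n
    using mult_right_mono[of "1 / real (Suc n)" 1 "norm u"] by simp
  have QsD: "x \<in> ?D" if "x - ?s n \<in> ?Q" for x n
  proof -
    have "norm x \<le> norm (x - ?s n) + norm (?s n)" by (metis diff_add_cancel norm_triangle_ineq)
    then show ?thesis using r[OF that] sm[of n] by simp
  qed
  have conv: "(\<lambda>n. LINT x|lborel. indicator ?Q x * ?q w n x) \<longlonglongrightarrow> (LINT x|lborel. indicator ?Q x * ?d w x)" for w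
  proof (rule integral_dominated_convergence[where w="\<lambda>x. L * norm w * indicator ?D x"])
    show "AE x in lborel. (\<lambda>n. indicator ?Q x * ?q w n x) \<longlonglongrightarrow> indicator ?Q x * ?d w x"
      using lim[of w] by (rule AE_mp) (auto intro!: AE_I2 tendsto_mult_left diff_quot_tendsto)
    show "AE x in lborel. norm (indicator ?Q x * ?q w n x) \<le> L * norm w * indicator ?D x" for n
      using diff_quot_bound[OF f, of w n] QD L0 by (intro AE_I2) (auto simp: indicator_def)
  qed (use int_const in measurable)
  have conv': "(\<lambda>n. LINT x|lborel. indicator ?Q (x - ?s n) * ?q v n x) \<longlonglongrightarrow> (LINT x|lborel. indicator ?Q x * ?d v x)"
  proof (rule integral_dominated_convergence[where w="\<lambda>x. L * norm v * indicator ?D x"])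
    have "cbox a b - box a b \<in> null_sets lborel"
      using negligible_frontier_interval[of a b] by (simp add: negligible_iff_null_sets null_sets_completion_iff)
    then have "AE x in lborel. x \<notin> cbox a b - box a b" by (rule AE_not_in)
    with lim[of v] show "AE x in lborel. (\<lambda>n. indicator ?Q (x - ?s n) * ?q v n x) \<longlonglongrightarrow> indicator ?Q x * ?d v x"
    proof eventually_elim
      case (elim x)
      have "(\<lambda>n. ?s n) \<longlonglongrightarrow> 0 *\<^sub>R u"
        by (intro tendsto_scaleR inverse_Suc_tendsto_0 tendsto_const)
      then have s: "(\<lambda>n. x - ?s n) \<longlonglongrightarrow> x" using tendsto_diff[OF tendsto_const, of ?s 0 sequentially x] by simp
      have "\<forall>\<^sub>F n in sequentially. indicator ?Q (x - ?s n) = (indicator ?Q x :: real)"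
      proof (cases "x \<in> ?Q")
        case True
        have "\<forall>\<^sub>F n in sequentially. x - ?s n \<in> ?Q" by (rule topological_tendstoD[OF s open_box True])
        then show ?thesis by (rule eventually_mono) (use True in simp)
      next
        case False
        then have "x \<in> - cbox a b" using elim(2) by blast
        then have "\<forall>\<^sub>F n in sequentially. x - ?s n \<in> - cbox a b"
          by (intro topological_tendstoD[OF s]) auto
        then show ?thesis
          by (rule eventually_mono) (use False box_subset_cbox[of a b] in \<open>auto simp: indicator_def\<close>)
      qed
      then have "(\<lambda>n. indicator ?Q (x - ?s n) :: real) \<longlonglongrightarrow> indicator ?Q x"
        by (rule tendsto_eventually)
      then show ?case by (intro tendsto_mult diff_quot_tendsto elim(1))
    qed
    show "AE x in lborel. norm (indicator ?Q (x - ?s n) * ?q v n x) \<le> L * norm v * indicator ?D x" for n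
      using diff_quot_bound[OF f, of v n] QsD L0 by (intro AE_I2) (auto simp: indicator_def)
  qed (use int_const in measurable)
  have shift: "(LINT x|lborel. indicator ?Q x * ?q v n (x + ?s n)) = (LINT x|lborel. indicator ?Q (x - ?s n) * ?q v n x)" for n
  proof -
    have "(LINT x|lborel. indicator ?Q (x - ?s n) * ?q v n x) =
        (LINT x|distr lborel borel ((+) (?s n)). indicator ?Q (x - ?s n) * ?q v n x)"
      by (simp only: lborel_distr_plus)
    also have "\<dots> = (LINT x|lborel. indicator ?Q (?s n + x - ?s n) * ?q v n (?s n + x))"
      by (rule integral_distr) measurable
    finally show ?thesis by (simp add: add.commute)
  qed
  have split: "(LINT x|lborel. indicator ?Q x * ?q (u + v) n x) =
      (LINT x|lborel. indicator ?Q (x - ?s n) * ?q v n x) + (LINT x|lborel. indicator ?Q x * ?q u n x)" for n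
  proof -
    have "(LINT x|lborel. indicator ?Q x * ?q (u + v) n x) =
        (LINT x|lborel. indicator ?Q x * ?q v n (x + ?s n) + indicator ?Q x * ?q u n x)"
      by (intro Bochner_Integration.integral_cong) (auto simp: diff_quot_def algebra_simps)
    also have "\<dots> = (LINT x|lborel. indicator ?Q x * ?q v n (x + ?s n)) + (LINT x|lborel. indicator ?Q x * ?q u n x)"
    proof (rule Bochner_Integration.integral_add)
      show "integrable lborel (\<lambda>x. indicator ?Q x * ?q v n (x + ?s n))"
        by (rule Bochner_Integration.integrable_bound[OF int_const[of "L * norm v"]])
          (use diff_quot_bound[OF f, of v n] QD L0 in \<open>auto simp: indicator_def\<close>)
      show "integrable lborel (\<lambda>x. indicator ?Q x * ?q u n x)"
        by (rule Bochner_Integration.integrable_bound[OF int_const[of "L * norm u"]])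
          (use diff_quot_bound[OF f, of u n] QD L0 in \<open>auto simp: indicator_def\<close>)
    qed
    finally show ?thesis by (simp only: shift)
  qed
  have "(LINT x|lborel. indicator ?Q x * ?d (u + v) x) =
      (LINT x|lborel. indicator ?Q x * ?d v x) + (LINT x|lborel. indicator ?Q x * ?d u x)"
    by (rule LIMSEQ_unique[OF conv]) (unfold split, intro tendsto_add conv conv')
  also have "\<dots> = (LINT x|lborel. indicator ?Q x * ?d v x + indicator ?Q x * ?d u x)"
  proof (rule Bochner_Integration.integral_add[symmetric])
    have "integrable lborel (\<lambda>x. indicator ?Q x * ?d w x)" for w
    proof (rule Bochner_Integration.integrable_bound[OF int_const[of "L * norm w"]])
      show "AE x in lborel. norm (indicator ?Q x * ?d w x) \<le> norm (L * norm w * indicator ?D x)"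
        using dd_bound[of w] by eventually_elim (use QD L0 in \<open>auto simp: indicator_def\<close>)
    qed simp
    then show "integrable lborel (\<lambda>x. indicator ?Q x * ?d v x)"
      "integrable lborel (\<lambda>x. indicator ?Q x * ?d u x)" by blast+
  qed
  finally show "(LINT x:?Q|lborel. ?d (u + v) x) = (LINT x:?Q|lborel. ?d u x + ?d v x)"
    by (simp add: set_lebesgue_integral_def algebra_simps)
qed


text \<open>
  Substitute \<open>h c\<close> for \<open>h\<close>.
\<close>

lemma tendsto_difference_quotient_scale:
  fixes f :: "'a::real_normed_vector \<Rightarrow> real"
  assumes l: "((\<lambda>h. (f (x + h *\<^sub>R v) - f x) / h) \<longlongrightarrow> l) (at 0)"
  shows "((\<lambda>h. (f (x + h *\<^sub>R (c *\<^sub>R v)) - f x) / h) \<longlongrightarrow> c * l) (at 0)"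
proof (cases "c = 0")
  case True
  then show ?thesis by simp
next
  case False
  have "filterlim (\<lambda>h. h * c) (at 0) (at 0)"
    unfolding filterlim_at
  proof
    show "\<forall>\<^sub>F h in at 0. h * c \<in> UNIV \<and> h * c \<noteq> 0"
      using False by (auto simp: eventually_at_filter)
    show "((\<lambda>h. h * c) \<longlongrightarrow> 0) (at 0)"
      by (intro tendsto_mult_left_zero tendsto_ident_at)
  qed
  from tendsto_mult[OF tendsto_const filterlim_compose[OF l this], of c]
  show ?thesis using False by (simp add: mult.commute[of c] divide_simps)
qed

lemma AE_dir_deriv_linear:
  fixes f :: "'a::euclidean_space \<Rightarrow> real"
  assumes f: "L-lipschitz_on UNIV f"
  shows "AE x in lborel. ((\<lambda>h. (f (x + h *\<^sub>R v) - f x) / h) \<longlongrightarrow> (\<Sum>i\<in>Basis. (v \<bullet> i) * dir_deriv f i x)) (at 0)"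
proof -
  have sum: "AE x in lborel. dir_deriv f (\<Sum>i\<in>F. (v \<bullet> i) *\<^sub>R i) x = (\<Sum>i\<in>F. (v \<bullet> i) * dir_deriv f i x)"
    if "finite F" for F
    using that
  proof (induction F)
    case empty
    have "dir_deriv f 0 x = 0" for x :: 'a by (rule dir_deriv_eq) simp
    then show ?case by simp
  next
    case (insert i F)
    have "AE x in lborel. dir_deriv f ((v \<bullet> i) *\<^sub>R i + (\<Sum>i\<in>F. (v \<bullet> i) *\<^sub>R i)) x =
        dir_deriv f ((v \<bullet> i) *\<^sub>R i) x + dir_deriv f (\<Sum>i\<in>F. (v \<bullet> i) *\<^sub>R i) x"
      by (rule AE_dir_deriv_add[OF f])
    with insert.IH AE_tendsto_dir_deriv[OF f, of i] show ?case
    proof eventually_elim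
      case (elim x)
      have "dir_deriv f ((v \<bullet> i) *\<^sub>R i) x = (v \<bullet> i) * dir_deriv f i x"
        by (rule dir_deriv_eq[OF tendsto_difference_quotient_scale[OF elim(2)]])
      then show ?case using elim(1,3) insert.hyps by simp
    qed
  qed
  have "AE x in lborel. dir_deriv f v x = (\<Sum>i\<in>Basis. (v \<bullet> i) * dir_deriv f i x)"
    using sum[of Basis] by (simp add: euclidean_representation)
  with AE_tendsto_dir_deriv[OF f, of v] show ?thesis
    by eventually_elim simp
qed

text \<open>
  The quotients are Lipschitz in the direction, uniformly in the step, so convergence along finitely
  many directions forming a fine net of the unit sphere is uniform convergence on the sphere up to a small
  error.
\<close>

lemma lipschitz_differentiable_of_dense_directions:
  fixes f :: "'a::euclidean_space \<Rightarrow> real"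
  assumes f: "L-lipschitz_on UNIV f" and lin: "bounded_linear A"
    and dense: "\<And>U. open U \<Longrightarrow> U \<noteq> {} \<Longrightarrow> \<exists>v\<in>V. v \<in> U"
    and lim: "\<And>v. v \<in> V \<Longrightarrow> ((\<lambda>h. (f (x + h *\<^sub>R v) - f x) / h) \<longlongrightarrow> A v) (at 0)"
  shows "(f has_derivative A) (at x)"
  unfolding has_derivative_at_alt
proof (intro conjI allI impI lin)
  fix e :: real assume e: "0 < e"
  interpret A: bounded_linear A by (rule lin)
  obtain K where K: "0 < K" "\<And>v. norm (A v) \<le> norm v * K" using A.pos_bounded by blast
  have L0: "0 \<le> L" using f by (rule lipschitz_on_nonneg)
  (* moving a direction by d changes the quotient by L d and the linear map by K d *)
  define d where "d = e / (2 * (L + K))"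
  have d: "0 < d" "(L + K) * d = e / 2" using e K(1) L0 by (auto simp: d_def field_simps add_nonneg_eq_0_iff)
  let ?S = "sphere (0::'a) 1"
  have "?S \<subseteq> (\<Union>v\<in>V. ball v d)"
  proof
    fix w :: 'a assume "w \<in> ?S"
    obtain v where "v \<in> V" "v \<in> ball w d" using dense[of "ball w d"] d by auto
    then show "w \<in> (\<Union>v\<in>V. ball v d)" by (auto simp: dist_commute)
  qed
  then obtain W where W: "W \<subseteq> V" "finite W" "?S \<subseteq> (\<Union>v\<in>W. ball v d)"
    using compactE_image[OF compact_sphere, of V "\<lambda>v. ball v d" 0 1] by auto
  have "\<forall>\<^sub>F h in at 0. \<forall>v\<in>W. dist ((f (x + h *\<^sub>R v) - f x) / h) (A v) < e / 2"
    using W(1,2) e by (intro eventually_ball_finite ballI tendstoD[OF lim]) auto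
  then obtain \<delta> where \<delta>: "0 < \<delta>" "\<And>h v. h \<noteq> 0 \<Longrightarrow> \<bar>h\<bar> < \<delta> \<Longrightarrow> v \<in> W \<Longrightarrow> \<bar>(f (x + h *\<^sub>R v) - f x) / h - A v\<bar> < e / 2"
    by (auto simp: eventually_at dist_real_def)
  show "\<exists>\<delta>>0. \<forall>y. norm (y - x) < \<delta> \<longrightarrow> norm (f y - f x - A (y - x)) \<le> e * norm (y - x)"
  proof (intro exI[of _ \<delta>] conjI allI impI \<delta>(1))
    fix y assume y: "norm (y - x) < \<delta>"
    show "norm (f y - f x - A (y - x)) \<le> e * norm (y - x)"
    proof (cases "y = x")
      case False
      define t where "t = norm (y - x)"
      define w where "w = (1 / t) *\<^sub>R (y - x)"
      have t: "0 < t" using False by (simp add: t_def)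
      have y_eq: "y = x + t *\<^sub>R w" using t by (simp add: w_def)
      have "norm w = 1" using t by (simp add: w_def t_def)
      then obtain v where v: "v \<in> W" "dist v w < d" using W(3) by force
      have 1: "\<bar>f (x + t *\<^sub>R w) - f (x + t *\<^sub>R v)\<bar> \<le> L * (t * d)"
      proof -
        have "\<bar>f (x + t *\<^sub>R w) - f (x + t *\<^sub>R v)\<bar> \<le> L * dist (x + t *\<^sub>R w) (x + t *\<^sub>R v)"
          using lipschitz_onD[OF f, of "x + t *\<^sub>R w" "x + t *\<^sub>R v"] by (simp add: dist_real_def)
        also have "dist (x + t *\<^sub>R w) (x + t *\<^sub>R v) = t * dist v w"
          using t by (simp add: dist_norm norm_minus_commute flip: scaleR_right_diff_distrib)
        also have "L * (t * dist v w) \<le> L * (t * d)"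
          using v(2) t L0 by (intro mult_left_mono) auto
        finally show ?thesis .
      qed
      have 2: "\<bar>f (x + t *\<^sub>R v) - f x - t * A v\<bar> \<le> t * (e / 2)"
      proof -
        have "\<bar>(f (x + t *\<^sub>R v) - f x) / t - A v\<bar> < e / 2"
          using \<delta>(2)[of t v] t y v(1) by (simp add: t_def)
        then have "t * \<bar>(f (x + t *\<^sub>R v) - f x) / t - A v\<bar> \<le> t * (e / 2)"
          using t by (intro mult_left_mono) auto
        moreover have "t * \<bar>(f (x + t *\<^sub>R v) - f x) / t - A v\<bar> = \<bar>f (x + t *\<^sub>R v) - f x - t * A v\<bar>"
        proof -
          have "f (x + t *\<^sub>R v) - f x - t * A v = t * ((f (x + t *\<^sub>R v) - f x) / t - A v)"
            using t by (simp add: field_simps)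
          then show ?thesis using t by (simp add: abs_mult)
        qed
        ultimately show ?thesis by simp
      qed
      have 3: "\<bar>t * A v - t * A w\<bar> \<le> t * (d * K)"
      proof -
        have "\<bar>A v - A w\<bar> \<le> norm (v - w) * K"
          using K(2)[of "v - w"] by (simp add: A.diff)
        also have "\<dots> \<le> d * K" using v(2) K(1) by (intro mult_right_mono) (auto simp: dist_norm)
        finally have "t * \<bar>A v - A w\<bar> \<le> t * (d * K)" using t by (intro mult_left_mono) auto
        then show ?thesis using t by (simp add: abs_mult_pos' right_diff_distrib)
      qed
      have "A (y - x) = t * A w" using A.scale[of t w] by (simp add: y_eq)
      then have "norm (f y - f x - A (y - x)) = \<bar>f (x + t *\<^sub>R w) - f x - t * A w\<bar>"
        by (simp add: y_eq)
      also have "\<dots> \<le> L * (t * d) + t * (e / 2) + t * (d * K)"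
        using 1 2 3 by linarith
      also have "L * (t * d) + t * (e / 2) + t * (d * K) = t * ((L + K) * d + e / 2)" by (simp add: algebra_simps)
      also have "\<dots> = e * norm (y - x)" unfolding d(2) t_def by simp
      finally show ?thesis .
    qed simp
  qed
qed

lemma rademacher_real:
  fixes f :: "'a::euclidean_space \<Rightarrow> real"
  assumes f: "L-lipschitz_on UNIV f"
  shows "AE x in lborel. f differentiable (at x)"
proof -
  obtain V :: "'a set" where V: "countable V" "\<And>U. open U \<Longrightarrow> U \<noteq> {} \<Longrightarrow> \<exists>v\<in>V. v \<in> U"
    using countable_dense_exists by blast
  have "AE x in lborel. \<forall>v\<in>V. ((\<lambda>h. (f (x + h *\<^sub>R v) - f x) / h) \<longlongrightarrow> (\<Sum>i\<in>Basis. (v \<bullet> i) * dir_deriv f i x)) (at 0)"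
    using V(1) by (subst AE_ball_countable) (auto intro: AE_dir_deriv_linear[OF f])
  then show ?thesis
  proof (rule AE_mp, intro AE_I2 impI)
    fix x assume lim: "\<forall>v\<in>V. ((\<lambda>h. (f (x + h *\<^sub>R v) - f x) / h) \<longlongrightarrow> (\<Sum>i\<in>Basis. (v \<bullet> i) * dir_deriv f i x)) (at 0)"
    let ?A = "\<lambda>v. \<Sum>i\<in>Basis. (v \<bullet> i) * dir_deriv f i x"
    have "bounded_linear ?A"
      by (intro bounded_linear_sum bounded_linear_mult_const bounded_linear_inner_left)
    then have "(f has_derivative ?A) (at x)"
      by (rule lipschitz_differentiable_of_dense_directions[OF f _ V(2)]) (use lim in auto)
    then show "f differentiable (at x)" by (rule differentiableI)
  qed
qed

text \<open>
  On a closed ball \<open>\<phi>\<close> is Lipschitz, and composing with the nearest-point projection to the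
  ball extends this restriction to a Lipschitz map of the whole space.
\<close>

theorem rademacher:
  fixes \<phi> :: "'a::euclidean_space \<Rightarrow> 'b::euclidean_space"
  assumes \<phi>: "locally_lipschitz \<phi>"
  shows "AE x in lborel. \<phi> differentiable (at x)"
proof -
  obtain X :: "'a set" and u L where X: "countable X" "\<And>x. 0 < u x" "\<And>x. 0 < L x"
    "\<And>x. (L x)-lipschitz_on (ball x (u x)) \<phi>" "(\<Union>x\<in>X. ball x (u x / 2)) = UNIV"
    using locally_lipschitz_countable_cover[OF \<phi>] by blast
  have "AE x in lborel. x \<in> ball z (u z / 2) \<longrightarrow> \<phi> differentiable (at x)" for z
  proof -
    let ?D = "cball z (u z / 2)"
    let ?c = "closest_point ?D"
    have D: "closed ?D" "convex ?D" "?D \<noteq> {}" using X(2)[of z] by auto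
    have cin: "?c x \<in> ball z (u z)" for x
      using closest_point_in_set[OF D(1,3), of x] X(2)[of z] by (simp add: order_le_less_trans)
    have lip: "(L z)-lipschitz_on UNIV (\<lambda>x. \<phi> (?c x) \<bullet> i)" if i: "i \<in> Basis" for i
    proof (rule lipschitz_onI)
      fix x y :: 'a
      have "dist (\<phi> (?c x) \<bullet> i) (\<phi> (?c y) \<bullet> i) \<le> dist (\<phi> (?c x)) (\<phi> (?c y))"
        using Basis_le_norm[OF i, of "\<phi> (?c x) - \<phi> (?c y)"]
        by (simp add: dist_norm inner_diff_left)
      also have "\<dots> \<le> L z * dist (?c x) (?c y)"
        by (rule lipschitz_onD[OF X(4) cin cin])
      also have "\<dots> \<le> L z * dist x y"
        using closest_point_lipschitz[OF D(2,1,3)] X(3)[of z] by (intro mult_left_mono) auto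
      finally show "dist (\<phi> (?c x) \<bullet> i) (\<phi> (?c y) \<bullet> i) \<le> L z * dist x y" .
    qed (use X(3)[of z] in simp)
    have "AE x in lborel. \<forall>i\<in>Basis. (\<lambda>x. \<phi> (?c x) \<bullet> i) differentiable (at x)"
      by (intro AE_finite_allI rademacher_real[OF lip]) auto
    then show ?thesis
    proof (rule AE_mp, intro AE_I2 impI)
      fix x assume d: "\<forall>i\<in>Basis. (\<lambda>x. \<phi> (?c x) \<bullet> i) differentiable (at x)" and x: "x \<in> ball z (u z / 2)"
      have "(\<lambda>x. \<phi> (?c x)) differentiable (at x)"
        using d differentiable_componentwise_within[of "\<lambda>x. \<phi> (?c x)" x UNIV] by simp
      then obtain D where "((\<lambda>x. \<phi> (?c x)) has_derivative D) (at x)" by (auto simp: differentiable_def)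
      then have "(\<phi> has_derivative D) (at x)"
        by (rule has_derivative_transform_within_open[where s="ball z (u z / 2)"])
          (use x in \<open>auto simp: closest_point_self\<close>)
      then show "\<phi> differentiable (at x)" by (rule differentiableI)
    qed
  qed
  then have "AE x in lborel. \<forall>z\<in>X. x \<in> ball z (u z / 2) \<longrightarrow> \<phi> differentiable (at x)"
    by (intro AE_ball_countable[OF X(1), THEN iffD2] ballI)
  then show ?thesis
    by (rule AE_mp) (use X(5) in \<open>blast intro!: AE_I2\<close>)
qed

section \<open>Sets on which a map is nearly linear\<close>

lemma norm_matrix_vector_mult_le:
  fixes A :: "real^'k^'n"
  shows "norm (A *v x) \<le> norm A * norm x"
proof -
  have "norm (A *v x) = L2_set (\<lambda>i. \<bar>A $ i \<bullet> x\<bar>) UNIV"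
    by (simp add: norm_vec_def matrix_vector_mult_def inner_vec_def)
  also have "\<dots> \<le> L2_set (\<lambda>i. norm (A $ i) * norm x) UNIV"
    by (intro L2_set_mono Cauchy_Schwarz_ineq2) simp
  also have "\<dots> = norm A * norm x"
    by (simp add: L2_set_left_distrib norm_vec_def)
  finally show ?thesis .
qed

text \<open>
  Polarisation.
\<close>

lemma inner_eq_of_norm_eq:
  fixes S :: "'a::real_inner \<Rightarrow> 'b::real_inner" and M :: "'a \<Rightarrow> 'c::real_inner"
  assumes lin: "linear S" "linear M" and n: "\<And>v. norm (S v) = norm (M v)"
  shows "S x \<bullet> S y = M x \<bullet> M y"
  using n[of "x + y"] n[of x] n[of y] lin by (simp add: dot_norm linear_add)

text \<open>
  The range of \<open>M\<close> is isometric to the domain; the adjoint of such an isometry is the orthogonal projection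
  onto the range, followed by the inverse isometry.
\<close>

lemma contraction_isometric_on_range:
  fixes M :: "'a::euclidean_space \<Rightarrow> 'b::euclidean_space"
  assumes M: "linear M" "inj M"
  obtains Q :: "'b \<Rightarrow> 'a" where "linear Q" "\<And>y. norm (Q y) \<le> norm y" "\<And>v. norm (Q (M v)) = norm (M v)"
proof -
  have "dim (range M) = dim (UNIV :: 'a set)"
    using M by (intro dim_image_eq) (auto simp: inj_on_def)
  then obtain f :: "'a \<Rightarrow> 'b" where f: "linear f" "f ` UNIV = range M" "\<And>x. norm (f x) = norm x"
    using isometry_subspaces[of "UNIV :: 'a set" "range M"] linear_subspace_image[OF M(1) subspace_UNIV]
    by auto
  let ?Q = "adjoint f"
  have Q: "linear ?Q" by (rule adjoint_linear[OF f(1)])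
  have adj: "x \<bullet> ?Q y = f x \<bullet> y" for x y by (rule adjoint_works[OF f(1)])
  have Qf: "?Q (f v) = v" for v
  proof (rule vector_eq_ldot[THEN iffD1], rule allI)
    fix w
    have "f w \<bullet> f v = id w \<bullet> id v"
      by (rule inner_eq_of_norm_eq) (auto simp: f linear_ident id_def)
    then show "w \<bullet> ?Q (f v) = w \<bullet> v" by (simp add: adj)
  qed
  have "norm (?Q y) \<le> norm y" for y
  proof (cases "?Q y = 0")
    case False
    have "norm (?Q y) * norm (?Q y) = f (?Q y) \<bullet> y"
      using adj[of "?Q y" y] by (simp add: dot_square_norm power2_eq_square)
    also have "\<dots> \<le> norm (?Q y) * norm y"
      using norm_cauchy_schwarz[of "f (?Q y)" y] by (simp add: f(3))
    finally show ?thesis using False by simp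
  qed simp
  moreover have "norm (?Q (M v)) = norm (M v)" for v
  proof -
    obtain w where "M v = f w" using f(2) by blast
    then show ?thesis by (simp add: Qf f(3))
  qed
  ultimately show ?thesis using Q that by blast
qed

text \<open>
  The two matrices define the same quadratic form, hence have the same Gram matrix. The point is that
  the determinant on the right is one of a square matrix and can be read as a volume.
\<close>

lemma gram_det_eq:
  fixes M :: "real^'k^'n" and S :: "real^'k^'k"
  assumes "\<And>v. norm (S *v v) = norm (M *v v)"
  shows "det (transpose M ** M) = (det S)\<^sup>2"
proof -
  have gram: "x \<bullet> ((transpose A ** A) *v y) = (A *v x) \<bullet> (A *v y)" for A :: "real^'k^'m" and x y
    by (metis dot_lmul_matrix inner_commute matrix_vector_mul_assoc transpose_matrix_vector)
  have eq: "(S *v x) \<bullet> (S *v y) = (M *v x) \<bullet> (M *v y)" for x y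
    by (rule inner_eq_of_norm_eq) (auto simp: assms)
  have "(transpose S ** S) *v y = (transpose M ** M) *v y" for y
    by (rule vector_eq_ldot[THEN iffD1]) (simp only: gram eq simp_thms)
  then have "transpose S ** S = transpose M ** M" by (simp add: matrix_eq)
  then show ?thesis by (metis det_mul det_transpose power2_eq_square)
qed

lemma k_jacobian_eq_det:
  fixes \<phi> :: "real^'k \<Rightarrow> real^'n"
  assumes D: "(\<phi> has_derivative D) (at x)" and S: "linear S" "\<And>v. norm (S v) = norm (D v)"
  shows "k_jacobian \<phi> x = \<bar>det (matrix S)\<bar>"
proof -
  have "jacobian \<phi> (at x) = matrix D"
    unfolding jacobian_def using frechet_derivative_at[OF D] by simp
  moreover have "det (transpose (matrix D) ** matrix D) = (det (matrix S))\<^sup>2"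
    using S has_derivative_linear[OF D] by (intro gram_det_eq) (simp add: matrix_works)
  ultimately show ?thesis by (simp add: k_jacobian_def)
qed

text \<open>
  The base point \<open>x\<close> is restricted but the step \<open>w\<close> is not: the estimates hold on a full neighbourhood
  of \<open>x\<close>. Therefore they pass to the derivative at \<open>x\<close>, and for fixed \<open>w\<close> they are closed conditions
  on \<open>x\<close>.
\<close>

definition near_linear_set ::
  "('a::real_normed_vector \<Rightarrow> 'b::real_normed_vector) \<Rightarrow> ('a \<Rightarrow> 'a) \<Rightarrow> ('b \<Rightarrow> 'a) \<Rightarrow> real \<Rightarrow> nat \<Rightarrow> 'a set" where
  "near_linear_set \<phi> S Q t m = {x. \<forall>w. norm w < 1 / real (Suc m) \<longrightarrow>
     norm (\<phi> (x + w) - \<phi> x) \<le> t * norm (S w) \<and> norm (S w) \<le> t * norm (Q (\<phi> (x + w) - \<phi> x))}"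

lemma near_linear_set_closed:
  fixes \<phi> :: "'a::euclidean_space \<Rightarrow> 'b::euclidean_space"
  assumes "continuous_on UNIV \<phi>" "linear Q"
  shows "closed (near_linear_set \<phi> S Q t m)"
proof -
  have c: "continuous_on UNIV (\<lambda>x. \<phi> (x + w) - \<phi> x)" for w
    by (intro continuous_intros continuous_on_compose2[OF assms(1)] assms(1)) auto
  have c': "continuous_on UNIV (\<lambda>x. Q (\<phi> (x + w) - \<phi> x))" for w
    by (intro linear_continuous_on_compose[OF c assms(2)])
  have "near_linear_set \<phi> S Q t m = (\<Inter>w\<in>{w. norm w < 1 / real (Suc m)}.
      {x. norm (\<phi> (x + w) - \<phi> x) \<le> t * norm (S w)} \<inter> {x. norm (S w) \<le> t * norm (Q (\<phi> (x + w) - \<phi> x))})"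
    unfolding near_linear_set_def by blast
  also have "closed \<dots>"
    by (intro closed_INT ballI closed_Int closed_Collect_le continuous_intros c c')
  finally show ?thesis .
qed

lemma near_linear_setD:
  assumes "x \<in> near_linear_set \<phi> S Q t m" "norm (y - x) < 1 / real (Suc m)"
  shows "norm (\<phi> y - \<phi> x) \<le> t * norm (S (y - x))" "norm (S (y - x)) \<le> t * norm (Q (\<phi> y - \<phi> x))"
  using assms(1)[unfolded near_linear_set_def mem_Collect_eq, THEN spec, of "y - x"] assms(2) by simp_all

text \<open>
  The set itself is not assumed measurable; its Borel hull is.
\<close>

lemma hausdorff_null_imp_lebesgue_null:
  fixes E :: "'a::euclidean_space set"
  assumes "hausdorff_outer_measure DIM('a) E = 0"
  shows "E \<in> null_sets lebesgue"
proof -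
  obtain B where B: "B \<in> null_sets (hausdorff_measure (real DIM('a)))" "E \<subseteq> B"
    using hausdorff_null_borel_hull[OF assms] .
  have Bb: "B \<in> sets borel" using null_setsD2[OF B(1)] by simp
  then have "hausdorff_outer_measure DIM('a) B = 0"
    using null_setsD1[OF B(1)] by (simp add: emeasure_hausdorff_measure)
  moreover have "emeasure lebesgue B \<le> hausdorff_outer_measure DIM('a) B"
    using Bb by (intro lebesgue_le_hausdorff) simp
  ultimately have "emeasure lebesgue B = 0" by (simp only: le_zero_eq)
  then have "B \<in> null_sets lebesgue" using Bb by (intro null_setsI) simp_all
  then show ?thesis using B(2) by (rule null_sets_completion_subset[rotated])
qed

lemma lebesgue_measurable_image:
  fixes \<psi> :: "'a::euclidean_space \<Rightarrow> 'b::euclidean_space"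
  assumes dim: "DIM('a) = DIM('b)" and cont: "continuous_on UNIV \<psi>"
    and null: "\<And>N. N \<in> null_sets lebesgue \<Longrightarrow> hausdorff_outer_measure DIM('a) (\<psi> ` N) = 0"
    and A: "A \<in> sets lebesgue"
  shows "\<psi> ` A \<in> sets lebesgue"
proof -
  obtain C where C: "fsigma C" "C \<subseteq> A" "A - C \<in> null_sets lebesgue"
    using lebesgue_fsigma_subset[OF A] .
  have "\<psi> ` C \<in> sets borel"
    by (rule fsigma_continuous_image_borel[OF C(1) continuous_on_subset[OF cont]]) simp
  moreover have "\<psi> ` (A - C) \<in> null_sets lebesgue"
    using null[OF C(3)] dim by (intro hausdorff_null_imp_lebesgue_null) simp
  moreover have "\<psi> ` A = \<psi> ` C \<union> \<psi> ` (A - C)" using C(2) by auto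
  ultimately show ?thesis by auto
qed

text \<open>
  The radius of the ball makes any two points of \<open>A\<close> admissible as base point and neighbour.
\<close>

lemma near_linear_set_inj_on:
  assumes A: "A \<subseteq> near_linear_set \<phi> S Q t m" "A \<subseteq> ball z (1 / (2 * real (Suc m)))"
    and S: "linear S" "inj S" and Q: "linear Q"
  shows "inj_on \<phi> A"
    and "\<And>x y. x \<in> A \<Longrightarrow> y \<in> A \<Longrightarrow> norm (\<phi> y - \<phi> x) \<le> t * norm (S (y - x))"
    and "\<And>x y. x \<in> A \<Longrightarrow> y \<in> A \<Longrightarrow> norm (S (y - x)) \<le> t * norm (Q (\<phi> y - \<phi> x))"
proof -
  have close: "norm (y - x) < 1 / real (Suc m)" if "x \<in> A" "y \<in> A" for x y
  proof -
    have "dist z x < 1 / (2 * real (Suc m))" "dist z y < 1 / (2 * real (Suc m))" using that A(2) by auto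
    then have "dist y x < 1 / (2 * real (Suc m)) + 1 / (2 * real (Suc m))"
      using dist_triangle3[of y x z] by linarith
    then show ?thesis by (simp add: dist_norm field_simps)
  qed
  show 1: "norm (\<phi> y - \<phi> x) \<le> t * norm (S (y - x))" and 2: "norm (S (y - x)) \<le> t * norm (Q (\<phi> y - \<phi> x))"
    if "x \<in> A" "y \<in> A" for x y
    using near_linear_setD[of x \<phi> S Q t m y] close[OF that] that A(1) by auto
  show "inj_on \<phi> A"
  proof (rule inj_onI)
    fix x y assume "x \<in> A" "y \<in> A" "\<phi> x = \<phi> y"
    then have "S (y - x) = 0" using 2[of x y] linear_0[OF Q] by simp
    then show "x = y" using S by (simp add: linear_diff inj_eq)
  qed
qed

text \<open>
  In the coordinates given by \<open>S\<close>, the map \<open>\<phi>\<close> is \<open>t\<close>-Lipschitz, which gives the upper bound. The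
  inverse of \<open>Q \<circ> \<phi>\<close> followed by \<open>S\<close> is a \<open>t\<close>-Lipschitz map between subsets of \<open>\<real>\<^sup>k\<close>, and \<open>Q\<close>
  does not increase \<open>\<H>\<^sup>k\<close>, which gives the lower bound.
\<close>

lemma near_linear_set_measure:
  fixes \<phi> :: "real^'k \<Rightarrow> real^'n"
  assumes \<phi>: "locally_lipschitz \<phi>"
    and A: "A \<subseteq> near_linear_set \<phi> S Q t m" "A \<subseteq> ball z (1 / (2 * real (Suc m)))" "A \<in> sets lebesgue"
    and S: "linear S" "inj S" and Q: "linear Q" "\<And>y. norm (Q y) \<le> norm y" and t: "0 < t"
  shows "hausdorff_outer_measure CARD('k) (\<phi> ` A) \<le> ennreal (t ^ CARD('k)) * (ennreal \<bar>det (matrix S)\<bar> * emeasure lebesgue A)"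
    and "ennreal \<bar>det (matrix S)\<bar> * emeasure lebesgue A \<le> ennreal (t ^ CARD('k)) * hausdorff_outer_measure CARD('k) (\<phi> ` A)"
proof -
  note bil = near_linear_set_inj_on[OF A(1,2) S Q(1)]
  let ?k = "CARD('k)"
  have SA: "S ` A \<in> sets lebesgue" "emeasure lebesgue (S ` A) = ennreal \<bar>det (matrix S)\<bar> * emeasure lebesgue A"
    using emeasure_linear_image_det[OF S A(3)] by auto
  have invS: "inv S (S x) = x" for x using S(2) by simp
  have "t-lipschitz_on (S ` A) (\<lambda>z. \<phi> (inv S z))"
    using t bil(2) S(1) by (intro lipschitz_onI) (auto simp: invS dist_norm norm_minus_commute linear_diff)
  from hausdorff_lipschitz_image_le[OF SA(1) this t]
  show "hausdorff_outer_measure ?k (\<phi> ` A) \<le> ennreal (t ^ ?k) * (ennreal \<bar>det (matrix S)\<bar> * emeasure lebesgue A)"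
    by (simp add: image_image invS SA(2))
  let ?B = "Q ` (\<phi> ` A)"
  have contr: "hausdorff_outer_measure ?k (Q ` E) \<le> hausdorff_outer_measure ?k E" for E
    by (rule hausdorff_contraction_image_le) (metis Q linear_diff dist_norm)
  have B: "?B \<in> sets lebesgue"
  proof -
    have "(\<lambda>x. Q (\<phi> x)) ` A \<in> sets lebesgue"
    proof (rule lebesgue_measurable_image[OF _ _ _ A(3)])
      show "continuous_on UNIV (\<lambda>x. Q (\<phi> x))"
        by (rule linear_continuous_on_compose[OF locally_lipschitz_imp_continuous_on[OF \<phi>] Q(1)])
      fix N :: "(real^'k) set" assume "N \<in> null_sets lebesgue"
      then have "hausdorff_outer_measure ?k (\<phi> ` N) = 0"
        using hausdorff_locally_lipschitz_image_null[OF \<phi>] by simp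
      then show "hausdorff_outer_measure DIM(real^'k) ((\<lambda>x. Q (\<phi> x)) ` N) = 0"
        using contr[of "\<phi> ` N"] by (simp add: image_image)
    qed simp
    then show ?thesis by (simp add: image_image)
  qed
  have injQ: "inj_on (\<lambda>x. Q (\<phi> x)) A"
  proof (rule inj_onI)
    fix x y assume xy: "x \<in> A" "y \<in> A" "Q (\<phi> x) = Q (\<phi> y)"
    have "S (y - x) = 0" using bil(3)[OF xy(1,2)] xy(3) Q(1) by (simp add: linear_diff)
    then show "x = y" using S by (simp add: linear_diff inj_eq)
  qed
  let ?\<psi> = "\<lambda>z. S (the_inv_into A (\<lambda>x. Q (\<phi> x)) z)"
  have \<psi>: "?\<psi> (Q (\<phi> x)) = S x" if "x \<in> A" for x
    by (simp add: the_inv_into_f_f[OF injQ that])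
  have "t-lipschitz_on ?B ?\<psi>"
  proof (rule lipschitz_onI)
    fix a b assume "a \<in> ?B" "b \<in> ?B"
    then obtain x y where "x \<in> A" "y \<in> A" "a = Q (\<phi> x)" "b = Q (\<phi> y)" by blast
    then show "dist (?\<psi> a) (?\<psi> b) \<le> t * dist a b"
      using bil(3)[of y x] S(1) Q(1) by (simp add: \<psi> dist_norm linear_diff)
  qed (use t in simp)
  have "ennreal \<bar>det (matrix S)\<bar> * emeasure lebesgue A = emeasure lebesgue (?\<psi> ` ?B)"
    by (simp add: image_image \<psi> SA(2) cong: image_cong)
  also have "\<dots> \<le> hausdorff_outer_measure ?k (?\<psi> ` ?B)"
    using lebesgue_le_hausdorff[of "?\<psi> ` ?B"] SA(1) by (simp add: image_image \<psi> cong: image_cong)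
  also have "\<dots> \<le> ennreal (t ^ ?k) * emeasure lebesgue ?B"
    using hausdorff_lipschitz_image_le[OF B \<open>t-lipschitz_on ?B ?\<psi>\<close> t] by simp
  also have "\<dots> \<le> ennreal (t ^ ?k) * hausdorff_outer_measure ?k ?B"
    using lebesgue_le_hausdorff[OF B] by (intro mult_left_mono) simp_all
  also have "\<dots> \<le> ennreal (t ^ ?k) * hausdorff_outer_measure ?k (\<phi> ` A)"
    by (intro mult_left_mono contr) simp
  finally show "ennreal \<bar>det (matrix S)\<bar> * emeasure lebesgue A \<le> ennreal (t ^ ?k) * hausdorff_outer_measure ?k (\<phi> ` A)" .
qed

lemma real_le_of_forall_le_add_mult:
  fixes a b c :: real
  assumes "\<And>e. 0 < e \<Longrightarrow> a \<le> b + e * c" and "0 \<le> c"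
  shows "a \<le> b"
proof (cases "c = 0")
  case True
  then show ?thesis using assms(1)[of 1] by simp
next
  case False
  show ?thesis
  proof (rule field_le_epsilon)
    fix e :: real assume "0 < e"
    then show "a \<le> b + e" using assms(1)[of "e / c"] assms(2) False by simp
  qed
qed

text \<open>
  Apply the estimates to the step \<open>h v\<close> and divide by \<open>h\<close>; the error \<open>e\<close> of the linear approximation
  is arbitrary.
\<close>

lemma near_linear_set_derivative:
  fixes \<phi> :: "'a::euclidean_space \<Rightarrow> 'b::euclidean_space"
  assumes x: "x \<in> near_linear_set \<phi> S Q t m" and D: "(\<phi> has_derivative D) (at x)"
    and S: "linear S" and Q: "linear Q" "\<And>y. norm (Q y) \<le> norm y" and t: "0 < t"
  shows "norm (D v) \<le> t * norm (S v)" and "norm (S v) \<le> t * norm (D v)"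
proof -
  have linD: "linear D" using has_derivative_linear[OF D] .
  have *: "norm (D v) \<le> t * norm (S v) + e * norm v \<and> norm (S v) \<le> t * norm (D v) + t * (e * norm v)"
    if e: "0 < e" for e
  proof -
    obtain d where d: "0 < d" "\<And>y. norm (y - x) < d \<Longrightarrow> norm (\<phi> y - \<phi> x - D (y - x)) \<le> e * norm (y - x)"
      using D e unfolding has_derivative_at_alt by blast
    define \<mu> where "\<mu> = min d (1 / real (Suc m))"
    have \<mu>: "0 < \<mu>" "\<mu> \<le> d" "\<mu> \<le> 1 / real (Suc m)" using d(1) by (simp_all add: \<mu>_def)
    define N where "N = norm v + 1"
    define h where "h = \<mu> / (2 * N)"
    have v1: "0 < N" unfolding N_def using norm_ge_zero[of v] by linarith
    have h: "0 < h" using \<mu>(1) v1 by (simp add: h_def)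
    have "h * norm v < \<mu>"
    proof -
      have "h * norm v \<le> h * N" using h by (simp add: N_def)
      also have "\<dots> = \<mu> / 2" using v1 by (simp add: h_def)
      also have "\<dots> < \<mu>" using \<mu>(1) by simp
      finally show ?thesis .
    qed
    then have "h * norm v < d" "h * norm v < 1 / real (Suc m)" using \<mu>(2,3) by linarith+
    then have w: "norm (h *\<^sub>R v) < d" "norm (h *\<^sub>R v) < 1 / real (Suc m)" using h by simp_all
    let ?\<Delta> = "\<phi> (x + h *\<^sub>R v) - \<phi> x"
    have 1: "norm (?\<Delta> - h *\<^sub>R D v) \<le> e * (h * norm v)"
      using d(2)[of "x + h *\<^sub>R v"] w(1) h by (simp add: linear_scale[OF linD])
    have 2: "norm ?\<Delta> \<le> t * (h * norm (S v))" "h * norm (S v) \<le> t * norm (Q ?\<Delta>)"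
      using near_linear_setD[OF x, of "x + h *\<^sub>R v"] w(2) h by (simp_all add: linear_scale[OF S])
    have "h * norm (D v) = norm (h *\<^sub>R D v)" using h by simp
    also have "\<dots> \<le> norm ?\<Delta> + norm (?\<Delta> - h *\<^sub>R D v)" by (metis norm_minus_commute norm_triangle_sub)
    also have "\<dots> \<le> h * (t * norm (S v) + e * norm v)" using 1 2(1) by (simp add: algebra_simps)
    finally have "norm (D v) \<le> t * norm (S v) + e * norm v" using h by simp
    moreover have "h * norm (S v) \<le> t * norm ?\<Delta>"
      using 2(2) Q(2)[of ?\<Delta>] t by (meson mult_left_mono less_imp_le order_trans)
    then have "h * norm (S v) \<le> t * (norm (h *\<^sub>R D v) + norm (?\<Delta> - h *\<^sub>R D v))"
      using t norm_triangle_sub[of ?\<Delta> "h *\<^sub>R D v"] by (meson mult_left_mono less_imp_le order_trans)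
    then have "h * norm (S v) \<le> t * (norm (h *\<^sub>R D v) + e * (h * norm v))"
      using t 1 by (meson add_left_mono mult_left_mono less_imp_le order_trans)
    then have "h * norm (S v) \<le> h * (t * norm (D v) + t * (e * norm v))" using h by (simp add: algebra_simps)
    then have "norm (S v) \<le> t * norm (D v) + t * (e * norm v)" using h by simp
    ultimately show ?thesis by blast
  qed
  show "norm (D v) \<le> t * norm (S v)"
    by (rule real_le_of_forall_le_add_mult[of _ _ "norm v"]) (use * in auto)
  show "norm (S v) \<le> t * norm (D v)"
    by (rule real_le_of_forall_le_add_mult[of _ _ "t * norm v"]) (use * t in \<open>auto simp: mult_ac\<close>)
qed

text \<open>
  An isometric copy of the range of the derivative in \<open>\<real>\<^sup>k\<close> turns the Jacobian into the determinant of an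
  endomorphism \<open>R\<close>.
\<close>

lemma k_jacobian_eq_det_isometric:
  fixes \<phi> :: "real^'k \<Rightarrow> real^'n"
  assumes D: "(\<phi> has_derivative D) (at x)" "inj D"
  obtains R :: "real^'k \<Rightarrow> real^'k" where "linear R" "inj R" "\<And>v. norm (R v) = norm (D v)"
    "k_jacobian \<phi> x = \<bar>det (matrix R)\<bar>"
proof -
  have linD: "linear D" using has_derivative_linear[OF D(1)] .
  obtain P :: "real^'n \<Rightarrow> real^'k" where
    P: "linear P" "\<And>y. norm (P y) \<le> norm y" "\<And>v. norm (P (D v)) = norm (D v)"
    using contraction_isometric_on_range[OF linD D(2)] by metis
  define R where "R v = P (D v)" for v
  have R: "linear R" "\<And>v. norm (R v) = norm (D v)"
    using linear_compose[OF linD P(1)] P(3) by (simp_all add: R_def[abs_def] o_def)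
  have injR: "inj R"
  proof (subst linear_injective_0[OF R(1)], intro allI impI)
    fix v assume "R v = 0"
    then have "D v = 0" using R(2)[of v] by simp
    then show "v = 0" using D(2) linear_injective_0[OF linD] by blast
  qed
  show ?thesis by (rule that[OF R(1) injR R(2) k_jacobian_eq_det[OF D(1) R]])
qed

lemma k_jacobian_pos:
  fixes \<phi> :: "real^'k \<Rightarrow> real^'n"
  assumes "(\<phi> has_derivative D) (at x)" "inj D"
  shows "0 < k_jacobian \<phi> x"
proof -
  obtain R :: "real^'k \<Rightarrow> real^'k" where R: "linear R" "inj R" "\<And>v. norm (R v) = norm (D v)"
    "k_jacobian \<phi> x = \<bar>det (matrix R)\<bar>"
    using k_jacobian_eq_det_isometric[OF assms] by metis
  then show ?thesis using det_nz_iff_inj[OF R(1)] by simp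
qed

lemma near_linear_set_jacobian:
  fixes \<phi> :: "real^'k \<Rightarrow> real^'n"
  assumes x: "x \<in> near_linear_set \<phi> S Q t m" and D: "(\<phi> has_derivative D) (at x)" "inj D"
    and S: "linear S" "inj S" and Q: "linear Q" "\<And>y. norm (Q y) \<le> norm y" and t: "0 < t"
  shows "k_jacobian \<phi> x \<le> t ^ CARD('k) * \<bar>det (matrix S)\<bar>" and "\<bar>det (matrix S)\<bar> \<le> t ^ CARD('k) * k_jacobian \<phi> x"
proof -
  obtain R :: "real^'k \<Rightarrow> real^'k" where R: "linear R" "inj R" "\<And>v. norm (R v) = norm (D v)"
    "k_jacobian \<phi> x = \<bar>det (matrix R)\<bar>"
    using k_jacobian_eq_det_isometric[OF D] by metis
  note n = near_linear_set_derivative[OF x D(1) S(1) Q t]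
  show "k_jacobian \<phi> x \<le> t ^ CARD('k) * \<bar>det (matrix S)\<bar>"
    unfolding R(4) by (rule abs_det_le_of_norm_le[OF R(1) S t]) (simp add: R(3) n)
  show "\<bar>det (matrix S)\<bar> \<le> t ^ CARD('k) * k_jacobian \<phi> x"
    unfolding R(4) by (rule abs_det_le_of_norm_le[OF S(1) R(1,2) t]) (simp add: R(3) n)
qed

text \<open>
  If \<open>\<delta>\<close> bounds both the distance of \<open>T\<close> from the derivative and the error of the derivative, then
  \<open>\<phi> (x + w) - \<phi> x\<close> differs from \<open>T w\<close> by at most \<open>2 \<delta> |w|\<close>, while \<open>|T w| \<ge> (c - \<delta>) |w|\<close>. The choice of \<open>\<delta>\<close>
  makes the former at most \<open>(t - 1) / t\<close> times the latter.
\<close>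

lemma near_linear_set_approx:
  fixes \<phi> :: "'a::euclidean_space \<Rightarrow> 'b::euclidean_space"
  assumes D: "(\<phi> has_derivative D) (at x)" and c: "0 < c" "\<And>v. c * norm v \<le> norm (D v)" and t: "1 < t"
    and T: "linear T" "\<And>v. norm (T v - D v) \<le> (t - 1) * c / (3 * t) * norm v"
    and Q: "linear Q" "\<And>y. norm (Q y) \<le> norm y" "\<And>v. norm (Q (T v)) = norm (T v)"
  obtains m where "x \<in> near_linear_set \<phi> (\<lambda>v. Q (T v)) Q t m"
proof -
  define \<delta> where "\<delta> = (t - 1) * c / (3 * t)"
  have \<delta>: "0 < \<delta>" using t c(1) by (simp add: \<delta>_def)
  obtain d where d: "0 < d" "\<And>y. norm (y - x) < d \<Longrightarrow> norm (\<phi> y - \<phi> x - D (y - x)) \<le> \<delta> * norm (y - x)"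
    using D \<delta> unfolding has_derivative_at_alt by blast
  obtain m where m: "1 / real (Suc m) < d" using d(1) nat_approx_posE by metis
  have "x \<in> near_linear_set \<phi> (\<lambda>v. Q (T v)) Q t m"
    unfolding near_linear_set_def mem_Collect_eq
  proof (intro allI impI)
    fix w :: 'a assume w: "norm w < 1 / real (Suc m)"
    let ?\<Delta> = "\<phi> (x + w) - \<phi> x" and ?n = "norm w"
    have "norm (?\<Delta> - D w) \<le> \<delta> * ?n" using d(2)[of "x + w"] w m by simp
    then have dT: "norm (?\<Delta> - T w) \<le> 2 * (\<delta> * ?n)"
      using T(2)[of w] norm_triangle_ineq[of "?\<Delta> - D w" "D w - T w"]
      by (simp add: \<delta>_def norm_minus_commute)
    have "c * ?n - \<delta> * ?n \<le> norm (T w)"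
      using c(2)[of w] T(2)[of w] norm_triangle_sub[of "D w" "T w"] by (simp add: \<delta>_def norm_minus_commute)
    then have lower: "(c - \<delta>) * ?n \<le> norm (T w)" by (simp add: left_diff_distrib)
    have key: "2 * t * \<delta> + (t - 1) * \<delta> \<le> (t - 1) * c"
      using t c(1) by (simp add: \<delta>_def field_simps)
    then have "2 * t * \<delta> \<le> (t - 1) * (c - \<delta>)" by (simp add: algebra_simps)
    then have "2 * t * \<delta> * ?n \<le> (t - 1) * (c - \<delta>) * ?n" by (rule mult_right_mono) simp
    also have "\<dots> \<le> (t - 1) * norm (T w)"
      using lower t by (simp only: mult.assoc) (intro mult_left_mono, auto)
    finally have a: "t * (2 * (\<delta> * ?n)) \<le> (t - 1) * norm (T w)" by (simp add: mult_ac)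
    have "1 * (2 * (\<delta> * ?n)) \<le> t * (2 * (\<delta> * ?n))" using t \<delta> by (intro mult_right_mono) auto
    then have b: "2 * (\<delta> * ?n) \<le> (t - 1) * norm (T w)" using a by linarith
    have "norm ?\<Delta> \<le> norm (T w) + norm (?\<Delta> - T w)" by (rule norm_triangle_sub)
    then have "norm ?\<Delta> \<le> t * norm (T w)" using dT b by (simp add: left_diff_distrib)
    moreover have "norm (T w) - 2 * (\<delta> * ?n) \<le> norm (Q ?\<Delta>)"
    proof -
      have "norm (Q (T w)) \<le> norm (Q ?\<Delta>) + norm (Q (T w - ?\<Delta>))"
        using norm_triangle_sub[of "Q (T w)" "Q ?\<Delta>"] by (simp add: linear_diff[OF Q(1)])
      also have "norm (Q (T w - ?\<Delta>)) \<le> norm (?\<Delta> - T w)" by (metis Q(2) norm_minus_commute)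
      finally show ?thesis using dT Q(3)[of w] by linarith
    qed
    then have "t * (norm (T w) - 2 * (\<delta> * ?n)) \<le> t * norm (Q ?\<Delta>)" using t by (intro mult_left_mono) auto
    then have "norm (T w) \<le> t * norm (Q ?\<Delta>)" using a by (simp add: algebra_simps)
    ultimately show "norm ?\<Delta> \<le> t * norm (Q (T w)) \<and> norm (Q (T w)) \<le> t * norm (Q ?\<Delta>)" by (simp add: Q(3))
  qed
  then show ?thesis by (rule that)
qed

section \<open>The area formula for injective maps\<close>

text \<open>
  The pieces are indexed by a matrix \<open>T\<close> and a centre \<open>z\<close>, both from countable dense sets, and the scale \<open>m\<close>.
  A matrix close enough to the derivative at a point, together with a fine scale, captures that point.
\<close>

lemma near_linear_decomposition:
  fixes \<phi> :: "real^'k \<Rightarrow> real^'n"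
  assumes \<phi>: "continuous_on UNIV \<phi>" and t: "1 < t"
  obtains E :: "nat \<Rightarrow> (real^'k) set" where "disjoint_family E" "\<And>j. E j \<in> sets borel"
    "{x. \<exists>D. (\<phi> has_derivative D) (at x) \<and> inj D} \<subseteq> (\<Union>j. E j)"
    "\<And>j. \<exists>S Q m z. linear S \<and> inj S \<and> linear Q \<and> (\<forall>y. norm (Q y) \<le> norm y) \<and>
       E j \<subseteq> near_linear_set \<phi> S Q t m \<and> E j \<subseteq> ball z (1 / (2 * real (Suc m)))"
proof -
  obtain V :: "(real^'k^'n) set" where V: "countable V" "\<And>U. open U \<Longrightarrow> U \<noteq> {} \<Longrightarrow> \<exists>v\<in>V. v \<in> U"
    using countable_dense_exists by blast
  obtain Z :: "(real^'k) set" where Z: "countable Z" "\<And>U. open U \<Longrightarrow> U \<noteq> {} \<Longrightarrow> \<exists>v\<in>Z. v \<in> U"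
    using countable_dense_exists by blast
  define good where "good T Q \<longleftrightarrow> linear Q \<and> (\<forall>y. norm (Q y) \<le> norm y) \<and> (\<forall>v. norm (Q (T *v v)) = norm (T *v v))"
    for T :: "real^'k^'n" and Q :: "real^'n \<Rightarrow> real^'k"
  define QQ where "QQ T = (SOME Q. good T Q)" for T
  have QQ: "linear (QQ T) \<and> (\<forall>y. norm (QQ T y) \<le> norm y) \<and> (\<forall>v. norm (QQ T (T *v v)) = norm (T *v v))"
    if inj: "inj ((*v) T)" for T
  proof -
    obtain Q :: "real^'n \<Rightarrow> real^'k" where "linear Q" "\<And>y. norm (Q y) \<le> norm y" "\<And>v. norm (Q (T *v v)) = norm (T *v v)"
      using contraction_isometric_on_range[OF matrix_vector_mul_linear inj] by metis
    then have "good T Q" by (simp add: good_def)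
    then have "good T (QQ T)" unfolding QQ_def by (rule someI[where P="good T"])
    then show ?thesis unfolding good_def .
  qed
  define I where "I = {T \<in> V. inj ((*v) T)} \<times> (UNIV :: nat set) \<times> Z"
  have I: "countable I" unfolding I_def using V(1) Z(1) by (intro countable_SIGMA countable_Collect) auto
  define G where "G = (\<lambda>(T, m, z). near_linear_set \<phi> (\<lambda>v. QQ T (T *v v)) (QQ T) t m \<inter> ball z (1 / (2 * real (Suc m))))"
  define P where "P X \<longleftrightarrow> X \<in> sets borel \<and> (\<exists>S Q m z. linear S \<and> inj S \<and> linear Q \<and> (\<forall>y. norm (Q y) \<le> norm y) \<and>
       X \<subseteq> near_linear_set \<phi> S Q t m \<and> X \<subseteq> ball z (1 / (2 * real (Suc m))))" for X
  have P_G: "P (G i)" if iI: "i \<in> I" for i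
  proof -
    obtain T m z where i: "i = (T, m, z)" "inj ((*v) T)" using iI by (auto simp: I_def)
    let ?S = "\<lambda>v. QQ T (T *v v)"
    have S: "linear ?S"
      using linear_compose[OF matrix_vector_mul_linear[of T], of "QQ T"] QQ[OF i(2)] by (simp add: o_def)
    have "inj ?S"
    proof (subst linear_injective_0[OF S], intro allI impI)
      fix v assume "?S v = 0"
      then have "norm (T *v v) = 0" using QQ[OF i(2)] by (metis norm_zero)
      then show "v = 0" using i(2) linear_injective_0[OF matrix_vector_mul_linear[of T]] by simp
    qed
    moreover have "G i \<in> sets borel"
      using near_linear_set_closed[OF \<phi>, of "QQ T"] QQ[OF i(2)] unfolding i(1) G_def by auto
    ultimately show ?thesis
      unfolding P_def using S QQ[OF i(2)]
      by (intro conjI exI[of _ ?S] exI[of _ "QQ T"] exI[of _ m] exI[of _ z]) (auto simp: i(1) G_def)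
  qed
  have P_empty: "P {}"
    unfolding P_def by (intro conjI exI[of _ id] exI[of _ "\<lambda>_. 0"]) (auto simp: linear_id module_hom_zero)
  have P_mono: "P X" if "P Y" "X \<subseteq> Y" "X \<in> sets borel" for X Y
    using that unfolding P_def by (meson order_trans)
  have cover: "x \<in> (\<Union>i\<in>I. G i)" if D: "(\<phi> has_derivative D) (at x)" "inj D" for x D
  proof -
    have linD: "linear D" using has_derivative_linear[OF D(1)] .
    obtain c where c: "0 < c" "\<And>v. c * norm v \<le> norm (D v)"
      using linear_inj_bounded_below_pos[OF linD D(2)] by blast
    let ?\<delta> = "(t - 1) * c / (3 * t)"
    have \<delta>: "0 < ?\<delta>" "?\<delta> < c" using t c(1) by (auto simp: field_simps intro!: add_pos_pos)
    obtain T where T: "T \<in> V" "T \<in> ball (matrix D) ?\<delta>"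
      using V(2)[of "ball (matrix D) ?\<delta>"] \<delta>(1) by auto
    have near: "norm (T *v v - D v) \<le> ?\<delta> * norm v" for v
    proof -
      have "T *v v - D v = (T - matrix D) *v v"
        using linD by (simp add: matrix_vector_mult_diff_rdistrib matrix_works)
      then have "norm (T *v v - D v) \<le> norm (T - matrix D) * norm v"
        using norm_matrix_vector_mult_le[of "T - matrix D" v] by simp
      also have "\<dots> \<le> ?\<delta> * norm v"
        using T(2) by (intro mult_right_mono) (auto simp: dist_norm norm_minus_commute)
      finally show ?thesis .
    qed
    have injT: "inj ((*v) T)"
    proof (subst linear_injective_0[OF matrix_vector_mul_linear], intro allI impI)
      fix v assume "T *v v = 0"
      then have "c * norm v \<le> ?\<delta> * norm v" using near[of v] c(2)[of v] by simp
      then have "norm v \<le> 0" using \<delta>(2) mult_strict_right_mono[OF \<delta>(2), of "norm v"] by (cases "v = 0") auto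
      then show "v = 0" by simp
    qed
    obtain m where m: "x \<in> near_linear_set \<phi> (\<lambda>v. QQ T (T *v v)) (QQ T) t m"
      using near_linear_set_approx[OF D(1) c t matrix_vector_mul_linear near, of "QQ T"] QQ[OF injT] by blast
    obtain z where z: "z \<in> Z" "z \<in> ball x (1 / (2 * real (Suc m)))"
      using Z(2)[of "ball x (1 / (2 * real (Suc m)))"] by auto
    have "(T, m, z) \<in> I" using T(1) injT z(1) by (simp add: I_def)
    moreover have "x \<in> G (T, m, z)" using m z(2) by (simp add: G_def dist_commute)
    ultimately show ?thesis by blast
  qed
  define E0 where "E0 n = (if n \<in> to_nat_on I ` I then G (from_nat_into I n) else {})" for n
  have P_E0: "P (E0 n)" for n
    using P_G P_empty I by (auto simp: E0_def)
  have G_E0: "(\<Union>i\<in>I. G i) \<subseteq> (\<Union>n. E0 n)"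
  proof
    fix x assume "x \<in> (\<Union>i\<in>I. G i)"
    then obtain i where "i \<in> I" "x \<in> G i" by blast
    then have "x \<in> E0 (to_nat_on I i)" using I by (simp add: E0_def)
    then show "x \<in> (\<Union>n. E0 n)" by blast
  qed
  have P_dis: "P (disjointed E0 n)" for n
  proof (rule P_mono[OF P_E0 disjointed_subset])
    have "E0 n \<in> sets borel" for n using P_E0[of n] unfolding P_def by (rule conjunct1)
    then have "range E0 \<subseteq> sets borel" by blast
    from sets.range_disjointed_sets[OF this] show "disjointed E0 n \<in> sets borel" by blast
  qed
  show ?thesis
  proof (rule that[OF disjoint_family_disjointed[of E0]])
    show "disjointed E0 n \<in> sets borel" for n using P_dis[of n] unfolding P_def by (rule conjunct1)
    show "{x. \<exists>D. (\<phi> has_derivative D) (at x) \<and> inj D} \<subseteq> (\<Union>n. disjointed E0 n)"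
      unfolding UN_disjointed_eq
    proof
      fix x assume "x \<in> {x. \<exists>D. (\<phi> has_derivative D) (at x) \<and> inj D}"
      then obtain D where "(\<phi> has_derivative D) (at x)" "inj D" by blast
      from cover[OF this] G_E0 show "x \<in> (\<Union>n. E0 n)" by (rule subsetD[rotated])
    qed
    show "\<exists>S Q m z. linear S \<and> inj S \<and> linear Q \<and> (\<forall>y. norm (Q y) \<le> norm y) \<and>
       disjointed E0 n \<subseteq> near_linear_set \<phi> S Q t m \<and> disjointed E0 n \<subseteq> ball z (1 / (2 * real (Suc m)))" for n
      using P_dis[of n] unfolding P_def by (rule conjunct2)
  qed
qed

text \<open>
  Continuous images of \<open>F\<^sub>\<sigma>\<close> sets are Borel because these sets are \<open>\<sigma>\<close>-compact, and a measurable set is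
  an \<open>F\<^sub>\<sigma>\<close> set up to a null set, whose image does not count. So images of measurable sets can be
  measured without any theory of analytic sets.
\<close>

lemma hausdorff_image_fsigma_part:
  fixes \<phi> :: "'a::euclidean_space \<Rightarrow> 'b::metric_space"
  assumes \<phi>: "locally_lipschitz \<phi>" and A: "A \<in> sets lebesgue"
  obtains C where "fsigma C" "C \<subseteq> A" "A - C \<in> null_sets lebesgue" "\<phi> ` C \<in> sets borel"
    "hausdorff_outer_measure DIM('a) (\<phi> ` A) = hausdorff_outer_measure DIM('a) (\<phi> ` C)"
proof -
  let ?H = "hausdorff_outer_measure DIM('a)"
  obtain C where C: "fsigma C" "C \<subseteq> A" "A - C \<in> null_sets lebesgue"
    using lebesgue_fsigma_subset[OF A] .
  have "\<phi> ` C \<in> sets borel"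
    by (rule fsigma_continuous_image_borel[OF C(1) locally_lipschitz_imp_continuous_on[OF \<phi>]])
  moreover have "?H (\<phi> ` A) = ?H (\<phi> ` C)"
  proof (rule antisym)
    have "\<phi> ` A = \<phi> ` C \<union> \<phi> ` (A - C)" using C(2) by auto
    then have "?H (\<phi> ` A) \<le>
        ?H (\<phi> ` C) + ?H (\<phi> ` (A - C))"
      using hausdorff_outer_measure_Un by metis
    then show "?H (\<phi> ` A) \<le> ?H (\<phi> ` C)"
      by (simp add: hausdorff_locally_lipschitz_image_null[OF \<phi> C(3)])
    show "?H (\<phi> ` C) \<le> ?H (\<phi> ` A)"
      using C(2) by (intro hausdorff_outer_measure_mono) blast
  qed
  ultimately show ?thesis using that C by blast
qed

lemma hausdorff_image_UN_disjoint:
  fixes \<phi> :: "'a::euclidean_space \<Rightarrow> 'b::metric_space" and A :: "nat \<Rightarrow> 'a set"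
  assumes \<phi>: "locally_lipschitz \<phi>" and A: "\<And>j. A j \<in> sets lebesgue" and disj: "disjoint_family (\<lambda>j. \<phi> ` A j)"
  shows "hausdorff_outer_measure DIM('a) (\<phi> ` (\<Union>j. A j)) = (\<Sum>j. hausdorff_outer_measure DIM('a) (\<phi> ` A j))"
proof (rule antisym)
  let ?Ho = "hausdorff_outer_measure DIM('a)"
  show "?Ho (\<phi> ` (\<Union>j. A j)) \<le> (\<Sum>j. ?Ho (\<phi> ` A j))"
    unfolding image_UN by (rule hausdorff_outer_measure_subadditive)
  have "\<exists>C. C \<subseteq> A j \<and> \<phi> ` C \<in> sets borel \<and>
      ?Ho (\<phi> ` A j) = ?Ho (\<phi> ` C)" for j
    using hausdorff_image_fsigma_part[OF \<phi> A[of j]] by metis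
  then obtain C where C: "\<And>j. C j \<subseteq> A j" "\<And>j. \<phi> ` C j \<in> sets borel"
    "\<And>j. ?Ho (\<phi> ` A j) = ?Ho (\<phi> ` C j)"
    by metis
  let ?H = "hausdorff_measure DIM('a) :: 'b measure"
  have "disjoint_family (\<lambda>j. \<phi> ` C j)"
    using disj C(1) unfolding disjoint_family_on_def by blast
  then have "(\<Sum>j. emeasure ?H (\<phi> ` C j)) = emeasure ?H (\<Union>j. \<phi> ` C j)"
    using C(2) by (intro suminf_emeasure) auto
  then have "(\<Sum>j. ?Ho (\<phi> ` C j)) = ?Ho (\<Union>j. \<phi> ` C j)"
    using C(2) by (simp add: emeasure_hausdorff_measure sets.countable_UN)
  also have "\<dots> \<le> ?Ho (\<phi> ` (\<Union>j. A j))"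
    using C(1) by (intro hausdorff_outer_measure_mono) blast
  finally show "(\<Sum>j. ?Ho (\<phi> ` A j)) \<le> ?Ho (\<phi> ` (\<Union>j. A j))"
    by (simp add: C(3))
qed

lemma ennreal_le_of_forall_le_power_mult:
  fixes a b :: ennreal
  assumes "\<And>t::real. 1 < t \<Longrightarrow> a \<le> ennreal (t ^ n) * b"
  shows "a \<le> b"
proof (rule tendsto_lowerbound)
  have "((\<lambda>t::real. ennreal (t ^ n)) \<longlongrightarrow> ennreal (1 ^ n)) (at_right 1)"
    by (intro tendsto_intros)
  then have "((\<lambda>t::real. ennreal (t ^ n) * b) \<longlongrightarrow> ennreal (1 ^ n) * b) (at_right 1)"
    by (intro tendsto_mult_ennreal tendsto_const) auto
  then show "((\<lambda>t::real. ennreal (t ^ n) * b) \<longlongrightarrow> b) (at_right 1)" by simp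
  show "\<forall>\<^sub>F t in at_right (1::real). a \<le> ennreal (t ^ n) * b"
    using assms by (auto simp: eventually_at_right_field intro: exI[of _ 2])
qed simp

lemma near_linear_set_area:
  fixes \<phi> :: "real^'k \<Rightarrow> real^'n"
  assumes \<phi>: "locally_lipschitz \<phi>"
    and A: "A \<subseteq> near_linear_set \<phi> S Q t m" "A \<subseteq> ball z (1 / (2 * real (Suc m)))" "A \<in> sets lebesgue"
    and S: "linear S" "inj S" and Q: "linear Q" "\<And>y. norm (Q y) \<le> norm y" and t: "0 < t"
    and D: "\<And>x. x \<in> A \<Longrightarrow> \<exists>D. (\<phi> has_derivative D) (at x) \<and> inj D"
    and J: "J \<in> borel_measurable lebesgue" "\<And>x. x \<in> A \<Longrightarrow> J x = k_jacobian \<phi> x"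
  shows "hausdorff_outer_measure CARD('k) (\<phi> ` A) \<le> ennreal (t ^ (2 * CARD('k))) * (\<integral>\<^sup>+x\<in>A. ennreal (J x) \<partial>lebesgue)"
    and "(\<integral>\<^sup>+x\<in>A. ennreal (J x) \<partial>lebesgue) \<le> ennreal (t ^ (2 * CARD('k))) * hausdorff_outer_measure CARD('k) (\<phi> ` A)"
proof -
  let ?c = "t ^ CARD('k)" and ?s = "\<bar>det (matrix S)\<bar>"
  note jac = near_linear_set_jacobian[OF _ _ _ S Q t]
  have cc: "ennreal (t ^ (2 * CARD('k))) = ennreal ?c * ennreal ?c"
    using t by (simp add: power_mult power2_eq_square power_mult_distrib mult.commute[of 2] flip: ennreal_mult')
  have sA: "ennreal ?s * emeasure lebesgue A = (\<integral>\<^sup>+x. ennreal ?s * indicator A x \<partial>lebesgue)"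
    by (rule nn_integral_cmult_indicator[OF A(3), symmetric])
  have "ennreal ?s * emeasure lebesgue A \<le> (\<integral>\<^sup>+x. ennreal ?c * (ennreal (J x) * indicator A x) \<partial>lebesgue)"
    unfolding sA
  proof (rule nn_integral_mono)
    fix x
    show "ennreal ?s * indicator A x \<le> ennreal ?c * (ennreal (J x) * indicator A x)"
    proof (cases "x \<in> A")
      case True
      then obtain D where "(\<phi> has_derivative D) (at x)" "inj D" using D by blast
      from jac(2)[OF _ this] True A(1) have "?s \<le> ?c * J x" by (auto simp: J(2))
      then show ?thesis using True t by (simp add: ennreal_leI flip: ennreal_mult')
    qed simp
  qed
  also have "\<dots> = ennreal ?c * (\<integral>\<^sup>+x\<in>A. ennreal (J x) \<partial>lebesgue)"
    by (intro nn_integral_cmult borel_measurable_times_ennreal measurable_compose[OF J(1) measurable_ennreal]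
        borel_measurable_indicator A(3))
  finally have "ennreal ?c * (ennreal ?s * emeasure lebesgue A) \<le> ennreal ?c * (ennreal ?c * (\<integral>\<^sup>+x\<in>A. ennreal (J x) \<partial>lebesgue))"
    by (intro mult_left_mono) auto
  with near_linear_set_measure(1)[OF \<phi> A S Q t]
  show "hausdorff_outer_measure CARD('k) (\<phi> ` A) \<le> ennreal (t ^ (2 * CARD('k))) * (\<integral>\<^sup>+x\<in>A. ennreal (J x) \<partial>lebesgue)"
    unfolding cc mult.assoc by (rule order_trans)
  have "(\<integral>\<^sup>+x\<in>A. ennreal (J x) \<partial>lebesgue) \<le> (\<integral>\<^sup>+x. ennreal ?c * ennreal ?s * indicator A x \<partial>lebesgue)"
  proof (rule nn_integral_mono)
    fix x
    show "ennreal (J x) * indicator A x \<le> ennreal ?c * ennreal ?s * indicator A x"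
    proof (cases "x \<in> A")
      case True
      then obtain D where "(\<phi> has_derivative D) (at x)" "inj D" using D by blast
      from jac(1)[OF _ this] True A(1) have "J x \<le> ?c * ?s" by (auto simp: J(2))
      then show ?thesis using True t by (simp add: ennreal_leI flip: ennreal_mult')
    qed simp
  qed
  also have "\<dots> = ennreal ?c * (ennreal ?s * emeasure lebesgue A)"
    by (subst nn_integral_cmult_indicator[OF A(3)]) (simp only: mult.assoc)
  also have "\<dots> \<le> ennreal ?c * (ennreal ?c * hausdorff_outer_measure CARD('k) (\<phi> ` A))"
    by (intro mult_left_mono near_linear_set_measure(2)[OF \<phi> A S Q t]) auto
  finally show "(\<integral>\<^sup>+x\<in>A. ennreal (J x) \<partial>lebesgue) \<le> ennreal (t ^ (2 * CARD('k))) * hausdorff_outer_measure CARD('k) (\<phi> ` A)"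
    unfolding cc mult.assoc .
qed

text \<open>
  The Jacobian enters through a measurable function \<open>J\<close> that agrees with it on \<open>A\<close>, since the Jacobian itself
  is defined by an arbitrary choice at points where \<open>\<phi>\<close> is not differentiable. Each piece of a
  decomposition for \<open>t\<close> satisfies the formula up to the factor \<open>t\<^bsup>2 k\<^esup>\<close>, hence so does their union.
\<close>

theorem area_formula_injective:
  fixes \<phi> :: "real^'k \<Rightarrow> real^'n"
  assumes \<phi>: "locally_lipschitz \<phi>" and A: "A \<in> sets lebesgue" and inj: "inj_on \<phi> A"
    and D: "\<And>x. x \<in> A \<Longrightarrow> \<exists>D. (\<phi> has_derivative D) (at x) \<and> inj D"
    and J: "J \<in> borel_measurable lebesgue" "\<And>x. x \<in> A \<Longrightarrow> J x = k_jacobian \<phi> x"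
  shows "hausdorff_outer_measure CARD('k) (\<phi> ` A) = (\<integral>\<^sup>+x\<in>A. ennreal (J x) \<partial>lebesgue)"
proof -
  let ?H = "hausdorff_outer_measure CARD('k)"
  let ?I = "\<lambda>A. \<integral>\<^sup>+x\<in>A. ennreal (J x) \<partial>lebesgue"
  have "?H (\<phi> ` A) \<le> ennreal (t ^ (2 * CARD('k))) * ?I A \<and> ?I A \<le> ennreal (t ^ (2 * CARD('k))) * ?H (\<phi> ` A)"
    if t: "1 < t" for t
  proof -
    let ?c = "ennreal (t ^ (2 * CARD('k)))"
    obtain E :: "nat \<Rightarrow> (real^'k) set" where E: "disjoint_family E" "\<And>j. E j \<in> sets borel"
      "{x. \<exists>D. (\<phi> has_derivative D) (at x) \<and> inj D} \<subseteq> (\<Union>j. E j)"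
      "\<And>j. \<exists>S Q m z. linear S \<and> inj S \<and> linear Q \<and> (\<forall>y. norm (Q y) \<le> norm y) \<and>
         E j \<subseteq> near_linear_set \<phi> S Q t m \<and> E j \<subseteq> ball z (1 / (2 * real (Suc m)))"
      using near_linear_decomposition[OF locally_lipschitz_imp_continuous_on[OF \<phi>] t] by blast
    define B where "B j = A \<inter> E j" for j
    have B: "B j \<in> sets lebesgue" for j using A E(2)[of j] by (auto simp: B_def)
    have AB: "A = (\<Union>j. B j)" using D E(3) by (auto simp: B_def)
    have piece: "?H (\<phi> ` B j) \<le> ?c * ?I (B j) \<and> ?I (B j) \<le> ?c * ?H (\<phi> ` B j)" for j
    proof -
      obtain S Q m z where S: "linear S" "inj S" and Q: "linear Q" "\<And>y. norm (Q y) \<le> norm y" and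
         sub: "E j \<subseteq> near_linear_set \<phi> S Q t m" "E j \<subseteq> ball z (1 / (2 * real (Suc m)))"
        using E(4)[of j] by blast
      have "B j \<subseteq> near_linear_set \<phi> S Q t m" "B j \<subseteq> ball z (1 / (2 * real (Suc m)))" "0 < t"
        "\<And>x. x \<in> B j \<Longrightarrow> \<exists>D. (\<phi> has_derivative D) (at x) \<and> inj D" "\<And>x. x \<in> B j \<Longrightarrow> J x = k_jacobian \<phi> x"
        using sub t D J(2) by (auto simp: B_def)
      from near_linear_set_area[OF \<phi> this(1,2) B S Q this(3,4) J(1) this(5)] show ?thesis by blast
    qed
    have "disjoint_family B" using E(1) unfolding disjoint_family_on_def B_def by blast
    then have disj: "disjoint_family B" "disjoint_family (\<lambda>j. \<phi> ` B j)"
      using inj unfolding disjoint_family_on_def AB inj_on_def by blast+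
    have H: "?H (\<phi> ` A) = (\<Sum>j. ?H (\<phi> ` B j))"
      unfolding AB using hausdorff_image_UN_disjoint[OF \<phi> B disj(2)] by simp
    have I: "?I A = (\<Sum>j. ?I (B j))"
    proof -
      have *: "?I X = emeasure (density lebesgue (\<lambda>x. ennreal (J x))) X" if "X \<in> sets lebesgue" for X
        using that J(1) by (simp add: emeasure_density)
      have "(\<Sum>j. emeasure (density lebesgue (\<lambda>x. ennreal (J x))) (B j)) = emeasure (density lebesgue (\<lambda>x. ennreal (J x))) (\<Union>j. B j)"
        using B disj(1) by (intro suminf_emeasure) auto
      then show ?thesis using A B by (simp add: * AB[symmetric])
    qed
    have "(\<Sum>j. ?H (\<phi> ` B j)) \<le> (\<Sum>j. ?c * ?I (B j))" "(\<Sum>j. ?I (B j)) \<le> (\<Sum>j. ?c * ?H (\<phi> ` B j))"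
      by (rule suminf_le; use piece in blast)+
    then show ?thesis unfolding H I by simp
  qed
  then have *: "?H (\<phi> ` A) \<le> ennreal (t ^ (2 * CARD('k))) * ?I A"
    "?I A \<le> ennreal (t ^ (2 * CARD('k))) * ?H (\<phi> ` A)" if "1 < t" for t
    using that by blast+
  show ?thesis
    by (rule antisym; rule ennreal_le_of_forall_le_power_mult; rule *)
qed

section \<open>Sums over fibres\<close>

text \<open>
  A cover has at least one ball, and every ball has weight \<open>r\<^sup>0 = 1\<close>.
\<close>

lemma hausdorff_measure_0_singleton:
  fixes x :: "'a::metric_space"
  shows "emeasure (hausdorff_measure 0) {x} = 1"
proof -
  have "hausdorff_content 0 \<epsilon> {x} = 1" if e: "0 < \<epsilon>" for \<epsilon>
  proof (rule antisym)
    have "hausdorff_content 0 \<epsilon> {x} \<le> infsum (\<lambda>i. ennreal (\<epsilon> powr 0)) {x}"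
      by (rule hausdorff_content_le_infsum[where x="\<lambda>_. x"]) (use e in auto)
    then show "hausdorff_content 0 \<epsilon> {x} \<le> 1" using e by simp
    show "1 \<le> hausdorff_content 0 \<epsilon> {x}"
      unfolding hausdorff_content_def
    proof (rule INF_greatest, clarify)
      fix C assume C: "\<forall>(x, r) \<in> C. 0 < r \<and> r \<le> \<epsilon>" "{x} \<subseteq> (\<Union>(x, r) \<in> C. ball x r)"
      then obtain i where i: "i \<in> C" "0 < snd i" by force
      have "1 = infsum (\<lambda>(x, r). ennreal (r powr 0)) {i}" using i(2) by (simp add: case_prod_beta)
      also have "\<dots> \<le> infsum (\<lambda>(x, r). ennreal (r powr 0)) C"
        using i(1) by (intro infsum_ennreal_mono_set) simp
      finally show "1 \<le> infsum (\<lambda>(x, r). ennreal (r powr 0)) C" .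
    qed
  qed
  then have "hausdorff_outer_measure 0 {x} = 1"
    using hausdorff_outer_measure_nat[of 0 "{x}"] by (auto intro!: SUP_eq_const)
  then show ?thesis by (simp add: emeasure_hausdorff_measure)
qed

lemma infsum_disjoint_family:
  fixes h :: "'a \<Rightarrow> ennreal"
  assumes "disjoint_family E" "B \<subseteq> (\<Union>i::nat. E i)"
  shows "infsum h B = (\<Sum>i. infsum h (B \<inter> E i))"
proof (rule antisym)
  have "infsum h B \<le> infsum h (\<Union>i. B \<inter> E i)"
    using assms(2) by (intro infsum_ennreal_mono_set) auto
  also have "\<dots> \<le> (\<Sum>i. infsum h (B \<inter> E i))" by (rule infsum_ennreal_UN_le)
  finally show "infsum h B \<le> (\<Sum>i. infsum h (B \<inter> E i))" .
  show "(\<Sum>i. infsum h (B \<inter> E i)) \<le> infsum h B"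
  proof (rule suminf_le_const)
    fix n
    have "(\<Sum>i<n. infsum h (B \<inter> E i)) = infsum h (\<Union>i<n. B \<inter> E i)"
    proof (induction n)
      case (Suc n)
      have "E i \<inter> E n = {}" if "i < n" for i
        using assms(1) that by (simp add: disjoint_family_on_def)
      then have "(\<Union>i<n. B \<inter> E i) \<inter> (B \<inter> E n) = {}" by blast
      then have "infsum h ((\<Union>i<n. B \<inter> E i) \<union> (B \<inter> E n)) = infsum h (\<Union>i<n. B \<inter> E i) + infsum h (B \<inter> E n)"
        by (intro infsum_Un_disjoint) (auto intro!: nonneg_summable_on_complete)
      moreover have "(\<Union>i<Suc n. B \<inter> E i) = (\<Union>i<n. B \<inter> E i) \<union> (B \<inter> E n)"
        by (auto simp: lessThan_Suc)
      ultimately show ?case using Suc.IH by simp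
    qed simp
    also have "\<dots> \<le> infsum h B" by (intro infsum_ennreal_mono_set) auto
    finally show "(\<Sum>i<n. infsum h (B \<inter> E i)) \<le> infsum h B" .
  qed simp
qed

lemma fibre_inter_cases:
  assumes "\<And>x x'. x \<in> E \<Longrightarrow> x' \<in> E \<Longrightarrow> \<phi> x = y \<Longrightarrow> \<phi> x' = y \<Longrightarrow> x = x'"
  shows "\<phi> -` {y} \<inter> E = (if y \<in> \<phi> ` E then {the_inv_into E \<phi> y} else {})"
proof (cases "y \<in> \<phi> ` E")
  case True
  then obtain x where x: "x \<in> E" "\<phi> x = y" by blast
  have "the_inv_into E \<phi> y = x"
    unfolding the_inv_into_def by (rule the_equality) (use x assms in auto)
  then show ?thesis using True x assms by auto
next
  case False
  then show ?thesis by auto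
qed

text \<open>
  If each member of a partition meets the fibre in at most one point, the sum over the fibre is the
  series over the members. This is used for the pieces of the proof as well as for the given sets \<open>E\<^sub>i\<close>.
\<close>

lemma infsum_fibre:
  fixes h :: "'a \<Rightarrow> ennreal" and E :: "nat \<Rightarrow> 'a set"
  assumes "disjoint_family E" "\<phi> -` {y} \<subseteq> (\<Union>i. E i)"
    and "\<And>i x x'. x \<in> E i \<Longrightarrow> x' \<in> E i \<Longrightarrow> \<phi> x = y \<Longrightarrow> \<phi> x' = y \<Longrightarrow> x = x'"
  shows "infsum h (\<phi> -` {y}) = (\<Sum>i. if y \<in> \<phi> ` E i then h (the_inv_into (E i) \<phi> y) else 0)"
proof -
  have single: "\<phi> -` {y} \<inter> E i = (if y \<in> \<phi> ` E i then {the_inv_into (E i) \<phi> y} else {})" for i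
    by (rule fibre_inter_cases) (rule assms(3))
  have "infsum h (\<phi> -` {y}) = (\<Sum>i. infsum h (\<phi> -` {y} \<inter> E i))"
    by (rule infsum_disjoint_family[OF assms(1,2)])
  also have "\<dots> = (\<Sum>i. if y \<in> \<phi> ` E i then h (the_inv_into (E i) \<phi> y) else 0)"
    by (intro suminf_cong) (simp add: single)
  finally show ?thesis .
qed

text \<open>
  Such a fibre is countable, so the integrand, whatever \<open>h\<close> is, becomes a series of multiples of
  indicator functions of points.
\<close>

lemma nn_integral_hausdorff_0_fibre:
  fixes h :: "'a::metric_space \<Rightarrow> ennreal" and E :: "nat \<Rightarrow> 'a set"
  assumes disj: "disjoint_family E" and sub: "\<phi> -` {y} \<subseteq> (\<Union>i. E i)"
    and single: "\<And>i x x'. x \<in> E i \<Longrightarrow> x' \<in> E i \<Longrightarrow> \<phi> x = y \<Longrightarrow> \<phi> x' = y \<Longrightarrow> x = x'"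
  shows "(\<integral>\<^sup>+x\<in>\<phi> -` {y}. h x \<partial>hausdorff_measure 0) = infsum h (\<phi> -` {y})"
proof -
  let ?x = "\<lambda>i. the_inv_into (E i) \<phi> y"
  let ?t = "\<lambda>i x. (if y \<in> \<phi> ` E i then h (?x i) else 0) * indicator {?x i} x"
  have cases: "\<phi> -` {y} \<inter> E i = (if y \<in> \<phi> ` E i then {?x i} else {})" for i
    by (rule fibre_inter_cases) (rule single)
  have "h x * indicator (\<phi> -` {y}) x = (\<Sum>i. ?t i x)" for x
  proof -
    have "h x * indicator (\<phi> -` {y}) x = infsum h (if x \<in> \<phi> -` {y} then {x} else {})" by simp
    also have "\<dots> = (\<Sum>i. infsum h ((if x \<in> \<phi> -` {y} then {x} else {}) \<inter> E i))"
      using sub by (intro infsum_disjoint_family[OF disj]) auto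
    also have "\<dots> = (\<Sum>i. ?t i x)"
    proof (rule suminf_cong)
      fix i
      have "(if x \<in> \<phi> -` {y} then {x} else {}) \<inter> E i = (\<phi> -` {y} \<inter> E i) \<inter> {x}" by auto
      also have "\<dots> = (if y \<in> \<phi> ` E i then {?x i} else {}) \<inter> {x}"
        unfolding cases ..
      finally show "infsum h ((if x \<in> \<phi> -` {y} then {x} else {}) \<inter> E i) = ?t i x"
        by (auto simp: indicator_def)
    qed
    finally show ?thesis .
  qed
  then have "(\<integral>\<^sup>+x\<in>\<phi> -` {y}. h x \<partial>hausdorff_measure 0) = (\<integral>\<^sup>+x. (\<Sum>i. ?t i x) \<partial>hausdorff_measure 0)"
    by (intro nn_integral_cong) simp
  also have "\<dots> = (\<Sum>i. \<integral>\<^sup>+x. ?t i x \<partial>hausdorff_measure 0)"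
    by (intro nn_integral_suminf) simp
  also have "\<dots> = (\<Sum>i. if y \<in> \<phi> ` E i then h (?x i) else 0)"
    by (intro suminf_cong) (simp add: nn_integral_cmult_indicator hausdorff_measure_0_singleton)
  also have "\<dots> = infsum h (\<phi> -` {y})"
    by (rule infsum_fibre[OF disj sub single, symmetric])
  finally show ?thesis .
qed

lemma has_derivative_difference_quotient:
  fixes f :: "'a::real_normed_vector \<Rightarrow> real"
  assumes "(f has_derivative D) (at x)"
  shows "((\<lambda>h. (f (x + h *\<^sub>R v) - f x) / h) \<longlongrightarrow> D v) (at 0)"
proof -
  have "((\<lambda>h. x + h *\<^sub>R v) has_derivative (\<lambda>h. h *\<^sub>R v)) (at (0::real))"
    by (auto intro!: derivative_eq_intros)
  moreover have "(f has_derivative D) (at (x + 0 *\<^sub>R v))" using assms by simp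
  ultimately have "((\<lambda>h. f (x + h *\<^sub>R v)) has_derivative (\<lambda>h. D (h *\<^sub>R v))) (at 0)"
    by (rule has_derivative_compose)
  moreover have "(\<lambda>h. D (h *\<^sub>R v)) = (*) (D v)"
    using linear_scale[OF has_derivative_linear[OF assms]] by (auto simp: mult.commute)
  ultimately have "((\<lambda>h. f (x + h *\<^sub>R v)) has_field_derivative D v) (at 0)"
    by (simp add: has_field_derivative_def)
  then show ?thesis by (simp add: DERIV_def)
qed

text \<open>
  The Jacobian computed from partial derivatives: a Borel function that agrees with the Jacobian at all points
  of differentiability.
\<close>

definition jacobian_version :: "(real^'k \<Rightarrow> real^'n) \<Rightarrow> real^'k \<Rightarrow> real" where
  "jacobian_version \<phi> x =
     (let M = (\<chi> i j. dir_deriv (\<lambda>z. \<phi> z $ i) (axis j 1) x) in sqrt (det (transpose M ** M)))"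

lemma jacobian_version_eq:
  fixes \<phi> :: "real^'k \<Rightarrow> real^'n"
  assumes D: "(\<phi> has_derivative D) (at x)"
  shows "jacobian_version \<phi> x = k_jacobian \<phi> x"
proof -
  have "jacobian \<phi> (at x) = matrix D"
    unfolding jacobian_def using frechet_derivative_at[OF D] by simp
  moreover have "dir_deriv (\<lambda>z. \<phi> z $ i) (axis j 1) x = matrix D $ i $ j" for i j
  proof -
    have "((\<lambda>z. \<phi> z $ i) has_derivative (\<lambda>v. D v $ i)) (at x)"
      by (rule bounded_linear.has_derivative[OF bounded_linear_vec_nth D])
    from dir_deriv_eq[OF has_derivative_difference_quotient[OF this]]
    show ?thesis by (simp add: matrix_def)
  qed
  ultimately show ?thesis by (simp add: jacobian_version_def k_jacobian_def Let_def)
qed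

lemma borel_measurable_jacobian_version:
  fixes \<phi> :: "real^'k \<Rightarrow> real^'n"
  assumes \<phi>: "continuous_on UNIV \<phi>"
  shows "jacobian_version \<phi> \<in> borel_measurable borel"
proof -
  have [measurable]: "dir_deriv (\<lambda>z. \<phi> z $ i) v \<in> borel_measurable borel" for i v
    by (intro borel_measurable_dir_deriv borel_measurable_continuous_onI continuous_on_component \<phi>)
  show ?thesis
    unfolding jacobian_version_def[abs_def] Let_def det_def matrix_matrix_mult_def transpose_def
    by simp measurable
qed

section \<open>Densities under injective maps\<close>

text \<open>
  The preimage of a closed set \<open>F\<close> is the image of the \<open>\<sigma>\<close>-compact set \<open>C \<inter> F\<close>, up to the
  complement of the image of \<open>C\<close>, where the default value 0 is taken.
\<close>

lemma borel_measurable_inverse_on_image: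
  fixes \<phi> :: "'a::euclidean_space \<Rightarrow> 'b::t2_space"
  assumes \<phi>: "continuous_on UNIV \<phi>" and C: "fsigma C" and inj: "inj_on \<phi> C"
  shows "(\<lambda>y. if y \<in> \<phi> ` C then the_inv_into C \<phi> y else 0) \<in> borel_measurable borel"
proof -
  let ?g = "\<lambda>y. if y \<in> \<phi> ` C then the_inv_into C \<phi> y else 0"
  have contC: "continuous_on S \<phi>" for S by (rule continuous_on_subset[OF \<phi>]) simp
  have "?g \<in> measurable borel (sigma UNIV (Collect closed))"
  proof (rule measurable_measure_of)
    fix F :: "'a set" assume "F \<in> Collect closed"
    then have F: "closed F" by simp
    obtain K :: "nat \<Rightarrow> 'a set" where K: "range K \<subseteq> Collect compact" "C = \<Union>(range K)"
      using fsigma_Union_compact[THEN iffD1, OF C] by blast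
    have "fsigma (C \<inter> F)"
    proof (rule fsigma_Union_compact[THEN iffD2], intro exI[of _ "\<lambda>n. K n \<inter> F"] conjI)
      show "range (\<lambda>n. K n \<inter> F) \<subseteq> Collect compact" using K(1) F by (auto intro: compact_Int_closed)
    qed (use K(2) in auto)
    then have "\<phi> ` (C \<inter> F) \<in> sets borel" by (rule fsigma_continuous_image_borel[OF _ contC])
    moreover have "\<phi> ` C \<in> sets borel" by (rule fsigma_continuous_image_borel[OF C contC])
    moreover have "?g -` F \<inter> space borel = \<phi> ` (C \<inter> F) \<union> (if 0 \<in> F then - \<phi> ` C else {})"
      using the_inv_into_f_f[OF inj] by (auto split: if_splits)
    ultimately show "?g -` F \<inter> space borel \<in> sets borel" by auto
  qed auto
  then show ?thesis by (simp only: borel_eq_closed[where 'a='a])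
qed

text \<open>
  By the area formula, \<open>\<H>\<^sup>k\<close> on \<open>\<phi>(C)\<close> is the image of the measure with density \<open>J\<^sub>k\<phi>\<close> on \<open>C\<close>; transforming
  the integral back to \<open>C\<close>, the Jacobian cancels.
\<close>

lemma area_transform_injective:
  fixes \<phi> :: "real^'k \<Rightarrow> real^'n"
  assumes \<phi>: "locally_lipschitz \<phi>" and C: "fsigma C" and inj: "inj_on \<phi> C"
    and D: "\<And>x. x \<in> C \<Longrightarrow> \<exists>D. (\<phi> has_derivative D) (at x) \<and> inj D"
    and f[measurable]: "f \<in> borel_measurable borel" and A: "A \<in> sets borel"
  defines "\<psi> \<equiv> \<lambda>y. if y \<in> \<phi> ` C then the_inv_into C \<phi> y else 0"
  shows "(\<integral>\<^sup>+y\<in>A. indicator (\<phi> ` C) y * (f (\<psi> y) * ennreal (1 / jacobian_version \<phi> (\<psi> y))) \<partial>hausdorff_measure CARD('k))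
     = (\<integral>\<^sup>+x\<in>C \<inter> \<phi> -` A. f x \<partial>lborel)"
proof -
  let ?H = "hausdorff_measure CARD('k) :: (real^'n) measure"
  let ?J = "jacobian_version \<phi>"
  let ?h = "\<lambda>x. f x * ennreal (1 / ?J x)"
  have cont: "continuous_on UNIV \<phi>" by (rule locally_lipschitz_imp_continuous_on[OF \<phi>])
  have [measurable]: "\<phi> \<in> borel_measurable borel" by (rule borel_measurable_continuous_onI[OF cont])
  have J[measurable]: "?J \<in> borel_measurable borel" by (rule borel_measurable_jacobian_version[OF cont])
  have Cb[measurable]: "C \<in> sets borel" by (rule fsigma_imp_borel[OF C])
  have imC[measurable]: "\<phi> ` C \<in> sets borel"
    by (rule fsigma_continuous_image_borel[OF C continuous_on_subset[OF cont]]) simp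
  have \<psi>[measurable]: "\<psi> \<in> borel_measurable borel"
    unfolding \<psi>_def by (rule borel_measurable_inverse_on_image[OF cont C inj])
  have \<psi>\<phi>: "\<psi> (\<phi> x) = x" if "x \<in> C" for x
    using that inj by (simp add: \<psi>_def the_inv_into_f_f)
  note [measurable] = A
  have preim: "\<phi> -` B \<in> sets borel" if "B \<in> sets borel" for B
    using measurable_sets[OF \<open>\<phi> \<in> borel_measurable borel\<close> that] by simp
  let ?M1 = "density ?H (indicator (\<phi> ` C))"
  let ?M2 = "distr (density lborel (\<lambda>x. indicator C x * ennreal (?J x))) borel \<phi>"
  have "?M1 = ?M2"
  proof (rule measure_eqI)
    fix B assume "B \<in> sets ?M1"
    then have B[measurable]: "B \<in> sets borel" by simp
    have CB: "C \<inter> \<phi> -` B \<in> sets borel" using Cb preim[OF B] by (rule sets.Int)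
    have im: "\<phi> ` (C \<inter> \<phi> -` B) = \<phi> ` C \<inter> B" by blast
    have "emeasure ?M1 B = emeasure ?H (\<phi> ` C \<inter> B)"
      using B imC by (simp add: emeasure_density nn_integral_indicator flip: indicator_inter_arith)
    also have "\<dots> = hausdorff_outer_measure CARD('k) (\<phi> ` (C \<inter> \<phi> -` B))"
      unfolding im using B imC by (simp add: emeasure_hausdorff_measure)
    also have "\<dots> = (\<integral>\<^sup>+x\<in>C \<inter> \<phi> -` B. ennreal (?J x) \<partial>lebesgue)"
    proof (rule area_formula_injective[OF \<phi>])
      show "?J \<in> borel_measurable lebesgue" using J by (simp add: measurable_completion)
      show "?J x = k_jacobian \<phi> x" if "x \<in> C \<inter> \<phi> -` B" for x
        using D that jacobian_version_eq by blast
    qed (use CB D inj in \<open>auto intro: inj_on_subset\<close>)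
    also have "\<dots> = (\<integral>\<^sup>+x\<in>C \<inter> \<phi> -` B. ennreal (?J x) \<partial>lborel)"
      using CB by (intro nn_integral_completion) measurable
    also have "\<dots> = emeasure ?M2 B"
      using preim[OF B] by (simp add: emeasure_distr emeasure_density)
        (intro nn_integral_cong, auto simp: indicator_def)
    finally show "emeasure ?M1 B = emeasure ?M2 B" .
  qed simp
  have "(\<integral>\<^sup>+y\<in>A. indicator (\<phi> ` C) y * ?h (\<psi> y) \<partial>?H) = (\<integral>\<^sup>+y. indicator (\<phi> ` C) y * (?h (\<psi> y) * indicator A y) \<partial>?H)"
    by (simp add: mult.assoc)
  also have "\<dots> = (\<integral>\<^sup>+y. ?h (\<psi> y) * indicator A y \<partial>?M1)"
    by (rule nn_integral_density[symmetric]) measurable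
  also have "\<dots> = (\<integral>\<^sup>+x. ?h (\<psi> (\<phi> x)) * indicator A (\<phi> x) \<partial>density lborel (\<lambda>x. indicator C x * ennreal (?J x)))"
    unfolding \<open>?M1 = ?M2\<close> by (rule nn_integral_distr) measurable
  also have "\<dots> = (\<integral>\<^sup>+x. (indicator C x * ennreal (?J x)) * (?h (\<psi> (\<phi> x)) * indicator A (\<phi> x)) \<partial>lborel)"
    by (rule nn_integral_density) measurable
  also have "\<dots> = (\<integral>\<^sup>+x\<in>C \<inter> \<phi> -` A. f x \<partial>lborel)"
  proof (rule nn_integral_cong)
    fix x
    show "(indicator C x * ennreal (?J x)) * (?h (\<psi> (\<phi> x)) * indicator A (\<phi> x)) = f x * indicator (C \<inter> \<phi> -` A) x"
    proof (cases "x \<in> C")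
      case True
      then obtain D where "(\<phi> has_derivative D) (at x)" "inj D" using D by blast
      then have "0 < ?J x" using k_jacobian_pos jacobian_version_eq by metis
      then have "ennreal (?J x) * ennreal (1 / ?J x) = 1" by (simp flip: ennreal_mult')
      then have "ennreal (?J x) * (f x * ennreal (1 / ?J x)) = f x" by (simp add: mult.left_commute)
      then show ?thesis using True by (simp add: \<psi>\<phi> indicator_def)
    qed simp
  qed
  finally show ?thesis .
qed

section \<open>The density of a transformed random variable\<close>

theorem theorem4p1:
  fixes P :: "'a measure"
    and X :: "'a \<Rightarrow> real^'k"
    and f :: "real^'k \<Rightarrow> ennreal"
    and \<phi> :: "real^'k \<Rightarrow> real^'n"
  assumes "prob_space P"
    and "CARD('k) \<le> CARD('n)"
    and "distributed P lborel X f"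
    and "locally_lipschitz \<phi>"
    and "AE x in lborel. rank (jacobian \<phi> (at x)) = CARD('k)"
  shows
    "absolutely_continuous (hausdorff_measure (real CARD('k))) (distr P borel (\<phi> \<circ> X)) \<and>
     (\<exists>g. is_RN_derivative (hausdorff_measure (real CARD('k))) (distr P borel (\<phi> \<circ> X)) g \<and>
        (\<forall>y. y \<notin> range \<phi> \<longrightarrow> g y = 0)) \<and>
     (\<forall>g. is_RN_derivative (hausdorff_measure (real CARD('k))) (distr P borel (\<phi> \<circ> X)) g \<longrightarrow>
        (AE y in hausdorff_measure (real CARD('k)).
           (y \<in> range \<phi> \<longrightarrow>
              g y = (\<integral>\<^sup>+x\<in>\<phi> -` {y}. f x * ennreal (1 / k_jacobian \<phi> x) \<partial>hausdorff_measure 0) \<and>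
              g y = (\<Sum>\<^sub>\<infinity>x\<in>\<phi> -` {y}. f x * ennreal (1 / k_jacobian \<phi> x))) \<and>
           (y \<notin> range \<phi> \<longrightarrow> g y = 0)) \<and>
        (\<forall>E :: nat \<Rightarrow> (real^'k) set.
           disjoint_family E \<and> (\<forall>i. E i \<in> sets lebesgue) \<and> - (\<Union>i. E i) \<in> null_sets lebesgue \<and>
           (\<forall>i. ae_inj_on \<phi> (E i)) \<longrightarrow>
           (AE y in hausdorff_measure (real CARD('k)). y \<in> range \<phi> \<longrightarrow>
              g y = (\<Sum>i. if y \<in> \<phi> ` E i
                          then f (the_inv_into (E i) \<phi> y) *
                               ennreal (1 / k_jacobian \<phi> (the_inv_into (E i) \<phi> y))
                          else 0))))"
proof -
  interpret prob_space P by (rule assms(1))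
  note \<phi> = \<open>locally_lipschitz \<phi>\<close>
  let ?H = "hausdorff_measure (real CARD('k)) :: (real^'n) measure"
  let ?Y = "distr P borel (\<phi> \<circ> X)"
  let ?J = "jacobian_version \<phi>"
  let ?h = "\<lambda>x. f x * ennreal (1 / k_jacobian \<phi> x)"
  let ?Reg = "{x. \<exists>D. (\<phi> has_derivative D) (at x) \<and> inj D}"
  have cont: "continuous_on UNIV \<phi>" by (rule locally_lipschitz_imp_continuous_on[OF \<phi>])
  have \<phi>m[measurable]: "\<phi> \<in> borel_measurable borel" by (rule borel_measurable_continuous_onI[OF cont])
  have X[measurable]: "X \<in> measurable P borel" and dX: "distr P lborel X = density lborel f"
    and f[measurable]: "f \<in> borel_measurable borel"
    using assms(3) by (auto simp: distributed_def)
  have J[measurable]: "?J \<in> borel_measurable borel" by (rule borel_measurable_jacobian_version[OF cont])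
  have null_image: "hausdorff_outer_measure (real CARD('k)) (\<phi> ` N) = 0" if "N \<in> null_sets lebesgue" for N
    using hausdorff_locally_lipschitz_image_null[OF \<phi> that] by simp

  have "AE x in lborel. x \<in> ?Reg"
    using rademacher[OF \<phi>] assms(5)
  proof eventually_elim
    case (elim x)
    then obtain D where D: "(\<phi> has_derivative D) (at x)" by (auto simp: differentiable_def)
    have lin: "linear D" by (rule has_derivative_linear[OF D])
    have "jacobian \<phi> (at x) = matrix D"
      unfolding jacobian_def using frechet_derivative_at[OF D] by simp
    then have "inj ((*v) (matrix D))" using elim(2) full_rank_injective by metis
    moreover have "(*v) (matrix D) = D" using lin by (simp add: fun_eq_iff matrix_works)
    ultimately show ?case using D by auto
  qed
  then obtain N0 where N0': "N0 \<in> null_sets lborel" "{x \<in> space lborel. \<not> x \<in> ?Reg} \<subseteq> N0"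
    unfolding eventually_ae_filter by blast
  have N0: "N0 \<in> null_sets lborel" "- ?Reg \<subseteq> N0"
    using N0' by auto

  have one_less_two: "1 < (2::real)" by simp
  (* Any t > 1 would do: the pieces serve only to make phi injective. *)
  obtain E :: "nat \<Rightarrow> (real^'k) set" where E: "disjoint_family E" "\<And>j. E j \<in> sets borel" "?Reg \<subseteq> (\<Union>j. E j)"
    "\<And>j. \<exists>S Q m z. linear S \<and> inj S \<and> linear Q \<and> (\<forall>y. norm (Q y) \<le> norm y) \<and>
       E j \<subseteq> near_linear_set \<phi> S Q 2 m \<and> E j \<subseteq> ball z (1 / (2 * real (Suc m)))"
    using near_linear_decomposition[OF cont one_less_two] by blast
  have inj_E: "inj_on \<phi> (E j)" for j
  proof -
    obtain S :: "real^'k \<Rightarrow> real^'k" and Q m z where S: "linear S" "inj S" and Q: "linear Q" and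
       sub: "E j \<subseteq> near_linear_set \<phi> S Q 2 m" "E j \<subseteq> ball z (1 / (2 * real (Suc m)))"
      using E(4)[of j] by blast
    show ?thesis by (rule near_linear_set_inj_on(1)[OF sub S Q])
  qed
  have "\<exists>C. fsigma C \<and> C \<subseteq> E j - N0 \<and> (E j - N0) - C \<in> null_sets lebesgue" for j
  proof -
    have "E j - N0 \<in> sets lebesgue" using E(2)[of j] null_setsD2[OF N0(1)] by auto
    then show ?thesis using lebesgue_fsigma_subset by blast
  qed
  then obtain C where C: "\<And>j. fsigma (C j)" "\<And>j. C j \<subseteq> E j - N0" "\<And>j. (E j - N0) - C j \<in> null_sets lebesgue"
    by metis
  have disj_C: "disjoint_family C"
    using E(1) C(2) unfolding disjoint_family_on_def by blast
  have inj_C: "inj_on \<phi> (C j)" for j by (rule inj_on_subset[OF inj_E[of j]]) (use C(2) in blast)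
  have reg_C: "\<exists>D. (\<phi> has_derivative D) (at x) \<and> inj D" if "x \<in> C j" for x j
    using that C(2) N0(2) by blast
  have Cb[measurable]: "C j \<in> sets borel" for j by (rule fsigma_imp_borel[OF C(1)])
  have imC[measurable]: "\<phi> ` C j \<in> sets borel" for j
    by (rule fsigma_continuous_image_borel[OF C(1) continuous_on_subset[OF cont]]) simp
  have null_rest: "- (\<Union>j. C j) \<in> null_sets lebesgue"
  proof (rule null_sets_completion_subset)
    show "- (\<Union>j. C j) \<subseteq> N0 \<union> (\<Union>j. (E j - N0) - C j)" using N0(2) E(3) by blast
    show "N0 \<union> (\<Union>j. (E j - N0) - C j) \<in> null_sets lebesgue"
      using N0(1) C(3) by (intro null_sets.Un null_sets_UN) (auto intro: null_sets_completionI)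
  qed

  define \<psi> where "\<psi> j y = (if y \<in> \<phi> ` C j then the_inv_into (C j) \<phi> y else 0)" for j y
  have \<psi>[measurable]: "\<psi> j \<in> borel_measurable borel" for j
    unfolding \<psi>_def[abs_def] by (rule borel_measurable_inverse_on_image[OF cont C(1) inj_C])
  (* Where y has no preimage in C j the indicator removes the junk value of psi j. *)
  define g0 where "g0 y = (\<Sum>j. indicator (\<phi> ` C j) y * (f (\<psi> j y) * ennreal (1 / ?J (\<psi> j y))))" for y
  have g0[measurable]: "g0 \<in> borel_measurable borel" unfolding g0_def[abs_def] by measurable
  have g0_outside: "g0 y = 0" if "y \<notin> range \<phi>" for y
  proof -
    have "y \<notin> \<phi> ` C j" for j using that by blast
    then show ?thesis by (simp add: g0_def)
  qed

  have RN: "emeasure ?Y A = (\<integral>\<^sup>+y\<in>A. g0 y \<partial>?H)" if A[measurable]: "A \<in> sets borel" for A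
  proof -
    have pre: "\<phi> -` A \<in> sets borel" using measurable_sets[OF \<phi>m A] by simp
    have "(\<integral>\<^sup>+y\<in>A. g0 y \<partial>?H) = (\<integral>\<^sup>+y. (\<Sum>j. indicator (\<phi> ` C j) y * (f (\<psi> j y) * ennreal (1 / ?J (\<psi> j y))) * indicator A y) \<partial>?H)"
      by (simp add: g0_def)
    also have "\<dots> = (\<Sum>j. \<integral>\<^sup>+y\<in>A. indicator (\<phi> ` C j) y * (f (\<psi> j y) * ennreal (1 / ?J (\<psi> j y))) \<partial>?H)"
      by (rule nn_integral_suminf) measurable
    also have "\<dots> = (\<Sum>j. \<integral>\<^sup>+x\<in>C j \<inter> \<phi> -` A. f x \<partial>lborel)"
      unfolding \<psi>_def by (intro suminf_cong area_transform_injective[OF \<phi> C(1) inj_C reg_C f A])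
    also have "\<dots> = (\<Sum>j. emeasure (density lborel f) (C j \<inter> \<phi> -` A))"
      using pre by (simp add: emeasure_density)
    also have "\<dots> = emeasure (density lborel f) (\<Union>j. C j \<inter> \<phi> -` A)"
      using pre disj_C by (intro suminf_emeasure) (auto simp: disjoint_family_on_def)
    also have "\<dots> = emeasure (density lborel f) (\<phi> -` A)"
    proof (rule emeasure_eq_AE)
      have "- (\<Union>j. C j) \<in> null_sets lborel"
        using null_rest by (subst (asm) null_sets_completion_iff) auto
      then have "AE x in lborel. x \<in> (\<Union>j. C j)" using AE_not_in by fastforce
      then show "AE x in density lborel f. x \<in> (\<Union>j. C j \<inter> \<phi> -` A) \<longleftrightarrow> x \<in> \<phi> -` A"
        by (subst AE_density) (auto elim: AE_mp)
    qed (use pre in auto)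
    also have "\<dots> = emeasure (distr P lborel X) (\<phi> -` A)" by (simp only: dX)
    also have "\<dots> = emeasure ?Y A"
      using pre by (simp add: emeasure_distr vimage_comp)
    finally show ?thesis by simp
  qed
  have RN0: "is_RN_derivative ?H ?Y g0"
    using RN g0 by (simp add: is_RN_derivative_def)
  have abs_cont: "absolutely_continuous ?H ?Y"
    unfolding absolutely_continuous_def
  proof
    fix A assume A: "A \<in> null_sets ?H"
    then have "emeasure ?Y A = (\<integral>\<^sup>+y. g0 y * indicator A y \<partial>?H)" using RN by (auto dest: null_setsD2)
    also have "\<dots> = 0" using A by (rule nn_integral_null_set)
    finally show "A \<in> null_sets ?Y" using A by (auto simp: null_sets_def)
  qed
  have unique: "AE y in ?H. g y = g0 y" if g: "is_RN_derivative ?H ?Y g" for g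
  proof -
    have gm: "g \<in> borel_measurable ?H" and gA: "\<And>A. A \<in> sets ?H \<Longrightarrow> emeasure ?Y A = (\<integral>\<^sup>+y\<in>A. g y \<partial>?H)"
      using g by (auto simp: is_RN_derivative_def)
    have g0m: "g0 \<in> borel_measurable ?H" using g0 by simp
    have "density ?H g = density ?H g0"
      using gm g0m gA RN by (intro measure_eqI) (auto simp: emeasure_density)
    moreover have "integral\<^sup>N ?H g \<noteq> \<infinity>"
    proof -
      have "emeasure ?Y UNIV = integral\<^sup>N ?H g" using gA[of UNIV] by simp
      moreover have "emeasure ?Y UNIV = 1"
        using emeasure_space_1 by (simp add: emeasure_distr)
      ultimately show ?thesis by simp
    qed
    ultimately show ?thesis using finite_density_unique[OF gm g0m] by simp
  qed
  have fibre_formula: "AE y in ?H. g0 y = infsum ?h (\<phi> -` {y}) \<and>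
     (\<integral>\<^sup>+x\<in>\<phi> -` {y}. ?h x \<partial>hausdorff_measure 0) = infsum ?h (\<phi> -` {y})"
  proof (rule AE_hausdorffI[OF null_image[OF null_rest]])
    fix y assume y: "y \<notin> \<phi> ` (- (\<Union>j. C j))"
    then have sub: "\<phi> -` {y} \<subseteq> (\<Union>j. C j)" by blast
    have single: "x = x'" if "x \<in> C j" "x' \<in> C j" "\<phi> x = y" "\<phi> x' = y" for j x x'
      using that inj_onD[OF inj_C[of j]] by simp
    have "g0 y = (\<Sum>j. if y \<in> \<phi> ` C j then ?h (the_inv_into (C j) \<phi> y) else 0)"
      unfolding g0_def
    proof (rule suminf_cong)
      fix j
      show "indicator (\<phi> ` C j) y * (f (\<psi> j y) * ennreal (1 / ?J (\<psi> j y))) =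
          (if y \<in> \<phi> ` C j then ?h (the_inv_into (C j) \<phi> y) else 0)"
      proof (cases "y \<in> \<phi> ` C j")
        case True
        then have "the_inv_into (C j) \<phi> y \<in> C j" by (rule the_inv_into_into[OF inj_C]) simp
        then have "?J (the_inv_into (C j) \<phi> y) = k_jacobian \<phi> (the_inv_into (C j) \<phi> y)"
          using reg_C jacobian_version_eq by blast
        then show ?thesis using True by (simp add: \<psi>_def)
      qed simp
    qed
    also have "\<dots> = infsum ?h (\<phi> -` {y})"
      by (rule infsum_fibre[OF disj_C sub single, symmetric])
    finally have "g0 y = infsum ?h (\<phi> -` {y})" .
    moreover have "(\<integral>\<^sup>+x\<in>\<phi> -` {y}. ?h x \<partial>hausdorff_measure 0) = infsum ?h (\<phi> -` {y})"
      by (rule nn_integral_hausdorff_0_fibre[OF disj_C sub single])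
    ultimately show "g0 y = infsum ?h (\<phi> -` {y}) \<and>
        (\<integral>\<^sup>+x\<in>\<phi> -` {y}. ?h x \<partial>hausdorff_measure 0) = infsum ?h (\<phi> -` {y})"
      by (rule conjI)
  qed
  have partition_formula: "AE y in ?H. infsum ?h (\<phi> -` {y}) =
      (\<Sum>i. if y \<in> \<phi> ` F i then ?h (the_inv_into (F i) \<phi> y) else 0)"
    if F: "disjoint_family F" "- (\<Union>i. F i) \<in> null_sets lebesgue" "\<forall>i. ae_inj_on \<phi> (F i)"
    for F :: "nat \<Rightarrow> (real^'k) set"
  proof -
    obtain N where N: "\<And>i. N i \<in> null_sets lebesgue" "\<And>i. inj_on \<phi> (F i - N i)"
      using F(3) unfolding ae_inj_on_def by metis
    have "- (\<Union>i. F i) \<union> (\<Union>i. N i) \<in> null_sets lebesgue"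
      using F(2) N(1) by (intro null_sets.Un null_sets_UN) auto
    then show ?thesis
    proof (rule AE_hausdorffI[OF null_image])
      fix y assume "y \<notin> \<phi> ` (- (\<Union>i. F i) \<union> (\<Union>i. N i))"
      then have y: "\<phi> -` {y} \<subseteq> (\<Union>i. F i)" "\<And>x i. \<phi> x = y \<Longrightarrow> x \<notin> N i" by blast+
      show "infsum ?h (\<phi> -` {y}) = (\<Sum>i. if y \<in> \<phi> ` F i then ?h (the_inv_into (F i) \<phi> y) else 0)"
      proof (rule infsum_fibre[OF F(1) y(1)])
        fix i x x' assume "x \<in> F i" "x' \<in> F i" "\<phi> x = y" "\<phi> x' = y"
        then show "x = x'" using y(2) inj_onD[OF N(2)[of i], of x x'] by simp
      qed
    qed
  qed
  show ?thesis
  proof (intro conjI allI impI)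
    show "absolutely_continuous ?H ?Y" by (rule abs_cont)
    show "\<exists>g. is_RN_derivative ?H ?Y g \<and> (\<forall>y. y \<notin> range \<phi> \<longrightarrow> g y = 0)"
      using RN0 g0_outside by blast
  next
    fix g
    assume g: "is_RN_derivative ?H ?Y g"
    show "AE y in ?H. (y \<in> range \<phi> \<longrightarrow>
              g y = (\<integral>\<^sup>+x\<in>\<phi> -` {y}. ?h x \<partial>hausdorff_measure 0) \<and> g y = infsum ?h (\<phi> -` {y})) \<and>
           (y \<notin> range \<phi> \<longrightarrow> g y = 0)"
      using unique[OF g] fibre_formula by eventually_elim (auto simp: g0_outside)
    fix F :: "nat \<Rightarrow> (real^'k) set"
    assume F: "disjoint_family F \<and> (\<forall>i. F i \<in> sets lebesgue) \<and> - (\<Union>i. F i) \<in> null_sets lebesgue \<and> (\<forall>i. ae_inj_on \<phi> (F i))"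
    show "AE y in ?H. y \<in> range \<phi> \<longrightarrow>
        g y = (\<Sum>i. if y \<in> \<phi> ` F i then ?h (the_inv_into (F i) \<phi> y) else 0)"
    proof -
      have "AE y in ?H. infsum ?h (\<phi> -` {y}) = (\<Sum>i. if y \<in> \<phi> ` F i then ?h (the_inv_into (F i) \<phi> y) else 0)"
        using F by (intro partition_formula) auto
      with unique[OF g] fibre_formula show ?thesis by eventually_elim simp
    qed
  qed
qed

end
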